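(* Let $d\ge1$ and let $W=(W^{(1)}_{s,t},\dots,W^{(d)}_{s,t};\,(s,t)\in[0,1]^2)$ be an $\mathbb{R}^d$-valued Brownian sheet. Let $g\in\mathcal{C}^0\big([0,1]^2,\mathcal{C}^1(\mathbb{R}^{2d})\big)$ be such that there exists $\kappa>0$ satisfying $$|g(s,t,x,y)|\le\kappa|y|\quad\text{for all }(s,t,x,y)\in[0,1]^2\times\mathbb{R}^{2d}.$$ Let $(a,\varepsilon)\in[0,1)\times(0,1)$ be such that $a+\varepsilon\le1$. Then there exist positive constants $\alpha$ and $C$ such that for all $(s,s',y)\in\,]0,1]^2\times\mathbb{R}^d$ with $s\le s'$ and $(s'-s,y)\ne(0,0,\dots,0)$, and all $i\in\{1,\dots,d\}$, $$\mathbb{E}\Big[\exp\Big(\frac{\alpha\sqrt{\varepsilon s}}{|y|+\sqrt{s'-s}}\Big|\int_0^1\partial_{x_i}g\big(s,t,\widetilde W^{\varepsilon}_{s,t},\,y+W^{\varepsilon}_{s',t}-W^{\varepsilon}_{s,t}\big)\,\mathrm{d}t\Big|\Big)\Big]\le C .$$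
   Context: A one-dimensional Brownian sheet is a centered continuous Gaussian process with covariance $(s\wedge s')(t\wedge t')$; an $\mathbb{R}^d$-valued Brownian sheet has independent one-dimensional Brownian sheets as components. $|\cdot|$ is the maximum norm on $\mathbb{R}^d$. For $g=g(s,t,x,y)$ with $x,y\in\mathbb{R}^d$, $\partial_{x_i}g$ is the partial derivative with respect to the $i$-th component of the third variable $x$. The processes $W^{\varepsilon}=(W^{(\varepsilon,1)},\dots,W^{(\varepsilon,d)})$ and $\widetilde W^{\varepsilon}=(\widetilde W^{(\varepsilon,1)},\dots,\widetilde W^{(\varepsilon,d)})$ on $[0,1]^2$ are given by $W^{(\varepsilon,i)}_{s,t}=W^{(i)}_{s,a+\varepsilon t}$ and $\widetilde W^{(\varepsilon,i)}_{s,t}=W^{(i)}_{s,a+\varepsilon t}-W^{(i)}_{s,a}$. *)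

theory Defs
  imports "HOL-Probability.Probability"
begin

abbreviation unit_square :: "(real \<times> real) set" where
  "unit_square \<equiv> {0..1} \<times> {0..1}"

(* Constants count as (degenerate) Gaussian variables; the Brownian sheet vanishes on the axes. *)
definition gaussian_rv :: "'w measure \<Rightarrow> ('w \<Rightarrow> real) \<Rightarrow> bool" where
  "gaussian_rv M X \<longleftrightarrow> X \<in> borel_measurable M \<and>
     (\<exists>\<mu>. (AE \<omega> in M. X \<omega> = \<mu>) \<or>
          (\<exists>\<sigma>>0. distributed M lborel X (\<lambda>x. ennreal (normal_density \<mu> \<sigma> x))))"

definition gaussian_process :: "'w measure \<Rightarrow> 't set \<Rightarrow> ('t \<Rightarrow> 'w \<Rightarrow> real) \<Rightarrow> bool" where
  "gaussian_process M T X \<longleftrightarrow>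
     (\<forall>F c. finite F \<and> F \<subseteq> T \<longrightarrow> gaussian_rv M (\<lambda>\<omega>. \<Sum>p\<in>F. c p * X p \<omega>))"

definition brownian_sheet_real :: "'w measure \<Rightarrow> (real \<times> real \<Rightarrow> 'w \<Rightarrow> real) \<Rightarrow> bool" where
  "brownian_sheet_real M X \<longleftrightarrow>
     gaussian_process M unit_square X \<and>
     (\<forall>p\<in>unit_square. integral\<^sup>L M (X p) = 0) \<and>
     (\<forall>s\<in>{0..1}. \<forall>t\<in>{0..1}. \<forall>s'\<in>{0..1}. \<forall>t'\<in>{0..1}.
        integral\<^sup>L M (\<lambda>\<omega>. X (s, t) \<omega> * X (s', t') \<omega>) = min s s' * min t t') \<and>
     (\<forall>\<omega>\<in>space M. continuous_on unit_square (\<lambda>p. X p \<omega>))"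

(* Independence is that of the component processes, i.e. of random elements of the
   product space indexed by the unit square. *)
definition brownian_sheet ::
    "'w measure \<Rightarrow> (real \<times> real \<Rightarrow> 'w \<Rightarrow> real ^ 'd) \<Rightarrow> bool" where
  "brownian_sheet M W \<longleftrightarrow>
     (\<forall>i. brownian_sheet_real M (\<lambda>p \<omega>. W p \<omega> $ i)) \<and>
     prob_space.indep_vars M (\<lambda>_. \<Pi>\<^sub>M p\<in>unit_square. (borel :: real measure))
       (\<lambda>i \<omega>. \<lambda>p\<in>unit_square. W p \<omega> $ i) UNIV"

(* C^0(T, C^1(E)), where C^1(E) carries its usual Frechet topology: uniform convergence on
   compact sets of the functions and of their first derivatives. *)
definition continuous_into_C1 ::
    "'p::topological_space set \<Rightarrow> ('p \<Rightarrow> 'a::euclidean_space \<Rightarrow> real) \<Rightarrow> bool" where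
  "continuous_into_C1 T g \<longleftrightarrow>
     (\<exists>Dg :: 'p \<Rightarrow> 'a \<Rightarrow> 'a \<Rightarrow>\<^sub>L real.
        (\<forall>p\<in>T. (\<forall>z. (g p has_derivative blinfun_apply (Dg p z)) (at z)) \<and>
               continuous_on UNIV (Dg p)) \<and>
        (\<forall>p\<in>T. \<forall>K. compact K \<longrightarrow>
           uniform_limit K g (g p) (at p within T) \<and>
           uniform_limit K Dg (Dg p) (at p within T)))"

definition partial_x ::
    "'d \<Rightarrow> (real \<times> real \<Rightarrow> (real ^ 'd) \<times> (real ^ 'd) \<Rightarrow> real) \<Rightarrow>
     real \<times> real \<Rightarrow> (real ^ 'd) \<times> (real ^ 'd) \<Rightarrow> real" where
  "partial_x i g p z = deriv (\<lambda>h. g p (fst z + h *\<^sub>R axis i 1, snd z)) 0"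

definition W_eps ::
    "(real \<times> real \<Rightarrow> 'w \<Rightarrow> real ^ 'd) \<Rightarrow> real \<Rightarrow> real \<Rightarrow> real \<times> real \<Rightarrow> 'w \<Rightarrow> real ^ 'd" where
  "W_eps W a \<epsilon> p \<omega> = W (fst p, a + \<epsilon> * snd p) \<omega>"

definition W_tilde ::
    "(real \<times> real \<Rightarrow> 'w \<Rightarrow> real ^ 'd) \<Rightarrow> real \<Rightarrow> real \<Rightarrow> real \<times> real \<Rightarrow> 'w \<Rightarrow> real ^ 'd" where
  "W_tilde W a \<epsilon> p \<omega> = W (fst p, a + \<epsilon> * snd p) \<omega> - W (fst p, a) \<omega>"

end

theory Submission
  imports Defs
begin

text \<open>
  Fix \<open>s \<le> s'\<close>, \<open>y\<close> and the coordinate \<open>i\<close>. In the variable \<open>t\<close>, \<open>B t = W_tilde W a \<epsilon> (s, t)\<close> is a Brownian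
  motion with variance \<open>v = \<epsilon> * s\<close> per unit of time, and it is independent of
  \<open>Z t = W_eps W a \<epsilon> (s', t) - W_eps W a \<epsilon> (s, t)\<close>, whose coordinates have variance at most \<open>s' - s\<close>. The
  derivative of \<open>g\<close> is not under control, only \<open>g\<close> itself is. The derivative is removed by the identity
  that quadratic covariation provides: with \<open>h t x = g (s, t) (x, y + Z t)\<close>, the integral of \<open>\<partial>\<^sub>i h t (B t)\<close>
  times \<open>v\<close> is the limit of the sums of \<open>(h (B after the step) - h (B before the step))\<close> times the increment
  of coordinate \<open>i\<close>, taken over dyadic partitions, where only the coordinate \<open>i\<close> is moved
  (\<open>path_covariation_tendsto\<close>, together with \<open>AE_dyadic_quadratic_variation\<close>).

  These sums contain no derivative. Their part with the value before the step is a martingale transform of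
  Gaussian increments. In the part with the value after the step each increment is split into its regression
  on the endpoint of the step and an innovation that is independent of the future; the innovations
  give a martingale transform in reversed time and the regression gives a drift of integrable size
  \<open>|B t| / t\<close>. A transform with coefficients \<open>c\<close> has exponential moments as soon as the sum of
  \<open>c\<^sup>2\<close> does (\<open>nn_integral_exp_transform_le\<close>), and \<open>|h|\<close> is at most a multiple of the norm of \<open>y + Z\<close>,
  which is Gaussian of the scale \<open>D = |y| + sqrt (s' - s)\<close>. Since \<open>\<alpha>\<close> is small, all Gaussian squares that
  occur are exponentially integrable. This gives a bound that is uniform in the partition and in the
  parameters (\<open>nn_integral_exp_walk\<close>), and Fatou's lemma concludes.

  Independence enters through one fact: in a vector space of centered Gaussian variables, a variable is
  independent of the sigma-algebra generated by all members uncorrelated with it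
  (\<open>nn_integral_orth_algebra\<close>).
\<close>

section \<open>Centered Gaussian variables on the line\<close>

text \<open>The centered Gaussian law of variance \<^term>\<open>v\<close>, as the image of the standard normal law under scaling,
  so that \<^term>\<open>v = 0\<close> gives the point mass at \<open>0\<close>.\<close>

abbreviation centered_normal :: "real \<Rightarrow> real measure" where
  "centered_normal v \<equiv> distr std_normal_distribution borel (\<lambda>x. sqrt v * x)"

lemma prob_space_std_normal: "prob_space std_normal_distribution"
  by (rule prob_space_normal_density) simp

lemma real_distribution_centered_normal: "real_distribution (centered_normal v)"
proof -
  interpret N: prob_space std_normal_distribution by (rule prob_space_std_normal)
  show ?thesis
    by (rule N.real_distribution_distr) simp
qed

lemma char_centered_normal:
  assumes "0 \<le> v"
  shows "char (centered_normal v) t = complex_of_real (exp (- (t\<^sup>2 * v) / 2))"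
proof -
  have "char (centered_normal v) t = char std_normal_distribution (t * sqrt v)"
    unfolding char_def by (subst integral_distr) (auto simp: mult.assoc)
  also have "\<dots> = complex_of_real (exp (- (t\<^sup>2 * v) / 2))"
    using assms by (simp add: char_std_normal_distribution power_mult_distrib)
  finally show ?thesis .
qed

lemma nn_integral_exp_square_std_normal:
  assumes "b \<le> 1/4"
  shows "(\<integral>\<^sup>+x. ennreal (exp (b * x\<^sup>2)) \<partial>std_normal_distribution) \<le> 2"
proof -
  have "(\<integral>\<^sup>+x. ennreal (exp (b * x\<^sup>2)) \<partial>std_normal_distribution)
      \<le> (\<integral>\<^sup>+x. ennreal (exp (x\<^sup>2 / 4)) \<partial>std_normal_distribution)"
    using mult_right_mono[OF assms zero_le_power2] by (intro nn_integral_mono) (simp add: ennreal_leI)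
  also have "\<dots> = (\<integral>\<^sup>+x. ennreal (std_normal_density x) * ennreal (exp (x\<^sup>2 / 4)) \<partial>lborel)"
    by (subst nn_integral_density) (auto simp: normal_density_nonneg)
  also have "\<dots> = (\<integral>\<^sup>+x. ennreal (sqrt 2) * ennreal (normal_density 0 (sqrt 2) x) \<partial>lborel)"
  proof (intro nn_integral_cong)
    fix x :: real
    have "- x\<^sup>2 / 2 + x\<^sup>2 / 4 = - (x\<^sup>2) / 4" by simp
    then have "exp (- x\<^sup>2 / 2) * exp (x\<^sup>2 / 4) = exp (- (x\<^sup>2) / 4)"
      by (simp flip: exp_add)
    then have "std_normal_density x * exp (x\<^sup>2 / 4) = sqrt 2 * normal_density 0 (sqrt 2) x"
      by (simp add: normal_density_def std_normal_density_def real_sqrt_mult field_simps)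
    then show "ennreal (std_normal_density x) * ennreal (exp (x\<^sup>2 / 4))
        = ennreal (sqrt 2) * ennreal (normal_density 0 (sqrt 2) x)"
      by (simp add: ennreal_mult[symmetric] normal_density_nonneg)
  qed
  also have "\<dots> = ennreal (sqrt 2) * (\<integral>\<^sup>+x. ennreal (normal_density 0 (sqrt 2) x) \<partial>lborel)"
    by (subst nn_integral_cmult) (auto simp: normal_density_nonneg)
  also have "(\<integral>\<^sup>+x. ennreal (normal_density 0 (sqrt 2) x) \<partial>lborel) = 1"
    by (subst nn_integral_eq_integral) (auto simp: normal_density_nonneg integral_normal_density)
  also have "ennreal (sqrt 2) * 1 \<le> 2"
    using sqrt2_less_2 by (simp add: ennreal_le_iff2 flip: ennreal_numeral)
  finally show ?thesis .
qed

lemma nn_integral_exp_std_normal: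
  "(\<integral>\<^sup>+x. ennreal (exp (c * x - c\<^sup>2 / 2)) \<partial>std_normal_distribution) = 1"
proof -
  have "(\<integral>\<^sup>+x. ennreal (exp (c * x - c\<^sup>2 / 2)) \<partial>std_normal_distribution)
     = (\<integral>\<^sup>+x. ennreal (normal_density c 1 x) \<partial>lborel)"
  proof (subst nn_integral_density, simp, simp, intro nn_integral_cong)
    fix x :: real
    have "- x\<^sup>2 / 2 + (c * x - c\<^sup>2 / 2) = - (x - c)\<^sup>2 / 2"
      by (simp add: power2_eq_square field_simps)
    then have "exp (- x\<^sup>2 / 2) * exp (c * x - c\<^sup>2 / 2) = exp (- (x - c)\<^sup>2 / 2)"
      by (metis exp_add)
    then have "std_normal_density x * exp (c * x - c\<^sup>2 / 2) = normal_density c 1 x"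
      by (simp add: normal_density_def std_normal_density_def field_simps)
    then show "ennreal (std_normal_density x) * ennreal (exp (c * x - c\<^sup>2 / 2))
       = ennreal (normal_density c 1 x)"
      by (simp add: ennreal_mult[symmetric] normal_density_nonneg)
  qed
  also have "\<dots> = 1"
    by (subst nn_integral_eq_integral) (auto simp: normal_density_nonneg integral_normal_density)
  finally show ?thesis .
qed

section \<open>Gaussian spaces\<close>

text \<open>A vector space of random variables each of which is centered Gaussian (possibly degenerate).
  Joint Gaussianity is encoded by closure under linear combinations. Elements are functions and not
  almost sure equivalence classes.\<close>

locale gaussian_space = prob_space M for M :: "'w measure" +
  fixes H :: "('w \<Rightarrow> real) set"
  assumes add_mem: "X \<in> H \<Longrightarrow> Y \<in> H \<Longrightarrow> (\<lambda>\<omega>. X \<omega> + Y \<omega>) \<in> H"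
    and scale_mem: "X \<in> H \<Longrightarrow> (\<lambda>\<omega>. c * X \<omega>) \<in> H"
    and zero_mem: "(\<lambda>\<omega>. 0) \<in> H"
    and measurable_mem [measurable_dest]: "X \<in> H \<Longrightarrow> X \<in> borel_measurable M"
    and law: "X \<in> H \<Longrightarrow> distr M borel X = centered_normal (expectation (\<lambda>\<omega>. (X \<omega>)\<^sup>2))"
begin

lemma diff_mem: "X \<in> H \<Longrightarrow> Y \<in> H \<Longrightarrow> (\<lambda>\<omega>. X \<omega> - Y \<omega>) \<in> H"
  using add_mem[OF _ scale_mem[of Y "-1"], of X] by simp

lemma sum_mem: "(\<And>j. j \<in> J \<Longrightarrow> X j \<in> H) \<Longrightarrow> (\<lambda>\<omega>. \<Sum>j\<in>J. X j \<omega>) \<in> H"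
  by (induction J rule: infinite_finite_induct) (auto intro: add_mem zero_mem)

definition cov :: "('w \<Rightarrow> real) \<Rightarrow> ('w \<Rightarrow> real) \<Rightarrow> real" where
  "cov X Y = expectation (\<lambda>\<omega>. X \<omega> * Y \<omega>)"

lemma nn_integral_law:
  assumes "X \<in> H" and [measurable]: "f \<in> borel_measurable borel"
  shows "(\<integral>\<^sup>+\<omega>. f (X \<omega>) \<partial>M) = (\<integral>\<^sup>+x. f (sqrt (cov X X) * x) \<partial>std_normal_distribution)"
proof -
  have [measurable]: "X \<in> borel_measurable M" using assms(1) by (rule measurable_mem)
  have "(\<integral>\<^sup>+\<omega>. f (X \<omega>) \<partial>M) = integral\<^sup>N (distr M borel X) f"
    by (simp add: nn_integral_distr)
  also have "\<dots> = (\<integral>\<^sup>+x. f (sqrt (cov X X) * x) \<partial>std_normal_distribution)"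
    unfolding law[OF assms(1)] by (simp add: nn_integral_distr power2_eq_square cov_def)
  finally show ?thesis .
qed

lemma cov_self_nonneg: "0 \<le> cov X X"
  by (simp add: cov_def)

lemma cov_commute: "cov X Y = cov Y X"
  by (simp add: cov_def mult.commute)

lemma
  assumes "X \<in> H"
  shows integrable_power: "integrable M (\<lambda>\<omega>. X \<omega> ^ n)"
    and expectation_power4: "expectation (\<lambda>\<omega>. X \<omega> ^ 4) = 3 * (cov X X)\<^sup>2"
proof -
  have [measurable]: "X \<in> borel_measurable M" using assms by (rule measurable_mem)
  let ?v = "cov X X"
  have "integrable (distr M borel X) (\<lambda>x. x ^ n)"
    unfolding law[OF assms]
    by (subst integrable_distr_eq)
       (auto simp: power_mult_distrib intro!: integrable_mult_right integrable_std_normal_distribution_moment)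
  then show "integrable M (\<lambda>\<omega>. X \<omega> ^ n)"
    by (subst (asm) integrable_distr_eq) auto
  have "expectation (\<lambda>\<omega>. X \<omega> ^ 4) = (\<integral>x. x ^ 4 \<partial>distr M borel X)"
    by (subst integral_distr) auto
  also have "\<dots> = (\<integral>x. (sqrt ?v * x) ^ 4 \<partial>std_normal_distribution)"
    unfolding law[OF assms] by (subst integral_distr) (auto simp: power2_eq_square cov_def)
  also have "\<dots> = ?v\<^sup>2 * 3"
  proof -
    have "(sqrt ?v * x) ^ 4 = ?v\<^sup>2 * x ^ 4" for x
    proof -
      have "(sqrt ?v) ^ 4 = ((sqrt ?v)\<^sup>2)\<^sup>2"
        using power_mult[of "sqrt ?v" 2 2] by simp
      also have "\<dots> = ?v\<^sup>2"
        using cov_self_nonneg[of X] by (subst real_sqrt_pow2) auto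
      finally show ?thesis by (simp only: power_mult_distrib)
    qed
    moreover have "(LINT x|std_normal_distribution. x ^ (2 * 2)) = 3"
      by (subst std_normal_distribution_even_moments(1)) (simp add: fact_numeral)
    ultimately show ?thesis by simp
  qed
  finally show "expectation (\<lambda>\<omega>. X \<omega> ^ 4) = 3 * ?v\<^sup>2" by simp
qed

lemma integrable_mult_mem:
  assumes "X \<in> H" "Y \<in> H"
  shows "integrable M (\<lambda>\<omega>. X \<omega> * Y \<omega>)"
proof -
  have "(\<lambda>\<omega>. X \<omega> * Y \<omega>) = (\<lambda>\<omega>. ((X \<omega> + Y \<omega>) ^ 2 - X \<omega> ^ 2 - Y \<omega> ^ 2) / 2)"
    by (auto simp: power2_sum)
  then show ?thesis
    using integrable_power[OF add_mem[OF assms], of 2] integrable_power[OF assms(1), of 2]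
      integrable_power[OF assms(2), of 2] by simp
qed

lemma cov_add_left: "X \<in> H \<Longrightarrow> Y \<in> H \<Longrightarrow> Z \<in> H \<Longrightarrow> cov (\<lambda>\<omega>. X \<omega> + Y \<omega>) Z = cov X Z + cov Y Z"
  by (simp add: cov_def distrib_right integrable_mult_mem)

lemma cov_add_right: "X \<in> H \<Longrightarrow> Y \<in> H \<Longrightarrow> Z \<in> H \<Longrightarrow> cov Z (\<lambda>\<omega>. X \<omega> + Y \<omega>) = cov Z X + cov Z Y"
  by (simp add: cov_def distrib_left integrable_mult_mem)

lemma cov_diff_left: "X \<in> H \<Longrightarrow> Y \<in> H \<Longrightarrow> Z \<in> H \<Longrightarrow> cov (\<lambda>\<omega>. X \<omega> - Y \<omega>) Z = cov X Z - cov Y Z"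
  by (simp add: cov_def left_diff_distrib integrable_mult_mem)

lemma cov_diff_right: "X \<in> H \<Longrightarrow> Y \<in> H \<Longrightarrow> Z \<in> H \<Longrightarrow> cov Z (\<lambda>\<omega>. X \<omega> - Y \<omega>) = cov Z X - cov Z Y"
  by (simp add: cov_def right_diff_distrib integrable_mult_mem)

lemma cov_scale_left: "cov (\<lambda>\<omega>. c * X \<omega>) Z = c * cov X Z"
  by (simp add: cov_def mult.assoc)

lemma cov_scale_right: "cov Z (\<lambda>\<omega>. c * X \<omega>) = c * cov Z X"
  by (simp add: cov_def mult.left_commute)

lemma cov_sum_right:
  assumes "X \<in> H" "\<And>j. j \<in> J \<Longrightarrow> Y j \<in> H"
  shows "cov X (\<lambda>\<omega>. \<Sum>j\<in>J. Y j \<omega>) = (\<Sum>j\<in>J. cov X (Y j))"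
  using assms by (simp add: cov_def sum_distrib_left integrable_mult_mem)

lemma expectation_iexp:
  assumes "X \<in> H"
  shows "(CLINT \<omega>|M. iexp (X \<omega>)) = complex_of_real (exp (- cov X X / 2))"
proof -
  have [measurable]: "X \<in> borel_measurable M" using assms by (rule measurable_mem)
  have "(CLINT \<omega>|M. iexp (X \<omega>)) = char (distr M borel X) 1"
    unfolding char_def by (subst integral_distr) auto
  also have "\<dots> = complex_of_real (exp (- cov X X / 2))"
    unfolding law[OF assms] using cov_self_nonneg[of X]
    by (subst char_centered_normal) (auto simp: power2_eq_square cov_def)
  finally show ?thesis .
qed

lemma nn_integral_exp_square_le:
  assumes "X \<in> H" "b * cov X X \<le> 1/4"
  shows "(\<integral>\<^sup>+\<omega>. ennreal (exp (b * (X \<omega>)\<^sup>2)) \<partial>M) \<le> 2"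
proof -
  have "(\<integral>\<^sup>+\<omega>. ennreal (exp (b * (X \<omega>)\<^sup>2)) \<partial>M)
     = (\<integral>\<^sup>+x. ennreal (exp (b * (sqrt (cov X X) * x)\<^sup>2)) \<partial>std_normal_distribution)"
    by (subst nn_integral_law[OF assms(1), of "\<lambda>x. ennreal (exp (b * x\<^sup>2))"]) auto
  also have "\<dots> = (\<integral>\<^sup>+x. ennreal (exp ((b * cov X X) * x\<^sup>2)) \<partial>std_normal_distribution)"
    using cov_self_nonneg[of X] by (simp add: power_mult_distrib mult.assoc)
  also have "\<dots> \<le> 2"
    by (rule nn_integral_exp_square_std_normal[OF assms(2)])
  finally show ?thesis .
qed

lemma nn_integral_exp_compensated:
  assumes "X \<in> H"
  shows "(\<integral>\<^sup>+\<omega>. ennreal (exp (c * X \<omega> - c\<^sup>2 * cov X X / 2)) \<partial>M) = 1"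
proof -
  have "(\<integral>\<^sup>+\<omega>. ennreal (exp (c * X \<omega> - c\<^sup>2 * cov X X / 2)) \<partial>M)
     = (\<integral>\<^sup>+x. ennreal (exp (c * (sqrt (cov X X) * x) - c\<^sup>2 * cov X X / 2)) \<partial>std_normal_distribution)"
    by (subst nn_integral_law[OF assms(1), of "\<lambda>x. ennreal (exp (c * x - c\<^sup>2 * cov X X / 2))"]) auto
  also have "\<dots> = (\<integral>\<^sup>+x. ennreal (exp ((c * sqrt (cov X X)) * x - (c * sqrt (cov X X))\<^sup>2 / 2)) \<partial>std_normal_distribution)"
    using cov_self_nonneg[of X] by (simp add: power_mult_distrib mult.assoc)
  also have "\<dots> = 1"
    by (rule nn_integral_exp_std_normal)
  finally show ?thesis .
qed

end

section \<open>Uncorrelated Gaussian variables are independent\<close>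

context prob_space
begin

text \<open>If \<^term>\<open>U\<close> is orthogonal to all characters of \<^term>\<open>Y\<close>, then it is orthogonal to all events
  described by \<^term>\<open>Y\<close>: under the probability measure of density \<open>1 + U\<close> the variable \<^term>\<open>Y\<close> has the same
  characteristic function, hence the same law, as under the original measure.\<close>

lemma expectation_indicator_eq_zero_real:
  fixes U :: "'a \<Rightarrow> real"
  assumes [measurable]: "U \<in> borel_measurable M" "Y \<in> borel_measurable M"
    and bound: "\<And>\<omega>. \<bar>U \<omega>\<bar> \<le> 1"
    and zero: "\<And>t. (CLINT \<omega>|M. complex_of_real (U \<omega>) * iexp (t * Y \<omega>)) = 0"
    and A [measurable]: "A \<in> sets borel"
  shows "expectation (\<lambda>\<omega>. U \<omega> * indicat_real A (Y \<omega>)) = 0"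
proof -
  define Q where "Q = density M (\<lambda>\<omega>. ennreal (1 + U \<omega>))"
  have nonneg: "0 \<le> 1 + U \<omega>" for \<omega>
    using bound[of \<omega>] by (simp add: abs_le_iff)
  have int_U: "integrable M U"
    by (rule integrable_const_bound[of _ 1]) (auto simp: bound)
  have bound_iexp: "integrable M (\<lambda>\<omega>. complex_of_real (U \<omega>) * iexp (t * Y \<omega>))" for t
    by (rule integrable_const_bound[of _ 1]) (auto simp: bound norm_mult)
  have int_iexp: "integrable M (\<lambda>\<omega>. iexp (t * Y \<omega>))" for t
    by (rule integrable_const_bound[of _ 1]) auto
  have "complex_of_real (expectation U) = 0"
    using zero[of 0] by (simp flip: integral_complex_of_real)
  then have EU: "expectation U = 0" by simp
  have "emeasure Q (space M) = (\<integral>\<^sup>+\<omega>. ennreal (1 + U \<omega>) \<partial>M)"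
    unfolding Q_def by (simp add: emeasure_density nn_integral_set_ennreal cong: nn_integral_cong)
  also have "\<dots> = ennreal (expectation (\<lambda>\<omega>. 1 + U \<omega>))"
    using int_U nonneg by (subst nn_integral_eq_integral) auto
  also have "\<dots> = 1" using EU int_U by (simp add: prob_space)
  finally interpret Q: prob_space Q
    by (intro prob_spaceI) (simp add: Q_def)
  have [measurable]: "Y \<in> borel_measurable Q" by (simp add: Q_def)
  have "distr Q borel Y = distr M borel Y"
  proof (rule Levy_uniqueness)
    show "real_distribution (distr Q borel Y)" by (rule Q.real_distribution_distr) simp
    show "real_distribution (distr M borel Y)" by (rule real_distribution_distr) simp
    show "char (distr Q borel Y) = char (distr M borel Y)"
    proof
      fix t
      have "char (distr Q borel Y) t = (CLINT \<omega>|Q. iexp (t * Y \<omega>))"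
        unfolding char_def by (subst integral_distr) auto
      also have "\<dots> = (CLINT \<omega>|M. (1 + U \<omega>) *\<^sub>R iexp (t * Y \<omega>))"
        unfolding Q_def using nonneg by (subst integral_density) auto
      also have "\<dots> = (CLINT \<omega>|M. iexp (t * Y \<omega>) + complex_of_real (U \<omega>) * iexp (t * Y \<omega>))"
        by (intro Bochner_Integration.integral_cong) (auto simp: scaleR_conv_of_real distrib_right)
      also have "\<dots> = (CLINT \<omega>|M. iexp (t * Y \<omega>))"
        using bound_iexp[of t] int_iexp[of t] zero[of t] by simp
      also have "\<dots> = char (distr M borel Y) t"
        unfolding char_def by (subst integral_distr) auto
      finally show "char (distr Q borel Y) t = char (distr M borel Y) t" .
    qed
  qed
  then have "(\<integral>x. indicat_real A x \<partial>distr Q borel Y) = (\<integral>x. indicat_real A x \<partial>distr M borel Y)"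
    by simp
  moreover have "(\<integral>x. indicat_real A x \<partial>distr M borel Y) = expectation (\<lambda>\<omega>. indicat_real A (Y \<omega>))"
    by (subst integral_distr) auto
  moreover have "(\<integral>x. indicat_real A x \<partial>distr Q borel Y) = (\<integral>\<omega>. indicat_real A (Y \<omega>) \<partial>Q)"
    by (subst integral_distr) auto
  moreover have "(\<integral>\<omega>. indicat_real A (Y \<omega>) \<partial>Q) = expectation (\<lambda>\<omega>. (1 + U \<omega>) * indicat_real A (Y \<omega>))"
    unfolding Q_def using nonneg by (subst integral_density) auto
  moreover have "expectation (\<lambda>\<omega>. (1 + U \<omega>) * indicat_real A (Y \<omega>))
      = expectation (\<lambda>\<omega>. indicat_real A (Y \<omega>)) + expectation (\<lambda>\<omega>. U \<omega> * indicat_real A (Y \<omega>))"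
  proof -
    have "integrable M (\<lambda>\<omega>. U \<omega> * indicat_real A (Y \<omega>))"
      by (rule integrable_const_bound[of _ 1]) (auto simp: bound indicator_def)
    moreover have "integrable M (\<lambda>\<omega>. indicat_real A (Y \<omega>))"
      by (rule integrable_const_bound[of _ 1]) (auto simp: indicator_def)
    ultimately show ?thesis by (simp add: distrib_right)
  qed
  ultimately show ?thesis by simp
qed

lemma expectation_indicator_eq_zero:
  fixes U :: "'a \<Rightarrow> complex"
  assumes [measurable]: "U \<in> borel_measurable M" "Y \<in> borel_measurable M"
    and bound: "\<And>\<omega>. norm (U \<omega>) \<le> 1"
    and zero: "\<And>t. (CLINT \<omega>|M. U \<omega> * iexp (t * Y \<omega>)) = 0"
    and A [measurable]: "A \<in> sets borel"
  shows "(CLINT \<omega>|M. U \<omega> * complex_of_real (indicat_real A (Y \<omega>))) = 0"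
proof -
  have int: "integrable M (\<lambda>\<omega>. U \<omega> * iexp (t * Y \<omega>))" for t
    by (rule integrable_const_bound[of _ 1]) (auto simp: bound norm_mult)
  have cnj: "(CLINT \<omega>|M. cnj (U \<omega>) * iexp (t * Y \<omega>)) = 0" for t
  proof -
    have "(CLINT \<omega>|M. cnj (U \<omega>) * iexp (t * Y \<omega>)) = (CLINT \<omega>|M. cnj (U \<omega> * iexp ((- t) * Y \<omega>)))"
      by (intro Bochner_Integration.integral_cong) (auto simp: exp_cnj)
    also have "\<dots> = cnj (CLINT \<omega>|M. U \<omega> * iexp ((- t) * Y \<omega>))"
      by (rule Bochner_Integration.integral_cnj)
    finally show ?thesis using zero[of "- t"] by simp
  qed
  have int': "integrable M (\<lambda>\<omega>. cnj (U \<omega>) * iexp (t * Y \<omega>))" for t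
    using integrable_cnj[OF int[of "- t"]] by (simp add: exp_cnj)
  have "(CLINT \<omega>|M. complex_of_real (Re (U \<omega>)) * iexp (t * Y \<omega>)) = 0" for t
  proof -
    have "(CLINT \<omega>|M. complex_of_real (Re (U \<omega>)) * iexp (t * Y \<omega>))
        = (CLINT \<omega>|M. (U \<omega> * iexp (t * Y \<omega>) + cnj (U \<omega>) * iexp (t * Y \<omega>)) / 2)"
      by (intro Bochner_Integration.integral_cong refl)
         (simp add: complex_add_cnj flip: distrib_right)
    also have "\<dots> = 0"
      using zero[of t] cnj[of t] int[of t] int'[of t] by simp
    finally show ?thesis .
  qed
  then have Re0: "expectation (\<lambda>\<omega>. Re (U \<omega>) * indicat_real A (Y \<omega>)) = 0"
    by (intro expectation_indicator_eq_zero_real) (auto intro: order_trans[OF abs_Re_le_cmod bound])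
  have "(CLINT \<omega>|M. complex_of_real (Im (U \<omega>)) * iexp (t * Y \<omega>)) = 0" for t
  proof -
    have "(CLINT \<omega>|M. complex_of_real (Im (U \<omega>)) * iexp (t * Y \<omega>))
        = (CLINT \<omega>|M. (U \<omega> * iexp (t * Y \<omega>) - cnj (U \<omega>) * iexp (t * Y \<omega>)) / (2 * \<i>))"
      by (intro Bochner_Integration.integral_cong refl)
         (simp add: complex_diff_cnj field_simps flip: left_diff_distrib)
    also have "\<dots> = 0"
      using zero[of t] cnj[of t] int[of t] int'[of t] by simp
    finally show ?thesis .
  qed
  then have Im0: "expectation (\<lambda>\<omega>. Im (U \<omega>) * indicat_real A (Y \<omega>)) = 0"
    by (intro expectation_indicator_eq_zero_real) (auto intro: order_trans[OF abs_Im_le_cmod bound])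
  have "integrable M (\<lambda>\<omega>. U \<omega> * complex_of_real (indicat_real A (Y \<omega>)))"
    by (rule integrable_const_bound[of _ 1]) (auto simp: bound norm_mult indicator_def)
  from integral_Re[OF this] integral_Im[OF this] Re0 Im0 show ?thesis
    by (simp add: complex_eq_iff)
qed

text \<open>The passage to several variables replaces one character after the other by an indicator and absorbs
  the remaining characters into \<^term>\<open>U\<close>. In this way Levy's uniqueness theorem is needed on the line
  only.\<close>

lemma expectation_prod_indicator_eq_zero:
  fixes U :: "'a \<Rightarrow> complex" and Y :: "'j \<Rightarrow> 'a \<Rightarrow> real"
  assumes "finite J"
    and "U \<in> borel_measurable M" "\<And>j. j \<in> J \<Longrightarrow> Y j \<in> borel_measurable M"
    and "\<And>\<omega>. norm (U \<omega>) \<le> 1"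
    and "\<And>\<eta>. (CLINT \<omega>|M. U \<omega> * iexp (\<Sum>j\<in>J. \<eta> j * Y j \<omega>)) = 0"
    and "\<And>j. j \<in> J \<Longrightarrow> A j \<in> sets borel"
  shows "(CLINT \<omega>|M. U \<omega> * complex_of_real (\<Prod>j\<in>J. indicat_real (A j) (Y j \<omega>))) = 0"
  using assms
proof (induction J arbitrary: U rule: finite_induct)
  case empty
  then show ?case by simp
next
  case (insert k J)
  note [measurable] = insert.prems(1)
  have [measurable]: "Y k \<in> borel_measurable M" "A k \<in> sets borel"
    using insert.prems by auto
  have [measurable]: "\<And>j. j \<in> J \<Longrightarrow> Y j \<in> borel_measurable M"
    using insert.prems by auto
  have "(CLINT \<omega>|M. (U \<omega> * complex_of_real (indicat_real (A k) (Y k \<omega>)))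
      * complex_of_real (\<Prod>j\<in>J. indicat_real (A j) (Y j \<omega>))) = 0"
  proof (rule insert.IH)
    show "(\<lambda>\<omega>. U \<omega> * complex_of_real (indicat_real (A k) (Y k \<omega>))) \<in> borel_measurable M"
      by measurable
    show "norm (U \<omega> * complex_of_real (indicat_real (A k) (Y k \<omega>))) \<le> 1" for \<omega>
      using insert.prems(3)[of \<omega>] by (auto simp: norm_mult indicator_def)
    show "(CLINT \<omega>|M. U \<omega> * complex_of_real (indicat_real (A k) (Y k \<omega>))
        * iexp (\<Sum>j\<in>J. \<eta> j * Y j \<omega>)) = 0" for \<eta>
    proof -
      have "(CLINT \<omega>|M. (U \<omega> * iexp (\<Sum>j\<in>J. \<eta> j * Y j \<omega>))
          * complex_of_real (indicat_real (A k) (Y k \<omega>))) = 0"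
      proof (rule expectation_indicator_eq_zero)
        show "norm (U \<omega> * iexp (\<Sum>j\<in>J. \<eta> j * Y j \<omega>)) \<le> 1" for \<omega>
          using insert.prems(3)[of \<omega>] by (simp add: norm_mult)
        fix t
        have "(\<Sum>j\<in>insert k J. (\<eta>(k := t)) j * Y j \<omega>) = (\<Sum>j\<in>J. \<eta> j * Y j \<omega>) + t * Y k \<omega>" for \<omega>
        proof -
          have "(\<Sum>j\<in>J. (\<eta>(k := t)) j * Y j \<omega>) = (\<Sum>j\<in>J. \<eta> j * Y j \<omega>)"
            using insert.hyps by (intro sum.cong) auto
          then show ?thesis using insert.hyps by simp
        qed
        then have eq: "U \<omega> * iexp (\<Sum>j\<in>insert k J. (\<eta>(k := t)) j * Y j \<omega>)
            = U \<omega> * iexp (\<Sum>j\<in>J. \<eta> j * Y j \<omega>) * iexp (t * Y k \<omega>)" for \<omega>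
          by (simp only: of_real_add distrib_left exp_add mult.assoc)
        then show "(CLINT \<omega>|M. U \<omega> * iexp (\<Sum>j\<in>J. \<eta> j * Y j \<omega>) * iexp (t * Y k \<omega>)) = 0"
          using insert.prems(4)[of "\<eta>(k := t)"] by (simp only: eq)
      qed measurable
      then show ?thesis by (simp add: mult_ac)
    qed
  qed (use insert.prems in auto)
  then show ?case
    using insert.hyps by (simp add: mult.assoc)
qed

end

context gaussian_space
begin

text \<open>The events described by finitely many members of the space that are uncorrelated with \<^term>\<open>X\<close>, and
  the sigma-algebra that they generate.\<close>

definition orth_events :: "('w \<Rightarrow> real) \<Rightarrow> 'w set set" where
  "orth_events X = {{\<omega> \<in> space M. \<forall>Y\<in>J. Y \<omega> \<in> A Y} | J A.
      finite J \<and> J \<subseteq> H \<and> (\<forall>Y\<in>J. cov X Y = 0 \<and> A Y \<in> sets borel)}"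

definition orth_algebra :: "('w \<Rightarrow> real) \<Rightarrow> 'w measure" where
  "orth_algebra X = sigma (space M) (orth_events X)"

lemma orth_events_subset: "orth_events X \<subseteq> events"
proof
  fix E assume "E \<in> orth_events X"
  then obtain J A where E: "E = {\<omega> \<in> space M. \<forall>Y\<in>J. Y \<omega> \<in> A Y}" "finite J" "J \<subseteq> H"
      "\<And>Y. Y \<in> J \<Longrightarrow> A Y \<in> sets borel"
    by (auto simp: orth_events_def)
  have [measurable]: "Measurable.pred M (\<lambda>\<omega>. Y \<omega> \<in> A Y)" if "Y \<in> J" for Y
    using measurable_sets[OF measurable_mem E(4)[OF that]] that E(3)
    by (auto simp: pred_def vimage_def Int_def conj_commute)
  show "E \<in> events"
    unfolding E(1) using E(2) by measurable
qed

lemma space_orth_algebra [simp]: "space (orth_algebra X) = space M"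
  using orth_events_subset[of X] sets.space_closed[of M]
  by (auto simp: orth_algebra_def)

lemma sets_orth_algebra: "sets (orth_algebra X) = sigma_sets (space M) (orth_events X)"
  using orth_events_subset[of X] sets.space_closed[of M]
  by (auto simp: orth_algebra_def)

lemma measurable_orth_algebra:
  assumes "Y \<in> H" "cov X Y = 0"
  shows "Y \<in> borel_measurable (orth_algebra X)"
proof (rule measurableI)
  fix A :: "real set" assume "A \<in> sets borel"
  then have "{\<omega> \<in> space M. \<forall>Z\<in>{Y}. Z \<omega> \<in> A} \<in> orth_events X"
    using assms unfolding orth_events_def by (intro CollectI exI[of _ "{Y}"] exI[of _ "\<lambda>_. A"]) auto
  then show "Y -` A \<inter> space (orth_algebra X) \<in> sets (orth_algebra X)"
    by (auto simp: sets_orth_algebra vimage_def Int_def conj_commute)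
qed simp

lemma id_measurable_orth_algebra: "(\<lambda>\<omega>. \<omega>) \<in> measurable M (orth_algebra X)"
  using orth_events_subset[of X]
  by (intro measurableI) (auto simp: sets_orth_algebra Int_absorb2[OF sets.sets_into_space]
        dest: sets.sigma_sets_subset[THEN subsetD, rotated])

lemma Int_stable_orth_events: "Int_stable (orth_events X)"
  unfolding Int_stable_def
proof (intro ballI)
  fix E F assume "E \<in> orth_events X" "F \<in> orth_events X"
  then obtain J A K B where *: "E = {\<omega> \<in> space M. \<forall>Y\<in>J. Y \<omega> \<in> A Y}"
      "F = {\<omega> \<in> space M. \<forall>Y\<in>K. Y \<omega> \<in> B Y}" "finite J" "J \<subseteq> H" "finite K" "K \<subseteq> H"
      "\<forall>Y\<in>J. cov X Y = 0 \<and> A Y \<in> sets borel" "\<forall>Y\<in>K. cov X Y = 0 \<and> B Y \<in> sets borel"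
    unfolding orth_events_def by blast
  define C where "C Y = (if Y \<in> J then A Y else UNIV) \<inter> (if Y \<in> K then B Y else UNIV)" for Y
  have "E \<inter> F = {\<omega> \<in> space M. \<forall>Y\<in>J \<union> K. Y \<omega> \<in> C Y}"
    using * by (auto simp: C_def)
  moreover have "finite (J \<union> K)" "J \<union> K \<subseteq> H" "\<forall>Y\<in>J \<union> K. cov X Y = 0 \<and> C Y \<in> sets borel"
    using * by (auto simp: C_def)
  ultimately show "E \<inter> F \<in> orth_events X"
    unfolding orth_events_def by (intro CollectI exI[of _ "J \<union> K"] exI[of _ C]) simp
qed

text \<open>Uncorrelatedness makes the characteristic function of \<^term>\<open>X\<close> and finitely many members factorise,
  since it is determined by the variances of linear combinations. Hence
  \<open>iexp (t * X) - expectation (iexp (t * X))\<close> is orthogonal to the indicator of every event of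
  \<^term>\<open>orth_events X\<close>, and a second application of the same principle, now to \<^term>\<open>X\<close>, gives the
  product formula.\<close>

lemma prob_orth_event:
  assumes X: "X \<in> H" and E: "E \<in> orth_events X" and B [measurable]: "B \<in> sets borel"
  shows "prob ((X -` B \<inter> space M) \<inter> E) = prob (X -` B \<inter> space M) * prob E"
proof -
  have [measurable]: "X \<in> borel_measurable M" using X by (rule measurable_mem)
  from E obtain J A where E': "E = {\<omega> \<in> space M. \<forall>Y\<in>J. Y \<omega> \<in> A Y}" "finite J" "J \<subseteq> H"
      "\<And>Y. Y \<in> J \<Longrightarrow> cov X Y = 0" "\<And>Y. Y \<in> J \<Longrightarrow> A Y \<in> sets borel"
    by (auto simp: orth_events_def)
  have E_meas [measurable]: "E \<in> events" using E orth_events_subset by auto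
  define I where "I \<omega> = indicat_real E \<omega>" for \<omega>
  have I_meas [measurable]: "I \<in> borel_measurable M" unfolding I_def by measurable
  have I_prod: "I \<omega> = (\<Prod>Y\<in>J. indicat_real (A Y) (Y \<omega>))" if \<omega>: "\<omega> \<in> space M" for \<omega>
  proof (cases "\<omega> \<in> E")
    case True
    then show ?thesis by (auto simp: I_def E'(1))
  next
    case False
    then obtain Y where "Y \<in> J" "Y \<omega> \<notin> A Y" using \<omega> by (auto simp: E'(1))
    then have "(\<Prod>Y\<in>J. indicat_real (A Y) (Y \<omega>)) = 0"
      using E'(2) by (intro prod_zero) (auto intro!: bexI[of _ Y])
    then show ?thesis using False by (simp add: I_def)
  qed
  have int_iexp: "integrable M (\<lambda>\<omega>. iexp (t * X \<omega>))" for t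
    by (rule integrable_const_bound[of _ 1]) auto
  have int_I: "integrable M (\<lambda>\<omega>. complex_of_real (I \<omega>))"
    by (rule integrable_const_bound[of _ 1]) (auto simp: I_def indicator_def)
  have EI: "expectation I = prob E"
    unfolding I_def by simp
  have factor: "(CLINT \<omega>|M. iexp (t * X \<omega>) * complex_of_real (I \<omega>))
      = (CLINT \<omega>|M. iexp (t * X \<omega>)) * complex_of_real (prob E)" for t
  proof -
    define \<phi> where "\<phi> = (CLINT \<omega>|M. iexp (t * X \<omega>))"
    have "norm \<phi> \<le> (\<integral>\<omega>. norm (iexp (t * X \<omega>)) \<partial>M)"
      unfolding \<phi>_def by (rule integral_norm_bound)
    then have norm_\<phi>: "norm \<phi> \<le> 1" by (simp add: prob_space)
    \<comment> \<open>the factor one half keeps the norm below 1\<close>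
    define U where "U \<omega> = (iexp (t * X \<omega>) - \<phi>) / 2" for \<omega>
    have "(CLINT \<omega>|M. U \<omega> * complex_of_real (\<Prod>Y\<in>J. indicat_real (A Y) (Y \<omega>))) = 0"
    proof (rule expectation_prod_indicator_eq_zero)
      show "U \<in> borel_measurable M" unfolding U_def by measurable
      show "norm (U \<omega>) \<le> 1" for \<omega>
        using norm_triangle_ineq4[of "iexp (t * X \<omega>)" \<phi>] norm_\<phi> by (simp add: U_def norm_divide)
      show "(CLINT \<omega>|M. U \<omega> * iexp (\<Sum>Y\<in>J. \<eta> Y * Y \<omega>)) = 0" for \<eta>
      proof -
        define Z where "Z \<omega> = (\<Sum>Y\<in>J. \<eta> Y * Y \<omega>)" for \<omega>
        have Z: "Z \<in> H" unfolding Z_def using E'(3) by (intro sum_mem scale_mem) auto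
        have [measurable]: "Z \<in> borel_measurable M" using Z by (rule measurable_mem)
        have "cov X Z = (\<Sum>Y\<in>J. cov X (\<lambda>\<omega>. \<eta> Y * Y \<omega>))"
          unfolding Z_def using E'(3) by (intro cov_sum_right X scale_mem) auto
        also have "\<dots> = 0" using E'(4) by (simp add: cov_scale_right)
        finally have XZ: "cov X Z = 0" .
        define T where "T \<omega> = t * X \<omega>" for \<omega>
        have T: "T \<in> H" unfolding T_def by (intro scale_mem X)
        have TZ: "cov T Z = 0" unfolding T_def by (simp add: cov_scale_left XZ)
        have "cov (\<lambda>\<omega>. T \<omega> + Z \<omega>) (\<lambda>\<omega>. T \<omega> + Z \<omega>) = cov T (\<lambda>\<omega>. T \<omega> + Z \<omega>) + cov Z (\<lambda>\<omega>. T \<omega> + Z \<omega>)"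
          by (intro cov_add_left T Z add_mem)
        also have "cov T (\<lambda>\<omega>. T \<omega> + Z \<omega>) = cov T T + cov T Z"
          by (intro cov_add_right T Z)
        also have "cov Z (\<lambda>\<omega>. T \<omega> + Z \<omega>) = cov T Z + cov Z Z"
          using cov_add_right[OF T Z Z] cov_commute[of Z T] by simp
        finally have "cov (\<lambda>\<omega>. T \<omega> + Z \<omega>) (\<lambda>\<omega>. T \<omega> + Z \<omega>) = cov T T + cov Z Z"
          unfolding TZ by simp
        then have "(CLINT \<omega>|M. iexp (T \<omega> + Z \<omega>)) = complex_of_real (exp (- cov T T / 2) * exp (- cov Z Z / 2))"
          by (subst expectation_iexp[OF add_mem[OF T Z]]) (simp add: field_simps flip: exp_add)
        then have "(CLINT \<omega>|M. iexp (T \<omega> + Z \<omega>)) = \<phi> * (CLINT \<omega>|M. iexp (Z \<omega>))"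
          unfolding expectation_iexp[OF Z] \<phi>_def using expectation_iexp[OF T] by (simp add: T_def)
        then have "(CLINT \<omega>|M. (iexp (t * X \<omega>) * iexp (Z \<omega>) - \<phi> * iexp (Z \<omega>)) / 2) = 0"
          using integrable_iexp[of "\<lambda>\<omega>. T \<omega> + Z \<omega>"] integrable_iexp[of Z]
          by (simp add: T_def exp_add distrib_left)
        then show ?thesis
          by (simp add: U_def Z_def left_diff_distrib diff_divide_distrib)
      qed
    qed (use E' in auto)
    also have "(CLINT \<omega>|M. U \<omega> * complex_of_real (\<Prod>Y\<in>J. indicat_real (A Y) (Y \<omega>)))
        = (CLINT \<omega>|M. (iexp (t * X \<omega>) * complex_of_real (I \<omega>) - \<phi> * complex_of_real (I \<omega>)) / 2)"
      by (intro Bochner_Integration.integral_cong refl)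
         (simp add: I_prod U_def left_diff_distrib diff_divide_distrib)
    also have "\<dots> = ((CLINT \<omega>|M. iexp (t * X \<omega>) * complex_of_real (I \<omega>)) - \<phi> * complex_of_real (prob E)) / 2"
    proof -
      have "integrable M (\<lambda>\<omega>. iexp (t * X \<omega>) * complex_of_real (I \<omega>))"
        by (rule integrable_const_bound[of _ 1]) (auto simp: I_def indicator_def norm_mult)
      then show ?thesis using int_I EI by simp
    qed
    finally show ?thesis by (simp add: \<phi>_def)
  qed
  have "expectation (\<lambda>\<omega>. (I \<omega> - prob E) * indicat_real B (X \<omega>)) = 0"
  proof (rule expectation_indicator_eq_zero_real)
    obtain p where p: "prob E = p" "0 \<le> p" "p \<le> 1" by simp
    then show "\<bar>I \<omega> - prob E\<bar> \<le> 1" for \<omega>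
      unfolding p(1) by (auto simp: I_def indicator_def abs_le_iff)
    show "(CLINT \<omega>|M. complex_of_real (I \<omega> - prob E) * iexp (t * X \<omega>)) = 0" for t
    proof -
      have "integrable M (\<lambda>\<omega>. iexp (t * X \<omega>) * complex_of_real (I \<omega>))"
        by (rule integrable_const_bound[of _ 1]) (auto simp: I_def indicator_def norm_mult)
      then have "(CLINT \<omega>|M. iexp (t * X \<omega>) * complex_of_real (I \<omega>) - iexp (t * X \<omega>) * complex_of_real (prob E)) = 0"
        using factor[of t] int_iexp[of t] by simp
      then show ?thesis by (simp add: algebra_simps)
    qed
  qed auto
  moreover have "integrable M (\<lambda>\<omega>. I \<omega> * indicat_real B (X \<omega>))" "integrable M (\<lambda>\<omega>. indicat_real B (X \<omega>))"
    by (rule integrable_const_bound[of _ 1]; auto simp: I_def indicator_def)+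
  ultimately have "expectation (\<lambda>\<omega>. I \<omega> * indicat_real B (X \<omega>)) = prob E * expectation (\<lambda>\<omega>. indicat_real B (X \<omega>))"
    by (simp add: left_diff_distrib)
  moreover have "expectation (\<lambda>\<omega>. I \<omega> * indicat_real B (X \<omega>)) = expectation (indicat_real ((X -` B \<inter> space M) \<inter> E))"
    by (intro Bochner_Integration.integral_cong) (auto simp: I_def indicator_def)
  moreover have "expectation (\<lambda>\<omega>. indicat_real B (X \<omega>)) = expectation (indicat_real (X -` B \<inter> space M))"
    by (intro Bochner_Integration.integral_cong) (auto simp: indicator_def)
  ultimately show ?thesis
    by (simp add: mult.commute)
qed

lemma indep_set_orth_algebra:
  assumes X: "X \<in> H"
  shows "indep_set (sigma_sets (space M) {X -` B \<inter> space M |B. B \<in> sets borel}) (sets (orth_algebra X))"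
proof -
  have [measurable]: "X \<in> borel_measurable M" using X by (rule measurable_mem)
  have "indep_set {X -` B \<inter> space M |B. B \<in> sets borel} (orth_events X)"
    unfolding indep_sets2_eq using prob_orth_event[OF X] orth_events_subset by (auto intro: measurable_sets)
  then show ?thesis
    unfolding sets_orth_algebra
  proof (rule indep_set_sigma_sets)
    show "Int_stable {X -` B \<inter> space M |B. B \<in> sets borel}"
      unfolding Int_stable_def by safe (rule_tac x="B \<inter> Ba" in exI, auto)
  qed (rule Int_stable_orth_events)
qed

lemma distr_pair_orth_algebra:
  assumes X: "X \<in> H"
  shows "distr M (borel \<Otimes>\<^sub>M orth_algebra X) (\<lambda>\<omega>. (X \<omega>, \<omega>))
    = distr M borel X \<Otimes>\<^sub>M distr M (orth_algebra X) (\<lambda>\<omega>. \<omega>)"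
proof (rule sym, rule pair_measure_eqI)
  note [measurable] = measurable_mem[OF X] id_measurable_orth_algebra
  show "sigma_finite_measure (distr M borel X)"
    by (intro prob_space_imp_sigma_finite prob_space_distr) simp
  show "sigma_finite_measure (distr M (orth_algebra X) (\<lambda>\<omega>. \<omega>))"
    by (intro prob_space_imp_sigma_finite prob_space_distr) simp
  fix A E assume "A \<in> sets (distr M borel X)" "E \<in> sets (distr M (orth_algebra X) (\<lambda>\<omega>. \<omega>))"
  then have A [measurable]: "A \<in> sets borel" and E [measurable]: "E \<in> sets (orth_algebra X)" by auto
  have "E \<subseteq> space M" using sets.sets_into_space[OF E] by simp
  then have *: "(\<lambda>\<omega>. (X \<omega>, \<omega>)) -` (A \<times> E) \<inter> space M = (X -` A \<inter> space M) \<inter> E" by auto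
  have "prob ((X -` A \<inter> space M) \<inter> E) = prob (X -` A \<inter> space M) * prob E"
    using indep_set_orth_algebra[OF X] A E unfolding indep_sets2_eq by blast
  moreover have "E \<inter> space M = E" using \<open>E \<subseteq> space M\<close> by auto
  ultimately show "emeasure (distr M borel X) A * emeasure (distr M (orth_algebra X) (\<lambda>\<omega>. \<omega>)) E
      = emeasure (distr M (borel \<Otimes>\<^sub>M orth_algebra X) (\<lambda>\<omega>. (X \<omega>, \<omega>))) (A \<times> E)"
    by (subst (1 2 3) emeasure_distr) (auto simp: * emeasure_eq_measure ennreal_mult)
qed simp

text \<open>Averaging over \<^term>\<open>X\<close> with everything measurable for \<^term>\<open>orth_algebra X\<close> frozen. This is the only
  form of conditioning that the argument uses.\<close>

lemma nn_integral_orth_algebra: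
  assumes X: "X \<in> H" and f: "f \<in> borel_measurable (borel \<Otimes>\<^sub>M orth_algebra X)"
  shows "(\<integral>\<^sup>+\<omega>. f (X \<omega>, \<omega>) \<partial>M) = (\<integral>\<^sup>+\<omega>. (\<integral>\<^sup>+\<omega>'. f (X \<omega>', \<omega>) \<partial>M) \<partial>M)"
proof -
  note [measurable] = measurable_mem[OF X] id_measurable_orth_algebra f
  interpret Q: prob_space "distr M borel X" by (rule prob_space_distr) simp
  interpret O: prob_space "distr M (orth_algebra X) (\<lambda>\<omega>. \<omega>)" by (rule prob_space_distr) simp
  interpret QO: pair_prob_space "distr M borel X" "distr M (orth_algebra X) (\<lambda>\<omega>. \<omega>)" ..
  have "(\<integral>\<^sup>+\<omega>. f (X \<omega>, \<omega>) \<partial>M) = integral\<^sup>N (distr M (borel \<Otimes>\<^sub>M orth_algebra X) (\<lambda>\<omega>. (X \<omega>, \<omega>))) f"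
    by (subst nn_integral_distr) auto
  also have "\<dots> = (\<integral>\<^sup>+\<omega>. (\<integral>\<^sup>+x. f (x, \<omega>) \<partial>distr M borel X) \<partial>distr M (orth_algebra X) (\<lambda>\<omega>. \<omega>))"
    unfolding distr_pair_orth_algebra[OF X] by (rule QO.nn_integral_snd[symmetric]) simp
  also have "\<dots> = (\<integral>\<^sup>+\<omega>. (\<integral>\<^sup>+x. f (x, \<omega>) \<partial>distr M borel X) \<partial>M)"
    by (subst nn_integral_distr) auto
  also have "\<dots> = (\<integral>\<^sup>+\<omega>. (\<integral>\<^sup>+\<omega>'. f (X \<omega>', \<omega>) \<partial>M) \<partial>M)"
    by (intro nn_integral_cong) (subst nn_integral_distr, auto)
  finally show ?thesis .
qed

lemma indep_var_mem:
  assumes X: "X \<in> H" and Y: "Y \<in> H" and "cov X Y = 0"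
  shows "indep_var borel X borel Y"
  unfolding indep_var_eq
proof (intro conjI)
  show "X \<in> borel_measurable M" "Y \<in> borel_measurable M"
    using X Y by (auto intro: measurable_mem)
  have *: "{Y -` B \<inter> space M |B. B \<in> sets borel} \<subseteq> sets (orth_algebra X)"
    using measurable_sets[OF measurable_orth_algebra[OF Y \<open>cov X Y = 0\<close>]] by auto
  then have "sigma_sets (space M) {Y -` B \<inter> space M |B. B \<in> sets borel} \<subseteq> sets (orth_algebra X)"
    using sets.sigma_sets_subset[OF *] by simp
  then show "indep_set (sigma_sets (space M) {X -` B \<inter> space M |B. B \<in> sets borel})
     (sigma_sets (space M) {Y -` B \<inter> space M |B. B \<in> sets borel})"
    using indep_set_orth_algebra[OF X] unfolding indep_sets2_eq by blast
qed

end

section \<open>Exponential moments of discrete stochastic integrals\<close>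

lemma exp_sum_le_weighted:
  fixes w x :: "'i \<Rightarrow> real"
  assumes "finite I" "(\<Sum>i\<in>I. w i) = 1" "\<And>i. i \<in> I \<Longrightarrow> 0 \<le> w i"
  shows "exp (\<Sum>i\<in>I. w i * x i) \<le> (\<Sum>i\<in>I. w i * exp (x i))"
proof -
  have "I \<noteq> {}" using assms(2) by auto
  from convex_on_sum[OF assms(1) this exp_convex assms(2,3), of x] show ?thesis by simp
qed

lemma exp_add_le: "exp (a + b) \<le> exp (2 * a) + exp (2 * b)" for a b :: real
proof -
  have "exp (a + b) \<le> exp (max (2 * a) (2 * b))" by simp
  also have "\<dots> \<le> exp (2 * a) + exp (2 * b)" by (simp add: max_def)
  finally show ?thesis .
qed

lemma exp_le_compensated: "p = 2 * x - u \<Longrightarrow> exp x \<le> exp p + exp u" for p x u :: real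
  using exp_add_le[of "x - u / 2" "u / 2"] by (simp add: right_diff_distrib)

lemma exp_add3_le: "exp (a + b + c) \<le> exp (3 * a) + exp (3 * b) + exp (3 * c)" for a b c :: real
proof -
  have "a + b + c \<le> 3 * a \<or> a + b + c \<le> 3 * b \<or> a + b + c \<le> 3 * c" by linarith
  then have "exp (a + b + c) \<le> exp (3 * a) \<or> exp (a + b + c) \<le> exp (3 * b) \<or> exp (a + b + c) \<le> exp (3 * c)"
    by simp
  then show ?thesis
    using exp_gt_zero[of "3 * a"] exp_gt_zero[of "3 * b"] exp_gt_zero[of "3 * c"] by linarith
qed

lemma (in prob_space) nn_integral_exp_sum_le:
  fixes w :: "'i \<Rightarrow> real" and X :: "'i \<Rightarrow> 'a \<Rightarrow> real"
  assumes "finite I" "(\<Sum>i\<in>I. w i) = 1" "\<And>i. i \<in> I \<Longrightarrow> 0 \<le> w i"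
    and X: "\<And>i. i \<in> I \<Longrightarrow> X i \<in> borel_measurable M"
    and K: "\<And>i. i \<in> I \<Longrightarrow> (\<integral>\<^sup>+\<omega>. ennreal (exp (X i \<omega>)) \<partial>M) \<le> K"
  shows "(\<integral>\<^sup>+\<omega>. ennreal (exp (\<Sum>i\<in>I. w i * X i \<omega>)) \<partial>M) \<le> K"
proof -
  note [measurable] = X
  have "(\<integral>\<^sup>+\<omega>. ennreal (exp (\<Sum>i\<in>I. w i * X i \<omega>)) \<partial>M)
      \<le> (\<integral>\<^sup>+\<omega>. (\<Sum>i\<in>I. ennreal (w i) * ennreal (exp (X i \<omega>))) \<partial>M)"
  proof (intro nn_integral_mono)
    fix \<omega>
    have "ennreal (exp (\<Sum>i\<in>I. w i * X i \<omega>)) \<le> ennreal (\<Sum>i\<in>I. w i * exp (X i \<omega>))"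
      by (intro ennreal_leI exp_sum_le_weighted assms)
    also have "\<dots> = (\<Sum>i\<in>I. ennreal (w i) * ennreal (exp (X i \<omega>)))"
      using assms(3) by (subst sum_ennreal[symmetric]) (auto simp: ennreal_mult intro!: sum.cong)
    finally show "ennreal (exp (\<Sum>i\<in>I. w i * X i \<omega>)) \<le> (\<Sum>i\<in>I. ennreal (w i) * ennreal (exp (X i \<omega>)))" .
  qed
  also have "\<dots> = (\<Sum>i\<in>I. ennreal (w i) * (\<integral>\<^sup>+\<omega>. ennreal (exp (X i \<omega>)) \<partial>M))"
    by (simp add: nn_integral_sum nn_integral_cmult)
  also have "\<dots> \<le> (\<Sum>i\<in>I. ennreal (w i) * K)"
    by (intro sum_mono mult_left_mono K) auto
  also have "\<dots> = ennreal (\<Sum>i\<in>I. w i) * K"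
    using assms(3) by (simp add: sum_distrib_right[symmetric])
  finally show ?thesis by (simp add: assms(2))
qed

context gaussian_space
begin

lemma borel_measurable_orth_algebraD:
  "f \<in> borel_measurable (orth_algebra X) \<Longrightarrow> f \<in> borel_measurable M"
  by (rule measurable_compose[OF id_measurable_orth_algebra])

text \<open>The stochastic exponential of a discrete stochastic integral has expectation \<open>1\<close>. The coefficients
  \<^term>\<open>c\<close> may be random and unbounded; \<^term>\<open>c k\<close> is only required to be independent of the innovations
  from index \<open>k\<close> on.\<close>

lemma nn_integral_exp_martingale:
  fixes n :: nat
  assumes "\<And>k. k < n \<Longrightarrow> \<xi> k \<in> H"
    and "\<And>k l. l < k \<Longrightarrow> k < n \<Longrightarrow> cov (\<xi> k) (\<xi> l) = 0"
    and "\<And>k l. l \<le> k \<Longrightarrow> k < n \<Longrightarrow> c l \<in> borel_measurable (orth_algebra (\<xi> k))"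
  shows "(\<integral>\<^sup>+\<omega>. ennreal (exp (\<Sum>k<n. c k \<omega> * \<xi> k \<omega> - (c k \<omega>)\<^sup>2 * cov (\<xi> k) (\<xi> k) / 2)) \<partial>M) = 1"
  using assms
proof (induction n)
  case 0
  show ?case by (simp add: emeasure_space_1)
next
  case (Suc n)
  define P where "P \<omega> = (\<Sum>k<n. c k \<omega> * \<xi> k \<omega> - (c k \<omega>)\<^sup>2 * cov (\<xi> k) (\<xi> k) / 2)" for \<omega>
  define f where "f = (\<lambda>(x, \<omega>). ennreal (exp (P \<omega>)) * ennreal (exp (c n \<omega> * x - (c n \<omega>)\<^sup>2 * cov (\<xi> n) (\<xi> n) / 2)))"
  have mem: "\<xi> n \<in> H" using Suc.prems(1) by simp
  note [measurable] = measurable_mem[OF mem]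
  have c [measurable]: "c k \<in> borel_measurable (orth_algebra (\<xi> n))" if "k \<le> n" for k
    using Suc.prems(3)[of k n] that by simp
  have \<xi> [measurable]: "\<xi> k \<in> borel_measurable (orth_algebra (\<xi> n))" if "k < n" for k
    by (rule measurable_orth_algebra) (use Suc.prems(1)[of k] Suc.prems(2)[of k n] that in simp_all)
  have P [measurable]: "P \<in> borel_measurable (orth_algebra (\<xi> n))"
    unfolding P_def by measurable
  have cn [measurable]: "c n \<in> borel_measurable (orth_algebra (\<xi> n))" by (rule c) simp
  have f [measurable]: "f \<in> borel_measurable (borel \<Otimes>\<^sub>M orth_algebra (\<xi> n))"
    unfolding f_def by measurable
  have "(\<integral>\<^sup>+\<omega>. ennreal (exp (\<Sum>k<Suc n. c k \<omega> * \<xi> k \<omega> - (c k \<omega>)\<^sup>2 * cov (\<xi> k) (\<xi> k) / 2)) \<partial>M)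
      = (\<integral>\<^sup>+\<omega>. f (\<xi> n \<omega>, \<omega>) \<partial>M)"
  proof (intro nn_integral_cong)
    fix \<omega>
    show "ennreal (exp (\<Sum>k<Suc n. c k \<omega> * \<xi> k \<omega> - (c k \<omega>)\<^sup>2 * cov (\<xi> k) (\<xi> k) / 2)) = f (\<xi> n \<omega>, \<omega>)"
      unfolding sum.lessThan_Suc P_def[symmetric] exp_add[symmetric] f_def prod.case
      by (simp only: ennreal_mult[symmetric] exp_ge_zero exp_add)
  qed
  also have "\<dots> = (\<integral>\<^sup>+\<omega>. (\<integral>\<^sup>+\<omega>'. f (\<xi> n \<omega>', \<omega>) \<partial>M) \<partial>M)"
    by (rule nn_integral_orth_algebra[OF mem f])
  also have "\<dots> = (\<integral>\<^sup>+\<omega>. ennreal (exp (P \<omega>)) \<partial>M)"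
  proof (intro nn_integral_cong)
    fix \<omega>
    show "(\<integral>\<^sup>+\<omega>'. f (\<xi> n \<omega>', \<omega>) \<partial>M) = ennreal (exp (P \<omega>))"
      unfolding f_def prod.case
      by (subst nn_integral_cmult) (simp_all only: nn_integral_exp_compensated[OF mem] mult_1_right, measurable)
  qed
  also have "\<dots> = 1"
    unfolding P_def
    by (rule Suc.IH; rule Suc.prems; simp)
  finally show ?case .
qed

text \<open>The elementary bound \<open>exp x \<le> exp (2 * x - u) + exp u\<close> separates a stochastic exponential from the
  quadratic variation of the discrete integral.\<close>

lemma nn_integral_exp_transform_le:
  fixes n :: nat
  assumes \<xi>: "\<And>k. k < n \<Longrightarrow> \<xi> k \<in> H"
    and cov: "\<And>k l. l < k \<Longrightarrow> k < n \<Longrightarrow> cov (\<xi> k) (\<xi> l) = 0"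
    and c: "\<And>k l. l \<le> k \<Longrightarrow> k < n \<Longrightarrow> c l \<in> borel_measurable (orth_algebra (\<xi> k))"
  shows "(\<integral>\<^sup>+\<omega>. ennreal (exp (\<theta> * (\<Sum>k<n. c k \<omega> * \<xi> k \<omega>))) \<partial>M)
    \<le> 1 + (\<integral>\<^sup>+\<omega>. ennreal (exp (2 * \<theta>\<^sup>2 * (\<Sum>k<n. (c k \<omega>)\<^sup>2 * cov (\<xi> k) (\<xi> k)))) \<partial>M)"
proof -
  let ?P = "\<lambda>\<omega>. (\<Sum>k<n. (2 * \<theta> * c k \<omega>) * \<xi> k \<omega> - (2 * \<theta> * c k \<omega>)\<^sup>2 * cov (\<xi> k) (\<xi> k) / 2)"
  let ?U = "\<lambda>\<omega>. 2 * \<theta>\<^sup>2 * (\<Sum>k<n. (c k \<omega>)\<^sup>2 * cov (\<xi> k) (\<xi> k))"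
  have [measurable]: "\<xi> k \<in> borel_measurable M" if "k < n" for k
    using \<xi>[OF that] by (rule measurable_mem)
  have [measurable]: "c k \<in> borel_measurable M" if "k < n" for k
    using c[of k k] that by (intro borel_measurable_orth_algebraD[of _ "\<xi> k"]) auto
  have le: "ennreal (exp (\<theta> * (\<Sum>k<n. c k \<omega> * \<xi> k \<omega>))) \<le> ennreal (exp (?P \<omega>)) + ennreal (exp (?U \<omega>))" for \<omega>
  proof -
    have "?P \<omega> = 2 * (\<theta> * (\<Sum>k<n. c k \<omega> * \<xi> k \<omega>)) - ?U \<omega>"
      by (simp add: sum_subtractf sum_distrib_left power_mult_distrib algebra_simps)
    then have "exp (\<theta> * (\<Sum>k<n. c k \<omega> * \<xi> k \<omega>)) \<le> exp (?P \<omega>) + exp (?U \<omega>)"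
      by (rule exp_le_compensated)
    then show ?thesis
      by (simp add: ennreal_leI flip: ennreal_plus)
  qed
  have "(\<integral>\<^sup>+\<omega>. ennreal (exp (\<theta> * (\<Sum>k<n. c k \<omega> * \<xi> k \<omega>))) \<partial>M)
      \<le> (\<integral>\<^sup>+\<omega>. ennreal (exp (?P \<omega>)) + ennreal (exp (?U \<omega>)) \<partial>M)"
    by (intro nn_integral_mono le)
  also have "\<dots> = (\<integral>\<^sup>+\<omega>. ennreal (exp (?P \<omega>)) \<partial>M) + (\<integral>\<^sup>+\<omega>. ennreal (exp (?U \<omega>)) \<partial>M)"
    by (rule nn_integral_add) measurable
  also have "(\<integral>\<^sup>+\<omega>. ennreal (exp (?P \<omega>)) \<partial>M) = 1"
  proof (rule nn_integral_exp_martingale)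
    show "(\<lambda>\<omega>. 2 * \<theta> * c l \<omega>) \<in> borel_measurable (orth_algebra (\<xi> k))" if "l \<le> k" "k < n" for k l
      using c[OF that] by simp
  qed (use \<xi> cov in auto)
  finally show ?thesis .
qed

end

lemma infnorm_power2_le_sum: "(infnorm x)\<^sup>2 \<le> (\<Sum>j\<in>UNIV. (x $ j)\<^sup>2)" for x :: "real ^ 'd"
proof -
  have "(infnorm x)\<^sup>2 \<le> (norm x)\<^sup>2"
    by (intro power_mono infnorm_le_norm infnorm_pos_le)
  also have "\<dots> = (\<Sum>j\<in>UNIV. (x $ j)\<^sup>2)"
    by (simp add: norm_vec_def L2_set_def sum_nonneg)
  finally show ?thesis .
qed

lemma borel_measurable_vec_lambda:
  fixes f :: "'d::finite \<Rightarrow> 'a \<Rightarrow> real"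
  assumes "\<And>j. f j \<in> borel_measurable N"
  shows "(\<lambda>\<omega>. \<chi> j. f j \<omega>) \<in> borel_measurable N"
  unfolding borel_measurable_euclidean_space[where f="\<lambda>\<omega>. \<chi> j. f j \<omega>"]
  using assms by (auto simp: Basis_vec_def inner_axis)

text \<open>The discrete skeleton of the problem. \<open>B i k\<close> is the value at time \<open>k / n\<close> of a Brownian motion started
  at \<open>0\<close> with variance \<open>v\<close> per unit of time. The other coordinates \<open>B j k\<close> and the process \<open>Z\<close> are
  uncorrelated with it, and \<open>Z\<close> has variance at most \<open>D\<^sup>2\<close>. The function \<open>h k\<close> is the integrand at
  time \<open>k / n\<close>, of linear growth in its second argument. The number \<open>\<alpha>\<close> is the small exponent of the
  final estimate.\<close>

locale gaussian_walk = gaussian_space M H for M :: "'w measure" and H +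
  fixes B Z :: "'d::finite \<Rightarrow> nat \<Rightarrow> 'w \<Rightarrow> real" and n :: nat and v D :: real
    and y :: "real ^ 'd" and i :: 'd and h :: "nat \<Rightarrow> (real ^ 'd) \<times> (real ^ 'd) \<Rightarrow> real" and \<kappa> \<alpha> :: real
  assumes n_pos: "0 < n" and v_pos: "0 < v" and D_pos: "0 < D"
    and B_mem: "k \<le> n \<Longrightarrow> B j k \<in> H" and Z_mem: "k \<le> n \<Longrightarrow> Z j k \<in> H"
    and cov_BB: "k \<le> n \<Longrightarrow> l \<le> n \<Longrightarrow> cov (B i k) (B i l) = v * real (min k l) / real n"
    and cov_BB': "k \<le> n \<Longrightarrow> l \<le> n \<Longrightarrow> j \<noteq> i \<Longrightarrow> cov (B i k) (B j l) = 0"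
    and cov_BZ: "k \<le> n \<Longrightarrow> l \<le> n \<Longrightarrow> cov (B i k) (Z j l) = 0"
    and cov_ZZ: "k \<le> n \<Longrightarrow> cov (Z j k) (Z j k) \<le> D\<^sup>2"
    and y_le: "infnorm y \<le> D"
    and h_measurable: "k \<le> n \<Longrightarrow> h k \<in> borel_measurable borel"
    and h_le: "k \<le> n \<Longrightarrow> \<bar>h k (x, z)\<bar> \<le> \<kappa> * infnorm z"
    and \<kappa>_pos: "0 < \<kappa>" and \<alpha>_pos: "0 < \<alpha>" and \<alpha>_small: "48 * real CARD('d) * (\<alpha> * \<kappa>) \<le> 1"
begin

text \<open>The positions at time \<open>k / n\<close>. In \<open>Bmix k\<close> only the coordinate \<open>i\<close> is taken at time \<open>k / n\<close>, the other
  ones at time \<open>(k + 1) / n\<close>: moving from \<open>Bmix k\<close> to \<open>Bvec (Suc k)\<close> changes one coordinate, and \<open>Bmix k\<close> is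
  independent of the increment of that coordinate.\<close>

definition Zvec :: "nat \<Rightarrow> 'w \<Rightarrow> real ^ 'd" where
  "Zvec k \<omega> = (\<chi> j. Z j k \<omega>)"

definition Bvec :: "nat \<Rightarrow> 'w \<Rightarrow> real ^ 'd" where
  "Bvec k \<omega> = (\<chi> j. B j k \<omega>)"

definition Bmix :: "nat \<Rightarrow> 'w \<Rightarrow> real ^ 'd" where
  "Bmix k \<omega> = (\<chi> j. if j = i then B i k \<omega> else B j (Suc k) \<omega>)"

text \<open>The squared bound on the integrand, normalised by \<^term>\<open>D\<close>.\<close>

definition V :: "nat \<Rightarrow> 'w \<Rightarrow> real" where
  "V k \<omega> = (infnorm (y + Zvec k \<omega>))\<^sup>2 / D\<^sup>2"

lemma borel_measurable_Zvec:
  "(\<And>j. Z j k \<in> borel_measurable N) \<Longrightarrow> Zvec k \<in> borel_measurable N"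
  unfolding Zvec_def by (rule borel_measurable_vec_lambda)

lemma measurable_V [measurable]: "k \<le> n \<Longrightarrow> V k \<in> borel_measurable M"
proof -
  assume k: "k \<le> n"
  have [measurable]: "Zvec k \<in> borel_measurable M"
    by (intro borel_measurable_Zvec measurable_mem Z_mem k)
  have [measurable]: "(infnorm :: real ^ 'd \<Rightarrow> real) \<in> borel_measurable borel"
    by (intro borel_measurable_continuous_onI continuous_intros)
  show "V k \<in> borel_measurable M" unfolding V_def by measurable
qed

lemma nn_integral_exp_V:
  assumes k: "k \<le> n" and \<mu>: "0 \<le> \<mu>" "8 * real CARD('d) * \<mu> \<le> 1"
  shows "(\<integral>\<^sup>+\<omega>. ennreal (exp (\<mu> * V k \<omega>)) \<partial>M) \<le> 6"
proof -
  let ?d = "real CARD('d)"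
  have d: "1 \<le> ?d" using finite_UNIV_card_ge_0[where 'a='d] by (simp add: Suc_le_eq)
  have "\<mu> * 1 \<le> \<mu> * ?d" using d \<mu> by (intro mult_left_mono) auto
  then have \<mu>8: "8 * \<mu> \<le> 1" using \<mu> by (simp add: mult_ac)
  have le: "\<mu> * V k \<omega> \<le> 1 + (\<Sum>j\<in>UNIV. (1 / ?d) * ((2 * \<mu> * ?d / D\<^sup>2) * (Z j k \<omega>)\<^sup>2))" for \<omega>
  proof -
    have "(infnorm (y + Zvec k \<omega>))\<^sup>2 \<le> (infnorm y + infnorm (Zvec k \<omega>))\<^sup>2"
      by (intro power_mono infnorm_triangle infnorm_pos_le)
    also have "\<dots> \<le> 2 * (infnorm y)\<^sup>2 + 2 * (infnorm (Zvec k \<omega>))\<^sup>2"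
      using sum_squares_bound[of "infnorm y" "infnorm (Zvec k \<omega>)"] by (simp add: power2_sum)
    also have "\<dots> \<le> 2 * D\<^sup>2 + 2 * (\<Sum>j\<in>UNIV. (Z j k \<omega>)\<^sup>2)"
      using infnorm_power2_le_sum[of "Zvec k \<omega>"] power_mono[OF y_le infnorm_pos_le, of 2]
      by (simp add: Zvec_def)
    finally have "V k \<omega> \<le> (2 * D\<^sup>2 + 2 * (\<Sum>j\<in>UNIV. (Z j k \<omega>)\<^sup>2)) / D\<^sup>2"
      unfolding V_def by (intro divide_right_mono) auto
    then have "\<mu> * V k \<omega> \<le> \<mu> * ((2 * D\<^sup>2 + 2 * (\<Sum>j\<in>UNIV. (Z j k \<omega>)\<^sup>2)) / D\<^sup>2)"
      by (rule mult_left_mono) (rule \<mu>)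
    also have "\<dots> = 2 * \<mu> + (\<Sum>j\<in>UNIV. (1 / ?d) * ((2 * \<mu> * ?d / D\<^sup>2) * (Z j k \<omega>)\<^sup>2))"
    proof -
      have "(\<Sum>j\<in>UNIV. (1 / ?d) * ((2 * \<mu> * ?d / D\<^sup>2) * (Z j k \<omega>)\<^sup>2))
          = 2 * \<mu> / D\<^sup>2 * (\<Sum>j\<in>UNIV. (Z j k \<omega>)\<^sup>2)"
        unfolding sum_distrib_left using d by (intro sum.cong) auto
      then show ?thesis
        using D_pos by (simp add: field_simps)
    qed
    finally show ?thesis using \<mu>8 by simp
  qed
  have "(\<integral>\<^sup>+\<omega>. ennreal (exp (\<mu> * V k \<omega>)) \<partial>M)
     \<le> (\<integral>\<^sup>+\<omega>. ennreal 3 * ennreal (exp (\<Sum>j\<in>UNIV. (1 / ?d) * ((2 * \<mu> * ?d / D\<^sup>2) * (Z j k \<omega>)\<^sup>2))) \<partial>M)"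
  proof (intro nn_integral_mono)
    fix \<omega>
    have "exp (\<mu> * V k \<omega>) \<le> exp 1 * exp (\<Sum>j\<in>UNIV. (1 / ?d) * ((2 * \<mu> * ?d / D\<^sup>2) * (Z j k \<omega>)\<^sup>2))"
      using le[of \<omega>] by (simp flip: exp_add)
    also have "\<dots> \<le> 3 * exp (\<Sum>j\<in>UNIV. (1 / ?d) * ((2 * \<mu> * ?d / D\<^sup>2) * (Z j k \<omega>)\<^sup>2))"
      using exp_le by (intro mult_right_mono) auto
    finally show "ennreal (exp (\<mu> * V k \<omega>)) \<le> ennreal 3 * ennreal (exp (\<Sum>j\<in>UNIV. (1 / ?d) * ((2 * \<mu> * ?d / D\<^sup>2) * (Z j k \<omega>)\<^sup>2)))"
      by (simp only: ennreal_mult[symmetric] exp_ge_zero zero_le_numeral ennreal_leI)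
  qed
  also have "\<dots> = ennreal 3 * (\<integral>\<^sup>+\<omega>. ennreal (exp (\<Sum>j\<in>UNIV. (1 / ?d) * ((2 * \<mu> * ?d / D\<^sup>2) * (Z j k \<omega>)\<^sup>2))) \<partial>M)"
    using measurable_mem[OF Z_mem[OF k]] by (intro nn_integral_cmult) simp
  also have "\<dots> \<le> ennreal 3 * 2"
  proof (intro mult_left_mono nn_integral_exp_sum_le)
    fix j
    show "(\<integral>\<^sup>+\<omega>. ennreal (exp ((2 * \<mu> * ?d / D\<^sup>2) * (Z j k \<omega>)\<^sup>2)) \<partial>M) \<le> 2"
    proof (rule nn_integral_exp_square_le[OF Z_mem[OF k]])
      have "2 * \<mu> * ?d / D\<^sup>2 * cov (Z j k) (Z j k) \<le> 2 * \<mu> * ?d / D\<^sup>2 * D\<^sup>2"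
        using \<mu> d by (intro mult_left_mono cov_ZZ k) auto
      also have "\<dots> = 2 * \<mu> * ?d" using D_pos by simp
      also have "\<dots> \<le> 1 / 4" using \<mu> by (simp add: mult_ac)
      finally show "2 * \<mu> * ?d / D\<^sup>2 * cov (Z j k) (Z j k) \<le> 1 / 4" .
    qed
  qed (use measurable_mem[OF Z_mem[OF k]] in auto)
  also have "\<dots> = 6" by (simp flip: ennreal_numeral ennreal_mult)
  finally show ?thesis .
qed

end

section \<open>Forward and backward integrals along a Gaussian walk\<close>

lemma sum_inverse_sqrt_le: "(\<Sum>k<n. 1 / sqrt (real (Suc k))) \<le> 2 * sqrt (real n)"
proof (induction n)
  case (Suc n)
  have "1 / sqrt (real (Suc n)) \<le> 2 * (sqrt (real (Suc n)) - sqrt (real n))"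
  proof -
    have "0 \<le> (sqrt (real (Suc n)) - sqrt (real n))\<^sup>2" by simp
    then have "2 * (sqrt (real (Suc n)) * sqrt (real n)) \<le> real (Suc n) + real n"
      by (simp add: power2_diff mult_ac)
    then have "1 \<le> 2 * (sqrt (real (Suc n)) - sqrt (real n)) * sqrt (real (Suc n))"
      by (simp add: algebra_simps)
    then show ?thesis by (subst pos_divide_le_eq) auto
  qed
  with Suc show ?case by simp
qed simp

context gaussian_walk
begin

text \<open>The increment of coordinate \<open>i\<close>, and its innovation with respect to the future: subtracting from the
  increment its regression \<open>B i (Suc k) / (k + 1)\<close> on the endpoint leaves \<open>\<xi> k\<close>, which is uncorrelated with
  \<open>B i l\<close> for every \<open>l > k\<close>, as for a Brownian bridge run backwards.\<close>

definition \<Delta> :: "nat \<Rightarrow> 'w \<Rightarrow> real" where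
  "\<Delta> k \<omega> = B i (Suc k) \<omega> - B i k \<omega>"

definition \<xi> :: "nat \<Rightarrow> 'w \<Rightarrow> real" where
  "\<xi> k \<omega> = real k / real (Suc k) * B i (Suc k) \<omega> - B i k \<omega>"

text \<open>The integrand before and after the \<open>k\<close>-th step of coordinate \<open>i\<close>. The function \<open>h\<close>, the other coordinates and
  \<open>Z\<close> are taken at time \<open>(k + 1) / n\<close> in both.\<close>

definition fwd :: "nat \<Rightarrow> 'w \<Rightarrow> real" where
  "fwd k \<omega> = h (Suc k) (Bmix k \<omega>, y + Zvec (Suc k) \<omega>)"

definition bwd :: "nat \<Rightarrow> 'w \<Rightarrow> real" where
  "bwd k \<omega> = h (Suc k) (Bvec (Suc k) \<omega>, y + Zvec (Suc k) \<omega>)"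

lemma \<Delta>_mem: "k < n \<Longrightarrow> \<Delta> k \<in> H"
  unfolding \<Delta>_def by (intro diff_mem B_mem) auto

lemma \<xi>_mem: "k < n \<Longrightarrow> \<xi> k \<in> H"
  unfolding \<xi>_def by (intro diff_mem scale_mem B_mem) auto

lemma cov_\<Delta>:
  assumes "k < n" "X \<in> H"
  shows "cov (\<Delta> k) X = cov (B i (Suc k)) X - cov (B i k) X"
  unfolding \<Delta>_def by (intro cov_diff_left B_mem) (use assms in auto)

lemma cov_\<xi>:
  assumes "k < n" "X \<in> H"
  shows "cov (\<xi> k) X = real k / real (Suc k) * cov (B i (Suc k)) X - cov (B i k) X"
proof -
  have mem: "B i k \<in> H" "B i (Suc k) \<in> H" using assms by (auto intro: B_mem)
  show ?thesis
    unfolding \<xi>_def cov_diff_left[OF scale_mem[OF mem(2)] mem(1) assms(2)] cov_scale_left ..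
qed

lemma cov_\<Delta>_past: "k < n \<Longrightarrow> l \<le> k \<Longrightarrow> cov (\<Delta> k) (B i l) = 0"
  by (simp add: cov_\<Delta> B_mem cov_BB min_def)

lemma cov_\<Delta>_other: "k < n \<Longrightarrow> l \<le> n \<Longrightarrow> j \<noteq> i \<Longrightarrow> cov (\<Delta> k) (B j l) = 0"
  by (simp add: cov_\<Delta> B_mem cov_BB')

lemma cov_\<Delta>_Z: "k < n \<Longrightarrow> l \<le> n \<Longrightarrow> cov (\<Delta> k) (Z j l) = 0"
  by (simp add: cov_\<Delta> Z_mem cov_BZ)

lemma cov_\<Delta>_\<Delta>:
  assumes "l < k" "k < n" shows "cov (\<Delta> k) (\<Delta> l) = 0"
proof -
  have "cov (\<Delta> k) (\<lambda>\<omega>. B i (Suc l) \<omega> - B i l \<omega>) = cov (\<Delta> k) (B i (Suc l)) - cov (\<Delta> k) (B i l)"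
    using assms by (intro cov_diff_right \<Delta>_mem B_mem) auto
  also have "\<dots> = 0" using assms by (simp add: cov_\<Delta>_past)
  finally show ?thesis unfolding \<Delta>_def[of l] .
qed

lemma cov_\<Delta>_self:
  assumes "k < n" shows "cov (\<Delta> k) (\<Delta> k) = v / real n"
proof -
  have "cov (\<Delta> k) (\<lambda>\<omega>. B i (Suc k) \<omega> - B i k \<omega>) = cov (\<Delta> k) (B i (Suc k)) - cov (\<Delta> k) (B i k)"
    using assms by (intro cov_diff_right \<Delta>_mem B_mem) auto
  also have "\<dots> = cov (\<Delta> k) (B i (Suc k))"
    using assms by (simp add: cov_\<Delta>_past)
  also have "\<dots> = v / real n"
    using assms n_pos by (simp add: cov_\<Delta> B_mem cov_BB min_def field_simps)
  finally show ?thesis unfolding \<Delta>_def[of k] .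
qed

lemma cov_\<xi>_future: "k < l \<Longrightarrow> l \<le> n \<Longrightarrow> cov (\<xi> k) (B i l) = 0"
  by (simp add: cov_\<xi> B_mem cov_BB min_def)

lemma cov_\<xi>_other: "k < n \<Longrightarrow> l \<le> n \<Longrightarrow> j \<noteq> i \<Longrightarrow> cov (\<xi> k) (B j l) = 0"
  by (simp add: cov_\<xi> B_mem cov_BB')

lemma cov_\<xi>_Z: "k < n \<Longrightarrow> l \<le> n \<Longrightarrow> cov (\<xi> k) (Z j l) = 0"
  by (simp add: cov_\<xi> Z_mem cov_BZ)

lemma cov_\<xi>_\<xi>:
  assumes "k < l" "l < n" shows "cov (\<xi> k) (\<xi> l) = 0"
proof -
  have "cov (\<xi> k) (\<lambda>\<omega>. real l / real (Suc l) * B i (Suc l) \<omega> - B i l \<omega>)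
      = cov (\<xi> k) (\<lambda>\<omega>. real l / real (Suc l) * B i (Suc l) \<omega>) - cov (\<xi> k) (B i l)"
    using assms by (intro cov_diff_right \<xi>_mem B_mem scale_mem) auto
  also have "\<dots> = 0" unfolding cov_scale_right using assms by (simp add: cov_\<xi>_future)
  finally show ?thesis unfolding \<xi>_def[of l] .
qed

lemma cov_\<xi>_self:
  assumes "k < n" shows "cov (\<xi> k) (\<xi> k) \<le> v / real n"
proof -
  have "cov (\<xi> k) (\<lambda>\<omega>. real k / real (Suc k) * B i (Suc k) \<omega> - B i k \<omega>)
      = cov (\<xi> k) (\<lambda>\<omega>. real k / real (Suc k) * B i (Suc k) \<omega>) - cov (\<xi> k) (B i k)"
    using assms by (intro cov_diff_right \<xi>_mem B_mem scale_mem) auto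
  also have "\<dots> = - cov (\<xi> k) (B i k)"
    unfolding cov_scale_right using assms by (simp add: cov_\<xi>_future)
  also have "\<dots> = v / real n * (real k / real (Suc k))"
  proof -
    define q where "q = real k / real (Suc k)"
    have "q * real k = real k - q" by (simp add: q_def field_simps)
    moreover have "- cov (\<xi> k) (B i k) = v / real n * (real k - q * real k)"
      using assms by (simp add: cov_\<xi> B_mem cov_BB min_def q_def right_diff_distrib mult_ac del: of_nat_Suc)
    ultimately show ?thesis by (simp add: q_def del: of_nat_Suc)
  qed
  also have "\<dots> \<le> v / real n * 1"
    using v_pos n_pos by (intro mult_left_mono) auto
  finally show ?thesis unfolding \<xi>_def[of k] by simp
qed

lemma borel_measurable_h:
  assumes "k \<le> n" "f \<in> borel_measurable N" "g \<in> borel_measurable N"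
  shows "(\<lambda>\<omega>. h k (f \<omega>, y + g \<omega>)) \<in> borel_measurable N"
proof -
  note [measurable] = h_measurable[OF assms(1)] assms(2,3)
  have "(\<lambda>\<omega>. (f \<omega>, y + g \<omega>)) \<in> borel_measurable N" by measurable
  from measurable_compose[OF this h_measurable[OF assms(1)]] show ?thesis .
qed

lemma borel_measurable_fwd:
  assumes "l \<le> k" "k < n"
  shows "fwd l \<in> borel_measurable (orth_algebra (\<Delta> k))"
  unfolding fwd_def
proof (rule borel_measurable_h)
  show "Bmix l \<in> borel_measurable (orth_algebra (\<Delta> k))"
    unfolding Bmix_def
  proof (rule borel_measurable_vec_lambda)
    fix j
    show "(\<lambda>\<omega>. if j = i then B i l \<omega> else B j (Suc l) \<omega>) \<in> borel_measurable (orth_algebra (\<Delta> k))"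
      using assms
      by (cases "j = i") (auto intro!: measurable_orth_algebra B_mem cov_\<Delta>_past cov_\<Delta>_other)
  qed
  show "Zvec (Suc l) \<in> borel_measurable (orth_algebra (\<Delta> k))"
    using assms by (intro borel_measurable_Zvec measurable_orth_algebra Z_mem cov_\<Delta>_Z) auto
qed (use assms in auto)

lemma borel_measurable_bwd:
  assumes "k \<le> l" "l < n"
  shows "bwd l \<in> borel_measurable (orth_algebra (\<xi> k))"
  unfolding bwd_def
proof (rule borel_measurable_h)
  show "Bvec (Suc l) \<in> borel_measurable (orth_algebra (\<xi> k))"
    unfolding Bvec_def
  proof (rule borel_measurable_vec_lambda)
    fix j
    show "(\<lambda>\<omega>. B j (Suc l) \<omega>) \<in> borel_measurable (orth_algebra (\<xi> k))"
      using assms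
      by (cases "j = i") (auto intro!: measurable_orth_algebra B_mem cov_\<xi>_future cov_\<xi>_other)
  qed
  show "Zvec (Suc l) \<in> borel_measurable (orth_algebra (\<xi> k))"
    using assms by (intro borel_measurable_Zvec measurable_orth_algebra Z_mem cov_\<xi>_Z) auto
qed (use assms in auto)

lemma measurable_walk [measurable]:
  assumes "k < n"
  shows "\<Delta> k \<in> borel_measurable M" "\<xi> k \<in> borel_measurable M" "fwd k \<in> borel_measurable M"
    "bwd k \<in> borel_measurable M" "B i (Suc k) \<in> borel_measurable M" "V (Suc k) \<in> borel_measurable M"
  using assms \<Delta>_mem[OF assms] \<xi>_mem[OF assms] borel_measurable_fwd[OF order_refl assms]
    borel_measurable_bwd[OF order_refl assms] B_mem[of "Suc k" i]
  by (auto intro: measurable_mem borel_measurable_orth_algebraD measurable_V)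

lemma fwd_le: "k < n \<Longrightarrow> \<bar>fwd k \<omega>\<bar> \<le> \<kappa> * infnorm (y + Zvec (Suc k) \<omega>)"
  unfolding fwd_def by (rule h_le) simp

lemma bwd_le: "k < n \<Longrightarrow> \<bar>bwd k \<omega>\<bar> \<le> \<kappa> * infnorm (y + Zvec (Suc k) \<omega>)"
  unfolding bwd_def by (rule h_le) simp

lemma \<alpha>\<kappa>_le: "48 * (\<alpha> * \<kappa>) \<le> 1"
proof -
  have "1 \<le> real CARD('d)" using finite_UNIV_card_ge_0[where 'a='d] by (simp add: Suc_le_eq)
  then have "\<alpha> * \<kappa> * 1 \<le> \<alpha> * \<kappa> * real CARD('d)"
    using \<alpha>_pos \<kappa>_pos by (intro mult_left_mono) auto
  then show ?thesis using \<alpha>_small by (simp add: mult_ac)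
qed

text \<open>The quadratic variation of either discrete integral is dominated by an average of the variables
  \<^term>\<open>V\<close>, so Jensen's inequality reduces its exponential moment to that of a single \<^term>\<open>V k\<close>.\<close>

lemma nn_integral_exp_coefficients:
  assumes f: "\<And>k. k < n \<Longrightarrow> f k \<le> n"
    and r: "\<And>k. k < n \<Longrightarrow> r k \<le> v / real n"
    and c: "\<And>k \<omega>. k < n \<Longrightarrow> \<bar>c k \<omega>\<bar> \<le> \<kappa> * infnorm (y + Zvec (f k) \<omega>)"
    and \<theta>: "\<theta>\<^sup>2 = 9 * \<alpha>\<^sup>2 / (v * D\<^sup>2)"
  shows "(\<integral>\<^sup>+\<omega>. ennreal (exp (2 * \<theta>\<^sup>2 * (\<Sum>k<n. (c k \<omega>)\<^sup>2 * r k))) \<partial>M) \<le> 6"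
proof -
  define \<mu> where "\<mu> = 18 * (\<alpha> * \<kappa>)\<^sup>2"
  have "2 * \<theta>\<^sup>2 * (\<Sum>k<n. (c k \<omega>)\<^sup>2 * r k) \<le> (\<Sum>k<n. 1 / real n * (\<mu> * V (f k) \<omega>))" for \<omega>
  proof -
    have "2 * \<theta>\<^sup>2 * (\<Sum>k<n. (c k \<omega>)\<^sup>2 * r k) \<le> 2 * \<theta>\<^sup>2 * (\<Sum>k<n. (\<kappa> * infnorm (y + Zvec (f k) \<omega>))\<^sup>2 * (v / real n))"
    proof (intro mult_left_mono sum_mono)
      fix k assume "k \<in> {..<n}"
      then have k: "k < n" by simp
      have "(c k \<omega>)\<^sup>2 * r k \<le> (c k \<omega>)\<^sup>2 * (v / real n)"
        by (intro mult_left_mono r k) simp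
      also have "\<dots> \<le> (\<kappa> * infnorm (y + Zvec (f k) \<omega>))\<^sup>2 * (v / real n)"
        using v_pos power_mono[OF c[OF k] abs_ge_zero, of \<omega> 2] by (intro mult_right_mono) auto
      finally show "(c k \<omega>)\<^sup>2 * r k \<le> (\<kappa> * infnorm (y + Zvec (f k) \<omega>))\<^sup>2 * (v / real n)" .
    qed simp
    also have "\<dots> = (\<Sum>k<n. 1 / real n * (\<mu> * V (f k) \<omega>))"
      unfolding sum_distrib_left
    proof (intro sum.cong refl)
      fix k
      show "2 * \<theta>\<^sup>2 * ((\<kappa> * infnorm (y + Zvec (f k) \<omega>))\<^sup>2 * (v / real n)) = 1 / real n * (\<mu> * V (f k) \<omega>)"
        unfolding \<theta> \<mu>_def V_def using v_pos D_pos n_pos by (simp add: power_mult_distrib field_simps)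
    qed
    finally show ?thesis .
  qed
  then have "(\<integral>\<^sup>+\<omega>. ennreal (exp (2 * \<theta>\<^sup>2 * (\<Sum>k<n. (c k \<omega>)\<^sup>2 * r k))) \<partial>M)
      \<le> (\<integral>\<^sup>+\<omega>. ennreal (exp (\<Sum>k<n. 1 / real n * (\<mu> * V (f k) \<omega>))) \<partial>M)"
    by (intro nn_integral_mono ennreal_leI) simp
  also have "\<dots> \<le> 6"
  proof (rule nn_integral_exp_sum_le)
    show "(\<Sum>k<n. 1 / real n) = 1" using n_pos by simp
    fix k assume "k \<in> {..<n}"
    then have k: "f k \<le> n" using f by simp
    show "(\<lambda>\<omega>. \<mu> * V (f k) \<omega>) \<in> borel_measurable M"
      using measurable_V[OF k] by simp
    \<comment> \<open>the condition of the bound for \<open>V\<close>, quadratic in the small quantity \<open>\<alpha> * \<kappa>\<close>\<close>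
    have "8 * real CARD('d) * \<mu> = 144 * (real CARD('d) * (\<alpha> * \<kappa>)) * (\<alpha> * \<kappa>)"
      by (simp add: \<mu>_def power2_eq_square)
    also have "\<dots> \<le> 144 * (1 / 48) * (1 / 48)"
      using \<alpha>\<kappa>_le \<alpha>_small \<alpha>_pos \<kappa>_pos by (intro mult_mono) auto
    finally show "(\<integral>\<^sup>+\<omega>. ennreal (exp (\<mu> * V (f k) \<omega>)) \<partial>M) \<le> 6"
      by (intro nn_integral_exp_V k) (auto simp: \<mu>_def)
  qed (auto simp: n_pos)
  finally show ?thesis .
qed

lemma nn_integral_exp_forward:
  assumes \<theta>: "\<theta>\<^sup>2 = 9 * \<alpha>\<^sup>2 / (v * D\<^sup>2)"
  shows "(\<integral>\<^sup>+\<omega>. ennreal (exp (\<theta> * (\<Sum>k<n. fwd k \<omega> * \<Delta> k \<omega>))) \<partial>M) \<le> 7"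
proof -
  have "(\<integral>\<^sup>+\<omega>. ennreal (exp (\<theta> * (\<Sum>k<n. fwd k \<omega> * \<Delta> k \<omega>))) \<partial>M)
    \<le> 1 + (\<integral>\<^sup>+\<omega>. ennreal (exp (2 * \<theta>\<^sup>2 * (\<Sum>k<n. (fwd k \<omega>)\<^sup>2 * cov (\<Delta> k) (\<Delta> k)))) \<partial>M)"
    by (rule nn_integral_exp_transform_le[OF \<Delta>_mem cov_\<Delta>_\<Delta> borel_measurable_fwd])
  also have "\<dots> \<le> 1 + 6"
    by (intro add_left_mono nn_integral_exp_coefficients[where f=Suc] fwd_le \<theta>) (auto simp: cov_\<Delta>_self)
  finally show ?thesis by simp
qed

text \<open>Reversing the order of summation turns the backward integral into a martingale.\<close>

lemma nn_integral_exp_backward: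
  assumes \<theta>: "\<theta>\<^sup>2 = 9 * \<alpha>\<^sup>2 / (v * D\<^sup>2)"
  shows "(\<integral>\<^sup>+\<omega>. ennreal (exp (\<theta> * (\<Sum>k<n. bwd k \<omega> * \<xi> k \<omega>))) \<partial>M) \<le> 7"
proof -
  let ?r = "\<lambda>k. n - Suc k"
  have "(\<integral>\<^sup>+\<omega>. ennreal (exp (\<theta> * (\<Sum>k<n. bwd k \<omega> * \<xi> k \<omega>))) \<partial>M)
    = (\<integral>\<^sup>+\<omega>. ennreal (exp (\<theta> * (\<Sum>k<n. bwd (?r k) \<omega> * \<xi> (?r k) \<omega>))) \<partial>M)"
    by (subst sum.nat_diff_reindex) simp
  also have "\<dots> \<le> 1 + (\<integral>\<^sup>+\<omega>. ennreal (exp (2 * \<theta>\<^sup>2 * (\<Sum>k<n. (bwd (?r k) \<omega>)\<^sup>2 * cov (\<xi> (?r k)) (\<xi> (?r k))))) \<partial>M)"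
    by (rule nn_integral_exp_transform_le; intro \<xi>_mem cov_\<xi>_\<xi> borel_measurable_bwd; simp)
  also have "\<dots> \<le> 1 + 6"
    by (intro add_left_mono nn_integral_exp_coefficients[where f="\<lambda>k. Suc (?r k)"] bwd_le \<theta> cov_\<xi>_self) auto
  finally show ?thesis by simp
qed

text \<open>The drift that the regression produces. With \<open>B i (Suc k)\<close> of order \<open>sqrt (v * (k + 1) / n)\<close>, the \<open>k\<close>-th
  term is a normalised variable times \<open>w k = 1 / sqrt ((k + 1) * n)\<close>, and these weights have total mass
  at most \<open>2\<close>.\<close>

lemma nn_integral_exp_drift:
  assumes \<theta>: "\<bar>\<theta>\<bar> = 3 * \<alpha> / (sqrt v * D)"
  shows "(\<integral>\<^sup>+\<omega>. ennreal (exp (\<theta> * (\<Sum>k<n. bwd k \<omega> * (B i (Suc k) \<omega> / real (Suc k))))) \<partial>M) \<le> 8"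
proof -
  define w where "w k = 1 / (sqrt (real (Suc k)) * sqrt (real n))" for k
  define S where "S = (\<Sum>k<n. w k)"
  define G where "G k \<omega> = real n / (v * real (Suc k)) * (B i (Suc k) \<omega>)\<^sup>2" for k \<omega>
  have w_pos: "0 < w k" for k using n_pos by (simp add: w_def)
  have S_pos: "0 < S" unfolding S_def using n_pos w_pos by (intro sum_pos) auto
  have S_le: "S \<le> 2"
  proof -
    have "S = (\<Sum>k<n. 1 / sqrt (real (Suc k))) / sqrt (real n)"
      by (simp add: S_def w_def sum_divide_distrib)
    also have "\<dots> \<le> 2" using sum_inverse_sqrt_le[of n] n_pos by (subst pos_divide_le_eq) auto
    finally show ?thesis .
  qed
  \<comment> \<open>normalising the weights to total mass one costs the factor \<open>S \<le> 2\<close>\<close>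
  have "\<theta> * (\<Sum>k<n. bwd k \<omega> * (B i (Suc k) \<omega> / real (Suc k)))
      \<le> (\<Sum>k<n. w k / S * (3 * (\<alpha> * \<kappa>) * V (Suc k) \<omega> + 3 * (\<alpha> * \<kappa>) * G k \<omega>))" for \<omega>
    unfolding sum_distrib_left
  proof (rule sum_mono)
    fix k assume "k \<in> {..<n}"
    then have k: "k < n" by simp
    let ?b = "B i (Suc k) \<omega>"
    let ?N = "infnorm (y + Zvec (Suc k) \<omega>)"
    define p where "p = ?N / D"
    define q where "q = sqrt (real n) * \<bar>?b\<bar> / (sqrt v * sqrt (real (Suc k)))"
    have p2: "p\<^sup>2 = V (Suc k) \<omega>" by (simp add: p_def V_def power_divide)
    have q2: "q\<^sup>2 = G k \<omega>" using v_pos by (simp add: q_def G_def power_divide power_mult_distrib)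
    have "\<theta> * (bwd k \<omega> * (?b / real (Suc k))) \<le> \<bar>\<theta>\<bar> * (\<bar>bwd k \<omega>\<bar> * (\<bar>?b\<bar> / real (Suc k)))"
      by (rule order_trans[OF abs_ge_self]) (simp add: abs_mult)
    also have "\<dots> \<le> \<bar>\<theta>\<bar> * ((\<kappa> * ?N) * (\<bar>?b\<bar> / real (Suc k)))"
      by (intro mult_left_mono mult_right_mono bwd_le k) auto
    also have "\<dots> = w k * (3 * (\<alpha> * \<kappa>)) * (p * q)"
    proof -
      have "real (Suc k) = sqrt (real (Suc k)) * sqrt (real (Suc k))" by simp
      then have eq: "\<bar>?b\<bar> / real (Suc k) = w k * (sqrt (real n) * \<bar>?b\<bar> / sqrt (real (Suc k)))"
        using n_pos by (simp add: w_def)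
      show ?thesis
        unfolding \<theta> p_def q_def eq by (simp add: mult_ac del: of_nat_Suc)
    qed
    also have "\<dots> \<le> w k * (3 * (\<alpha> * \<kappa>)) * ((p\<^sup>2 + q\<^sup>2) / 2)"
      using sum_squares_bound[of p q] w_pos[of k] \<alpha>_pos \<kappa>_pos
      by (intro mult_left_mono) (auto simp: less_imp_le)
    also have "\<dots> = w k / 2 * (3 * (\<alpha> * \<kappa>) * (p\<^sup>2 + q\<^sup>2))" by simp
    also have "\<dots> \<le> w k / S * (3 * (\<alpha> * \<kappa>) * (p\<^sup>2 + q\<^sup>2))"
      using S_le S_pos w_pos[of k] \<alpha>_pos \<kappa>_pos
      by (intro mult_right_mono divide_left_mono) (auto simp: less_imp_le)
    finally show "\<theta> * (bwd k \<omega> * (?b / real (Suc k))) \<le> w k / S * (3 * (\<alpha> * \<kappa>) * V (Suc k) \<omega> + 3 * (\<alpha> * \<kappa>) * G k \<omega>)"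
      by (simp add: p2 q2 distrib_left)
  qed
  then have "(\<integral>\<^sup>+\<omega>. ennreal (exp (\<theta> * (\<Sum>k<n. bwd k \<omega> * (B i (Suc k) \<omega> / real (Suc k))))) \<partial>M)
      \<le> (\<integral>\<^sup>+\<omega>. ennreal (exp (\<Sum>k<n. w k / S * (3 * (\<alpha> * \<kappa>) * V (Suc k) \<omega> + 3 * (\<alpha> * \<kappa>) * G k \<omega>))) \<partial>M)"
    by (intro nn_integral_mono ennreal_leI) simp
  also have "\<dots> \<le> 8"
  proof (rule nn_integral_exp_sum_le)
    show "(\<Sum>k<n. w k / S) = 1"
      using S_pos by (simp add: sum_divide_distrib[symmetric] S_def[symmetric])
    show "0 \<le> w k / S" for k using w_pos[of k] S_pos by simp
    fix k assume "k \<in> {..<n}"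
    then have k: "k < n" by simp
    note [measurable] = measurable_walk[OF k]
    have [measurable]: "G k \<in> borel_measurable M" unfolding G_def by measurable
    show "(\<lambda>\<omega>. 3 * (\<alpha> * \<kappa>) * V (Suc k) \<omega> + 3 * (\<alpha> * \<kappa>) * G k \<omega>) \<in> borel_measurable M"
      by measurable
    have "(\<integral>\<^sup>+\<omega>. ennreal (exp (3 * (\<alpha> * \<kappa>) * V (Suc k) \<omega> + 3 * (\<alpha> * \<kappa>) * G k \<omega>)) \<partial>M)
        \<le> (\<integral>\<^sup>+\<omega>. ennreal (exp ((6 * (\<alpha> * \<kappa>)) * V (Suc k) \<omega>)) + ennreal (exp ((6 * (\<alpha> * \<kappa>)) * G k \<omega>)) \<partial>M)"
    proof (intro nn_integral_mono)
      fix \<omega>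
      show "ennreal (exp (3 * (\<alpha> * \<kappa>) * V (Suc k) \<omega> + 3 * (\<alpha> * \<kappa>) * G k \<omega>))
        \<le> ennreal (exp ((6 * (\<alpha> * \<kappa>)) * V (Suc k) \<omega>)) + ennreal (exp ((6 * (\<alpha> * \<kappa>)) * G k \<omega>))"
        using exp_add_le[of "3 * (\<alpha> * \<kappa>) * V (Suc k) \<omega>" "3 * (\<alpha> * \<kappa>) * G k \<omega>"]
        by (simp add: mult.assoc ennreal_leI flip: ennreal_plus)
    qed
    also have "\<dots> = (\<integral>\<^sup>+\<omega>. ennreal (exp ((6 * (\<alpha> * \<kappa>)) * V (Suc k) \<omega>)) \<partial>M)
        + (\<integral>\<^sup>+\<omega>. ennreal (exp ((6 * (\<alpha> * \<kappa>)) * G k \<omega>)) \<partial>M)"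
      by (rule nn_integral_add) measurable
    also have "\<dots> \<le> 6 + 2"
    proof (rule add_mono)
      show "(\<integral>\<^sup>+\<omega>. ennreal (exp ((6 * (\<alpha> * \<kappa>)) * V (Suc k) \<omega>)) \<partial>M) \<le> 6"
        using k \<alpha>_small \<alpha>_pos \<kappa>_pos by (intro nn_integral_exp_V) auto
      have "(\<integral>\<^sup>+\<omega>. ennreal (exp ((6 * (\<alpha> * \<kappa>) * (real n / (v * real (Suc k)))) * (B i (Suc k) \<omega>)\<^sup>2)) \<partial>M) \<le> 2"
      proof (rule nn_integral_exp_square_le)
        show "B i (Suc k) \<in> H" using k by (intro B_mem) simp
        have "6 * (\<alpha> * \<kappa>) * (real n / (v * real (Suc k))) * cov (B i (Suc k)) (B i (Suc k)) = 6 * (\<alpha> * \<kappa>)"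
        proof -
          have "cov (B i (Suc k)) (B i (Suc k)) = v * real (Suc k) / real n"
            using k by (simp add: cov_BB del: of_nat_Suc)
          then show ?thesis using v_pos n_pos by (simp del: of_nat_Suc)
        qed
        then show "6 * (\<alpha> * \<kappa>) * (real n / (v * real (Suc k))) * cov (B i (Suc k)) (B i (Suc k)) \<le> 1 / 4"
          using \<alpha>\<kappa>_le by simp
      qed
      then show "(\<integral>\<^sup>+\<omega>. ennreal (exp ((6 * (\<alpha> * \<kappa>)) * G k \<omega>)) \<partial>M) \<le> 2"
        unfolding G_def by (simp only: mult.assoc)
    qed
    finally show "(\<integral>\<^sup>+\<omega>. ennreal (exp (3 * (\<alpha> * \<kappa>) * V (Suc k) \<omega> + 3 * (\<alpha> * \<kappa>) * G k \<omega>)) \<partial>M) \<le> 8"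
      by simp
  qed simp
  finally show ?thesis .
qed

lemma nn_integral_exp_signed:
  assumes \<rho>: "\<bar>\<rho>\<bar> = \<alpha> / (sqrt v * D)"
  shows "(\<integral>\<^sup>+\<omega>. ennreal (exp (\<rho> * (\<Sum>k<n. (bwd k \<omega> - fwd k \<omega>) * \<Delta> k \<omega>))) \<partial>M) \<le> 22"
proof -
  let ?F = "\<lambda>\<omega>. \<Sum>k<n. fwd k \<omega> * \<Delta> k \<omega>"
  let ?R = "\<lambda>\<omega>. \<Sum>k<n. bwd k \<omega> * \<xi> k \<omega>"
  let ?T = "\<lambda>\<omega>. \<Sum>k<n. bwd k \<omega> * (B i (Suc k) \<omega> / real (Suc k))"
  note [measurable] = measurable_walk
  have "\<rho>\<^sup>2 = (\<alpha> / (sqrt v * D))\<^sup>2" by (metis \<rho> power2_abs)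
  also have "\<dots> = \<alpha>\<^sup>2 / (v * D\<^sup>2)"
    using v_pos by (simp add: power_divide power_mult_distrib)
  finally have \<rho>2: "\<rho>\<^sup>2 = \<alpha>\<^sup>2 / (v * D\<^sup>2)" .
  have \<Delta>_split: "\<Delta> k \<omega> = \<xi> k \<omega> + B i (Suc k) \<omega> / real (Suc k)" for k \<omega>
  proof -
    have "real k / real (Suc k) = 1 - 1 / real (Suc k)" by (simp add: field_simps)
    then show ?thesis unfolding \<Delta>_def \<xi>_def by (simp add: left_diff_distrib del: of_nat_Suc)
  qed
  have "(\<Sum>k<n. (bwd k \<omega> - fwd k \<omega>) * \<Delta> k \<omega>) = ?R \<omega> + ?T \<omega> - ?F \<omega>" for \<omega>
  proof -
    have "(bwd k \<omega> - fwd k \<omega>) * \<Delta> k \<omega>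
      = bwd k \<omega> * \<xi> k \<omega> + bwd k \<omega> * (B i (Suc k) \<omega> / real (Suc k)) - fwd k \<omega> * \<Delta> k \<omega>" for k
      unfolding left_diff_distrib by (simp add: \<Delta>_split[of k] distrib_left)
    then show ?thesis by (simp add: sum_subtractf sum.distrib)
  qed
  then have eq: "\<rho> * (\<Sum>k<n. (bwd k \<omega> - fwd k \<omega>) * \<Delta> k \<omega>) = \<rho> * ?R \<omega> + \<rho> * ?T \<omega> + (- \<rho>) * ?F \<omega>" for \<omega>
    by (simp add: distrib_left right_diff_distrib)
  have "(\<integral>\<^sup>+\<omega>. ennreal (exp (\<rho> * (\<Sum>k<n. (bwd k \<omega> - fwd k \<omega>) * \<Delta> k \<omega>))) \<partial>M)
     \<le> (\<integral>\<^sup>+\<omega>. ennreal (exp ((3 * \<rho>) * ?R \<omega>)) + ennreal (exp ((3 * \<rho>) * ?T \<omega>)) + ennreal (exp ((- 3 * \<rho>) * ?F \<omega>)) \<partial>M)"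
  proof (intro nn_integral_mono)
    fix \<omega>
    have "exp (\<rho> * (\<Sum>k<n. (bwd k \<omega> - fwd k \<omega>) * \<Delta> k \<omega>))
       \<le> exp ((3 * \<rho>) * ?R \<omega>) + exp ((3 * \<rho>) * ?T \<omega>) + exp ((- 3 * \<rho>) * ?F \<omega>)"
      unfolding eq using exp_add3_le[of "\<rho> * ?R \<omega>" "\<rho> * ?T \<omega>" "(- \<rho>) * ?F \<omega>"]
      by (simp only: mult.assoc mult_minus_left mult_minus_right)
    then have "ennreal (exp (\<rho> * (\<Sum>k<n. (bwd k \<omega> - fwd k \<omega>) * \<Delta> k \<omega>)))
       \<le> ennreal (exp ((3 * \<rho>) * ?R \<omega>) + exp ((3 * \<rho>) * ?T \<omega>) + exp ((- 3 * \<rho>) * ?F \<omega>))"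
      by (rule ennreal_leI)
    then show "ennreal (exp (\<rho> * (\<Sum>k<n. (bwd k \<omega> - fwd k \<omega>) * \<Delta> k \<omega>)))
       \<le> ennreal (exp ((3 * \<rho>) * ?R \<omega>)) + ennreal (exp ((3 * \<rho>) * ?T \<omega>)) + ennreal (exp ((- 3 * \<rho>) * ?F \<omega>))"
      by (simp only: ennreal_plus exp_ge_zero add_nonneg_nonneg)
  qed
  also have "\<dots> = (\<integral>\<^sup>+\<omega>. ennreal (exp ((3 * \<rho>) * ?R \<omega>)) \<partial>M) + (\<integral>\<^sup>+\<omega>. ennreal (exp ((3 * \<rho>) * ?T \<omega>)) \<partial>M)
      + (\<integral>\<^sup>+\<omega>. ennreal (exp ((- 3 * \<rho>) * ?F \<omega>)) \<partial>M)"
  proof -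
    have [measurable]: "?R \<in> borel_measurable M" "?T \<in> borel_measurable M" "?F \<in> borel_measurable M"
      by measurable
    show ?thesis by (subst nn_integral_add; measurable)+
  qed
  also have "\<dots> \<le> 7 + 8 + 7"
  proof (intro add_mono nn_integral_exp_backward nn_integral_exp_drift nn_integral_exp_forward)
    show "(3 * \<rho>)\<^sup>2 = 9 * \<alpha>\<^sup>2 / (v * D\<^sup>2)" "(- 3 * \<rho>)\<^sup>2 = 9 * \<alpha>\<^sup>2 / (v * D\<^sup>2)"
      by (simp_all add: power_mult_distrib \<rho>2)
    show "\<bar>3 * \<rho>\<bar> = 3 * \<alpha> / (sqrt v * D)"
      by (simp add: abs_mult \<rho>)
  qed
  finally show ?thesis by simp
qed

text \<open>The bound does not depend on \<^term>\<open>n\<close>, \<^term>\<open>v\<close>, \<^term>\<open>D\<close> or the regularity of \<^term>\<open>h\<close>.\<close>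

theorem nn_integral_exp_walk:
  "(\<integral>\<^sup>+\<omega>. ennreal (exp (\<alpha> / (sqrt v * D) * \<bar>\<Sum>k<n. (bwd k \<omega> - fwd k \<omega>) * \<Delta> k \<omega>\<bar>)) \<partial>M) \<le> 44"
proof -
  let ?\<rho> = "\<alpha> / (sqrt v * D)"
  let ?S = "\<lambda>\<omega>. \<Sum>k<n. (bwd k \<omega> - fwd k \<omega>) * \<Delta> k \<omega>"
  note [measurable] = measurable_walk
  have "0 \<le> ?\<rho>" using \<alpha>_pos v_pos D_pos by simp
  have "(\<integral>\<^sup>+\<omega>. ennreal (exp (?\<rho> * \<bar>?S \<omega>\<bar>)) \<partial>M)
      \<le> (\<integral>\<^sup>+\<omega>. ennreal (exp (?\<rho> * ?S \<omega>)) + ennreal (exp ((- ?\<rho>) * ?S \<omega>)) \<partial>M)"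
  proof (intro nn_integral_mono)
    fix \<omega>
    show "ennreal (exp (?\<rho> * \<bar>?S \<omega>\<bar>)) \<le> ennreal (exp (?\<rho> * ?S \<omega>)) + ennreal (exp ((- ?\<rho>) * ?S \<omega>))"
      by (cases "0 \<le> ?S \<omega>") (auto simp: abs_of_nonneg abs_of_neg)
  qed
  also have "\<dots> = (\<integral>\<^sup>+\<omega>. ennreal (exp (?\<rho> * ?S \<omega>)) \<partial>M) + (\<integral>\<^sup>+\<omega>. ennreal (exp ((- ?\<rho>) * ?S \<omega>)) \<partial>M)"
    by (subst nn_integral_add, measurable)
  also have "\<dots> \<le> 22 + 22"
    by (intro add_mono nn_integral_exp_signed) (simp_all only: abs_minus_cancel abs_of_nonneg[OF \<open>0 \<le> ?\<rho>\<close>])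
  finally show ?thesis by simp
qed

end

section \<open>Dyadic sums\<close>

lemma integral_eq_mean_value:
  fixes f :: "real \<Rightarrow> real"
  assumes f: "continuous_on {0..1} f" and ab: "0 \<le> a" "a < b" "b \<le> 1"
  obtains x where "a < x" "x < b" "integral {0..b} f - integral {0..a} f = f x * (b - a)"
proof -
  have "\<exists>x\<in>{a<..<b}. integral {0..b} f - integral {0..a} f = f x * (b - a)"
  proof (rule mvt_simple[OF ab(2), of "\<lambda>t. integral {0..t} f" "\<lambda>x. (*) (f x)"])
    fix x assume x: "a \<le> x" "x \<le> b"
    have "((\<lambda>t. integral {0..t} f) has_real_derivative f x) (at x within {0..1})"
      by (rule integral_has_real_derivative[OF f]) (use x ab in auto)
    then show "((\<lambda>t. integral {0..t} f) has_derivative (*) (f x)) (at x within {a..b})"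
      unfolding has_field_derivative_def by (rule has_derivative_subset) (use ab in auto)
  qed
  then show ?thesis using that by auto
qed

text \<open>The mean value theorem on each dyadic interval turns the integral itself into a Riemann sum.\<close>

lemma dyadic_riemann_sum_le:
  fixes f :: "real \<Rightarrow> real"
  assumes f: "continuous_on {0..1} f"
    and osc: "\<And>x x'. x \<in> {0..1} \<Longrightarrow> x' \<in> {0..1} \<Longrightarrow> \<bar>x - x'\<bar> \<le> 1 / 2 ^ M \<Longrightarrow> \<bar>f x - f x'\<bar> \<le> e"
  shows "\<bar>(\<Sum>j<2 ^ M. f (real (Suc j) / 2 ^ M) / 2 ^ M) - integral {0..1} f\<bar> \<le> e"
proof -
  define F where "F j = integral {0..real j / 2 ^ M} f" for j
  have step: "\<bar>f (real (Suc j) / 2 ^ M) / 2 ^ M - (F (Suc j) - F j)\<bar> \<le> e / 2 ^ M" if j: "j < 2 ^ M" for j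
  proof -
    have "real (Suc j) \<le> real (2 ^ M)" using j by (intro of_nat_mono) simp
    then have le: "real (Suc j) / 2 ^ M \<le> 1" by (simp add: field_simps)
    have diff: "real (Suc j) / 2 ^ M - real j / 2 ^ M = 1 / 2 ^ M"
      by (simp add: field_simps)
    obtain x where x: "real j / 2 ^ M < x" "x < real (Suc j) / 2 ^ M"
        "F (Suc j) - F j = f x * (real (Suc j) / 2 ^ M - real j / 2 ^ M)"
      unfolding F_def
      by (rule integral_eq_mean_value[OF f, of "real j / 2 ^ M" "real (Suc j) / 2 ^ M"])
         (use le in \<open>auto simp: divide_strict_right_mono\<close>)
    have "\<bar>f (real (Suc j) / 2 ^ M) - f x\<bar> \<le> e"
    proof (rule osc)
      show "real (Suc j) / 2 ^ M \<in> {0..1}" using le by (simp del: of_nat_Suc)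
      have "0 \<le> real j / 2 ^ M" by simp
      then show "x \<in> {0..1}" using x(1,2) le unfolding atLeastAtMost_iff by linarith
      show "\<bar>real (Suc j) / 2 ^ M - x\<bar> \<le> 1 / 2 ^ M" using x(1,2) diff by linarith
    qed
    then have "\<bar>f (real (Suc j) / 2 ^ M) - f x\<bar> / 2 ^ M \<le> e / 2 ^ M"
      by (intro divide_right_mono) auto
    then show ?thesis
      unfolding x(3) diff by (simp add: diff_divide_distrib[symmetric])
  qed
  have "(\<Sum>j<2 ^ M. F (Suc j) - F j) = integral {0..1} f"
    unfolding sum_lessThan_telescope by (simp add: F_def)
  then have "\<bar>(\<Sum>j<2 ^ M. f (real (Suc j) / 2 ^ M) / 2 ^ M) - integral {0..1} f\<bar>
      = \<bar>\<Sum>j<2 ^ M. f (real (Suc j) / 2 ^ M) / 2 ^ M - (F (Suc j) - F j)\<bar>"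
    by (simp add: sum_subtractf)
  also have "\<dots> \<le> (\<Sum>j<(2 :: nat) ^ M. e / 2 ^ M)"
    by (rule order_trans[OF sum_abs]) (intro sum_mono step, simp)
  also have "\<dots> = e" by simp
  finally show ?thesis .
qed

lemma sum_dyadic_blocks:
  fixes F :: "nat \<Rightarrow> real"
  shows "(\<Sum>k<2 ^ (N + M). F k) = (\<Sum>j<2 ^ M. \<Sum>r<2 ^ N. F (j * 2 ^ N + r))"
proof -
  have "(\<Sum>k<2 ^ (N + M). F k) = (\<Sum>j<2 ^ M. sum F {j * 2 ^ N..<j * 2 ^ N + 2 ^ N})"
    by (simp add: sum.nat_group power_add mult.commute)
  also have "\<dots> = (\<Sum>j<2 ^ M. \<Sum>r<2 ^ N. F (j * 2 ^ N + r))"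
  proof (rule sum.cong[OF refl])
    fix j
    have "sum F {a..<a + b} = (\<Sum>r<b. F (a + r))" for a b :: nat
      by (induction b) auto
    then show "sum F {j * 2 ^ N..<j * 2 ^ N + 2 ^ N} = (\<Sum>r<2 ^ N. F (j * 2 ^ N + r))" .
  qed
  finally show ?thesis .
qed

text \<open>Weights at the dyadic points of order \<open>N\<close> whose mass on every fixed dyadic interval tends to \<^term>\<open>L\<close>
  times its length converge weakly to \<^term>\<open>L\<close> times Lebesgue measure. The integrand \<^term>\<open>f\<close> may be
  replaced by values \<^term>\<open>\<phi>\<close> that are uniformly close to it.\<close>

lemma dyadic_weighted_sums_tendsto:
  fixes f :: "real \<Rightarrow> real" and w \<phi> :: "nat \<Rightarrow> nat \<Rightarrow> real"
  assumes f: "continuous_on {0..1} f"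
    and w: "\<And>N k. 0 \<le> w N k"
    and blocks: "\<And>M j. j < 2 ^ M \<Longrightarrow> (\<lambda>N. \<Sum>r<2 ^ N. w (N + M) (j * 2 ^ N + r)) \<longlonglongrightarrow> L / 2 ^ M"
    and \<phi>: "\<And>e. 0 < e \<Longrightarrow> \<forall>\<^sub>F N in sequentially. \<forall>k<2 ^ N. \<bar>\<phi> N k - f (real (Suc k) / 2 ^ N)\<bar> \<le> e"
  shows "(\<lambda>N. \<Sum>k<2 ^ N. w N k * \<phi> N k) \<longlonglongrightarrow> L * integral {0..1} f"
proof (rule LIMSEQ_I, unfold real_norm_def)
  fix r :: real assume "0 < r"
  \<comment> \<open>chosen so that the three errors below add up to less than \<open>r\<close>\<close>
  define e where "e = r / (4 * (\<bar>L\<bar> + 1) + 1)"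
  have e: "0 < e" unfolding e_def using \<open>0 < r\<close> by (intro divide_pos_pos) auto
  have "uniformly_continuous_on {0..1} f"
    by (intro compact_uniformly_continuous f) simp
  then obtain d where d: "0 < d" "\<And>x x'. x \<in> {0..1} \<Longrightarrow> x' \<in> {0..1} \<Longrightarrow> dist x' x < d \<Longrightarrow> dist (f x') (f x) < e"
    using e unfolding uniformly_continuous_on_def by blast
  obtain M :: nat where M: "(1 / 2) ^ M < d"
    using real_arch_pow_inv[OF d(1), of "1/2"] by auto
  have osc: "\<bar>f x - f x'\<bar> \<le> e" if "x \<in> {0..1}" "x' \<in> {0..1}" "\<bar>x - x'\<bar> \<le> 1 / 2 ^ M" for x x'
    using d(2)[of x' x] that M by (simp add: dist_real_def power_one_over less_imp_le)
  have riemann: "\<bar>(\<Sum>j<2 ^ M. f (real (Suc j) / 2 ^ M) / 2 ^ M) - integral {0..1} f\<bar> \<le> e"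
    by (rule dyadic_riemann_sum_le[OF f osc])
  define W where "W N j = (\<Sum>r<2 ^ N. w (N + M) (j * 2 ^ N + r))" for N j
  have W: "(\<lambda>N. W N j) \<longlonglongrightarrow> L / 2 ^ M" if "j < 2 ^ M" for j
    unfolding W_def by (rule blocks[OF that])
  have "(\<lambda>N. \<Sum>j<2 ^ M. W N j) \<longlonglongrightarrow> (\<Sum>j<(2 ^ M :: nat). L / 2 ^ M)"
    by (intro tendsto_sum W) simp
  then have lim1: "(\<lambda>N. \<Sum>j<2 ^ M. W N j) \<longlonglongrightarrow> L" by simp
  have "(\<lambda>N. \<Sum>j<2 ^ M. f (real (Suc j) / 2 ^ M) * W N j)
      \<longlonglongrightarrow> (\<Sum>j<2 ^ M. f (real (Suc j) / 2 ^ M) * (L / 2 ^ M))"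
    by (intro tendsto_sum tendsto_mult tendsto_const W) simp
  then have lim2: "(\<lambda>N. \<Sum>j<2 ^ M. f (real (Suc j) / 2 ^ M) * W N j)
      \<longlonglongrightarrow> L * (\<Sum>j<2 ^ M. f (real (Suc j) / 2 ^ M) / 2 ^ M)"
    by (simp add: sum_distrib_left mult_ac)
  have ev1: "\<forall>\<^sub>F N in sequentially. (\<Sum>j<2 ^ M. W N j) < \<bar>L\<bar> + 1"
    by (rule order_tendstoD(2)[OF lim1]) simp
  have ev2: "\<forall>\<^sub>F N in sequentially. \<bar>(\<Sum>j<2 ^ M. f (real (Suc j) / 2 ^ M) * W N j)
      - L * (\<Sum>j<2 ^ M. f (real (Suc j) / 2 ^ M) / 2 ^ M)\<bar> < e"
    using tendstoD[OF lim2 e] by (simp add: dist_real_def)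
  have ev3: "\<forall>\<^sub>F N in sequentially. \<forall>k<2 ^ (N + M). \<bar>\<phi> (N + M) k - f (real (Suc k) / 2 ^ (N + M))\<bar> \<le> e"
    using \<phi>[OF e] unfolding eventually_sequentially by (metis trans_le_add1)
  have "\<forall>\<^sub>F N in sequentially. \<bar>(\<Sum>k<2 ^ (N + M). w (N + M) k * \<phi> (N + M) k) - L * integral {0..1} f\<bar> < r"
    using ev1 ev2 ev3
  proof eventually_elim
    case (elim N)
    have close: "\<bar>\<phi> (N + M) (j * 2 ^ N + s) - f (real (Suc j) / 2 ^ M)\<bar> \<le> 2 * e"
      if j: "j < 2 ^ M" and s: "s < 2 ^ N" for j s :: nat
    proof -
      let ?k = "j * 2 ^ N + s"
      have "?k + 1 \<le> (j + 1) * 2 ^ N" using s by simp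
      also have "\<dots> \<le> 2 ^ M * 2 ^ N" using j by (intro mult_right_mono) auto
      finally have k: "?k < 2 ^ (N + M)" by (simp add: power_add mult.commute)
      have pow: "(2 :: real) ^ (N + M) = 2 ^ N * 2 ^ M" by (simp add: power_add)
      have "real (Suc ?k) / 2 ^ (N + M) = real j / 2 ^ M + real (Suc s) / 2 ^ N * (1 / 2 ^ M)"
        unfolding pow by (simp add: field_simps)
      moreover have "real (Suc s) / 2 ^ N \<le> 1" "0 \<le> real (Suc s) / 2 ^ N"
      proof -
        have "real (Suc s) \<le> real (2 ^ N)" using s by (intro of_nat_mono) simp
        then show "real (Suc s) / 2 ^ N \<le> 1" by (simp add: field_simps)
      qed simp
      then have "real (Suc s) / 2 ^ N * (1 / 2 ^ M) \<le> 1 * (1 / 2 ^ M)"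
        by (intro mult_right_mono) auto
      moreover have "0 \<le> real (Suc s) / 2 ^ N * (1 / 2 ^ M)" by simp
      moreover have "real (Suc j) / 2 ^ M = real j / 2 ^ M + 1 / 2 ^ M" by (simp add: field_simps)
      moreover have "real (Suc j) / 2 ^ M \<le> 1"
      proof -
        have "real (Suc j) \<le> real (2 ^ M)" using j by (intro of_nat_mono) simp
        then show ?thesis by (simp add: field_simps)
      qed
      moreover have "0 \<le> real j / 2 ^ M" by simp
      ultimately have "\<bar>f (real (Suc ?k) / 2 ^ (N + M)) - f (real (Suc j) / 2 ^ M)\<bar> \<le> e"
        by (intro osc) (simp_all del: of_nat_Suc)
      moreover have "\<bar>\<phi> (N + M) ?k - f (real (Suc ?k) / 2 ^ (N + M))\<bar> \<le> e"
        using elim(3) k by blast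
      ultimately show ?thesis by linarith
    qed
    have "\<bar>(\<Sum>k<2 ^ (N + M). w (N + M) k * \<phi> (N + M) k) - (\<Sum>j<2 ^ M. f (real (Suc j) / 2 ^ M) * W N j)\<bar>
        = \<bar>\<Sum>j<2 ^ M. \<Sum>s<2 ^ N. w (N + M) (j * 2 ^ N + s) * (\<phi> (N + M) (j * 2 ^ N + s) - f (real (Suc j) / 2 ^ M))\<bar>"
      unfolding sum_dyadic_blocks W_def sum_distrib_left sum_subtractf[symmetric]
      by (simp only: right_diff_distrib mult.commute)
    also have "\<dots> \<le> (\<Sum>j<2 ^ M. \<Sum>s<2 ^ N. w (N + M) (j * 2 ^ N + s) * (2 * e))"
    proof (rule order_trans[OF sum_abs], rule sum_mono, rule order_trans[OF sum_abs], rule sum_mono)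
      fix j s :: nat assume "j \<in> {..<2 ^ M}" "s \<in> {..<2 ^ N}"
      then show "\<bar>w (N + M) (j * 2 ^ N + s) * (\<phi> (N + M) (j * 2 ^ N + s) - f (real (Suc j) / 2 ^ M))\<bar>
          \<le> w (N + M) (j * 2 ^ N + s) * (2 * e)"
        unfolding abs_mult abs_of_nonneg[OF w] by (intro mult_left_mono close w) auto
    qed
    also have "\<dots> = 2 * e * (\<Sum>j<2 ^ M. W N j)"
      unfolding W_def sum_distrib_left by (simp only: mult.commute)
    also have "\<dots> \<le> 2 * e * (\<bar>L\<bar> + 1)"
      using elim(1) e by (intro mult_left_mono) auto
    finally have 1: "\<bar>(\<Sum>k<2 ^ (N + M). w (N + M) k * \<phi> (N + M) k) - (\<Sum>j<2 ^ M. f (real (Suc j) / 2 ^ M) * W N j)\<bar>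
        \<le> 2 * e * (\<bar>L\<bar> + 1)" .
    have 2: "\<bar>L * (\<Sum>j<2 ^ M. f (real (Suc j) / 2 ^ M) / 2 ^ M) - L * integral {0..1} f\<bar> \<le> e * (\<bar>L\<bar> + 1)"
    proof -
      have "\<bar>L * (\<Sum>j<2 ^ M. f (real (Suc j) / 2 ^ M) / 2 ^ M) - L * integral {0..1} f\<bar>
          = \<bar>L\<bar> * \<bar>(\<Sum>j<2 ^ M. f (real (Suc j) / 2 ^ M) / 2 ^ M) - integral {0..1} f\<bar>"
        unfolding right_diff_distrib[symmetric] abs_mult ..
      also have "\<dots> \<le> \<bar>L\<bar> * e" by (intro mult_left_mono riemann) simp
      also have "\<dots> \<le> e * (\<bar>L\<bar> + 1)" using e by (simp add: distrib_left mult.commute)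
      finally show ?thesis .
    qed
    have "r = e * (4 * (\<bar>L\<bar> + 1) + 1)" unfolding e_def by simp
    then have "r = 4 * (e * (\<bar>L\<bar> + 1)) + e" by (simp add: distrib_left)
    moreover have "0 < e * (\<bar>L\<bar> + 1)" using e by (intro mult_pos_pos) auto
    ultimately show ?case using 1 2 elim(2) by linarith
  qed
  then obtain N0 where N0: "\<And>N. N \<ge> N0 \<Longrightarrow>
      \<bar>(\<Sum>k<2 ^ (N + M). w (N + M) k * \<phi> (N + M) k) - L * integral {0..1} f\<bar> < r"
    unfolding eventually_sequentially by blast
  show "\<exists>no. \<forall>n\<ge>no. \<bar>(\<Sum>k<2 ^ n. w n k * \<phi> n k) - L * integral {0..1} f\<bar> < r"
  proof (intro exI[of _ "N0 + M"] allI impI)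
    fix n assume "N0 + M \<le> n"
    then show "\<bar>(\<Sum>k<2 ^ n. w n k * \<phi> n k) - L * integral {0..1} f\<bar> < r"
      using N0[of "n - M"] by simp
  qed
qed

context gaussian_space
begin

lemma
  assumes X: "X \<in> H" and Y: "Y \<in> H" and XY: "cov X Y = 0"
  shows integrable_centered_squares: "integrable M (\<lambda>\<omega>. ((X \<omega>)\<^sup>2 - cov X X) * ((Y \<omega>)\<^sup>2 - cov Y Y))"
    and expectation_centered_squares: "expectation (\<lambda>\<omega>. ((X \<omega>)\<^sup>2 - cov X X) * ((Y \<omega>)\<^sup>2 - cov Y Y)) = 0"
proof -
  have int: "integrable M (\<lambda>\<omega>. (Z \<omega>)\<^sup>2 - cov Z Z)" if "Z \<in> H" for Z
    using integrable_power[OF that, of 2] by simp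
  have zero: "expectation (\<lambda>\<omega>. (Z \<omega>)\<^sup>2 - cov Z Z) = 0" if "Z \<in> H" for Z
    using integrable_power[OF that, of 2] by (simp add: cov_def power2_eq_square prob_space)
  have "indep_var borel ((\<lambda>x. x\<^sup>2 - cov X X) \<circ> X) borel ((\<lambda>y. y\<^sup>2 - cov Y Y) \<circ> Y)"
    by (rule indep_var_compose[OF indep_var_mem[OF X Y XY]]) measurable
  then have indep: "indep_var borel (\<lambda>\<omega>. (X \<omega>)\<^sup>2 - cov X X) borel (\<lambda>\<omega>. (Y \<omega>)\<^sup>2 - cov Y Y)"
    by (simp add: comp_def)
  show "integrable M (\<lambda>\<omega>. ((X \<omega>)\<^sup>2 - cov X X) * ((Y \<omega>)\<^sup>2 - cov Y Y))"
    by (rule indep_var_integrable[OF indep int[OF X] int[OF Y]])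
  show "expectation (\<lambda>\<omega>. ((X \<omega>)\<^sup>2 - cov X X) * ((Y \<omega>)\<^sup>2 - cov Y Y)) = 0"
    using indep_var_lebesgue_integral[OF indep int[OF X] int[OF Y]] zero[OF X] by simp
qed

lemma
  assumes X: "X \<in> H"
  shows integrable_centered_square_power2: "integrable M (\<lambda>\<omega>. ((X \<omega>)\<^sup>2 - cov X X) * ((X \<omega>)\<^sup>2 - cov X X))"
    and expectation_centered_square_power2:
      "expectation (\<lambda>\<omega>. ((X \<omega>)\<^sup>2 - cov X X) * ((X \<omega>)\<^sup>2 - cov X X)) = 2 * (cov X X)\<^sup>2"
proof -
  have eq: "((X \<omega>)\<^sup>2 - cov X X) * ((X \<omega>)\<^sup>2 - cov X X) = X \<omega> ^ 4 - 2 * cov X X * X \<omega> ^ 2 + (cov X X)\<^sup>2" for \<omega>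
    by (simp add: algebra_simps power2_eq_square power4_eq_xxxx)
  show "integrable M (\<lambda>\<omega>. ((X \<omega>)\<^sup>2 - cov X X) * ((X \<omega>)\<^sup>2 - cov X X))"
    unfolding eq using integrable_power[OF X] by simp
  have "expectation (\<lambda>\<omega>. X \<omega> ^ 2) = cov X X" by (simp add: cov_def power2_eq_square)
  then show "expectation (\<lambda>\<omega>. ((X \<omega>)\<^sup>2 - cov X X) * ((X \<omega>)\<^sup>2 - cov X X)) = 2 * (cov X X)\<^sup>2"
    unfolding eq using integrable_power[OF X, of 2] integrable_power[OF X, of 4] expectation_power4[OF X]
    by (simp add: prob_space power2_eq_square)
qed

lemma
  assumes "finite I" and X: "\<And>r. r \<in> I \<Longrightarrow> X r \<in> H"
    and orth: "\<And>r s. r \<in> I \<Longrightarrow> s \<in> I \<Longrightarrow> r \<noteq> s \<Longrightarrow> cov (X r) (X s) = 0"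
    and self: "\<And>r. r \<in> I \<Longrightarrow> cov (X r) (X r) = u"
  shows integrable_sum_centered_squares: "integrable M (\<lambda>\<omega>. (\<Sum>r\<in>I. (X r \<omega>)\<^sup>2 - u)\<^sup>2)"
    and expectation_sum_centered_squares: "expectation (\<lambda>\<omega>. (\<Sum>r\<in>I. (X r \<omega>)\<^sup>2 - u)\<^sup>2) = real (card I) * (2 * u\<^sup>2)"
proof -
  have sq: "(\<Sum>r\<in>I. (X r \<omega>)\<^sup>2 - u)\<^sup>2 = (\<Sum>r\<in>I. \<Sum>s\<in>I. ((X r \<omega>)\<^sup>2 - u) * ((X s \<omega>)\<^sup>2 - u))" for \<omega>
    by (simp add: power2_eq_square sum_product)
  have int: "integrable M (\<lambda>\<omega>. ((X r \<omega>)\<^sup>2 - u) * ((X s \<omega>)\<^sup>2 - u))" if "r \<in> I" "s \<in> I" for r s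
    using integrable_centered_squares[OF X X orth, of r s] integrable_centered_square_power2[OF X, of r] that self
    by (cases "r = s") auto
  have ex: "expectation (\<lambda>\<omega>. ((X r \<omega>)\<^sup>2 - u) * ((X s \<omega>)\<^sup>2 - u)) = (if s = r then 2 * u\<^sup>2 else 0)"
    if "r \<in> I" "s \<in> I" for r s
    using expectation_centered_squares[OF X X orth, of r s] expectation_centered_square_power2[OF X, of r] that self
    by (cases "r = s") auto
  show "integrable M (\<lambda>\<omega>. (\<Sum>r\<in>I. (X r \<omega>)\<^sup>2 - u)\<^sup>2)"
    unfolding sq by (intro Bochner_Integration.integrable_sum int)
  have "expectation (\<lambda>\<omega>. (\<Sum>r\<in>I. (X r \<omega>)\<^sup>2 - u)\<^sup>2) = (\<Sum>r\<in>I. \<Sum>s\<in>I. if s = r then 2 * u\<^sup>2 else 0)"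
    unfolding sq using int ex by (simp add: Bochner_Integration.integral_sum Bochner_Integration.integrable_sum)
  also have "\<dots> = real (card I) * (2 * u\<^sup>2)"
    using assms(1) by simp
  finally show "expectation (\<lambda>\<omega>. (\<Sum>r\<in>I. (X r \<omega>)\<^sup>2 - u)\<^sup>2) = real (card I) * (2 * u\<^sup>2)" .
qed

text \<open>The squared errors have expectation of order \<open>2 ^ (- N)\<close>, which is summable, so that almost surely
  they tend to \<open>0\<close>.\<close>

lemma AE_dyadic_quadratic_variation:
  fixes X :: "nat \<Rightarrow> nat \<Rightarrow> 'w \<Rightarrow> real"
  assumes X: "\<And>N k. k < 2 ^ N \<Longrightarrow> X N k \<in> H"
    and orth: "\<And>N k l. k < 2 ^ N \<Longrightarrow> l < 2 ^ N \<Longrightarrow> k \<noteq> l \<Longrightarrow> cov (X N k) (X N l) = 0"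
    and self: "\<And>N k. k < 2 ^ N \<Longrightarrow> cov (X N k) (X N k) = v / 2 ^ N"
  shows "AE \<omega> in M. \<forall>m j. j < 2 ^ m \<longrightarrow>
    (\<lambda>N. \<Sum>r<2 ^ N. (X (N + m) (j * 2 ^ N + r) \<omega>)\<^sup>2) \<longlonglongrightarrow> v / 2 ^ m"
proof -
  have "AE \<omega> in M. (\<lambda>N. \<Sum>r<2 ^ N. (X (N + m) (j * 2 ^ N + r) \<omega>)\<^sup>2) \<longlonglongrightarrow> v / 2 ^ m"
    if j: "j < 2 ^ m" for m j :: nat
  proof -
    define Y where "Y N \<omega> = (\<Sum>r<2 ^ N. (X (N + m) (j * 2 ^ N + r) \<omega>)\<^sup>2 - v / 2 ^ (N + m))" for N \<omega>
    have idx: "j * 2 ^ N + r < 2 ^ (N + m)" if "r < 2 ^ N" for N r :: nat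
    proof -
      have "j * 2 ^ N + r < (j + 1) * 2 ^ N" using that by simp
      also have "\<dots> \<le> 2 ^ m * 2 ^ N" using j by (intro mult_right_mono) auto
      finally show ?thesis by (simp add: power_add mult.commute)
    qed
    have int: "integrable M (\<lambda>\<omega>. (Y N \<omega>)\<^sup>2)" for N
      unfolding Y_def by (rule integrable_sum_centered_squares) (auto intro!: X orth self idx)
    have EY: "expectation (\<lambda>\<omega>. (Y N \<omega>)\<^sup>2) \<le> 2 * v\<^sup>2 * (1 / 2) ^ N" for N
    proof -
      have "expectation (\<lambda>\<omega>. (Y N \<omega>)\<^sup>2) = real (card {..<(2 :: nat) ^ N}) * (2 * (v / 2 ^ (N + m))\<^sup>2)"
        unfolding Y_def by (rule expectation_sum_centered_squares) (auto intro!: X orth self idx)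
      also have "\<dots> = 2 * v\<^sup>2 * (1 / 2) ^ N * (1 / 2 ^ m)\<^sup>2"
        by (simp add: power_divide power_mult_distrib power_add power2_eq_square field_simps)
      also have "\<dots> \<le> 2 * v\<^sup>2 * (1 / 2) ^ N * 1"
        by (intro mult_left_mono) (auto simp: power_le_one_iff field_simps)
      finally show ?thesis by simp
    qed
    have "(\<integral>\<^sup>+\<omega>. (\<Sum>N. ennreal ((Y N \<omega>)\<^sup>2)) \<partial>M) = (\<Sum>N. \<integral>\<^sup>+\<omega>. ennreal ((Y N \<omega>)\<^sup>2) \<partial>M)"
      using int by (intro nn_integral_suminf) auto
    also have "\<dots> \<le> (\<Sum>N. ennreal (2 * v\<^sup>2 * (1 / 2) ^ N))"
      using EY int by (intro suminf_le) (auto simp: nn_integral_eq_integral ennreal_leI)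
    also have "\<dots> < \<infinity>"
    proof -
      have "summable (\<lambda>N. 2 * v\<^sup>2 * (1 / 2 :: real) ^ N)"
        by (intro summable_mult summable_geometric) simp
      then show ?thesis by (subst suminf_ennreal2) auto
    qed
    finally have "(\<integral>\<^sup>+\<omega>. (\<Sum>N. ennreal ((Y N \<omega>)\<^sup>2)) \<partial>M) \<noteq> \<infinity>" by simp
    then have "AE \<omega> in M. (\<Sum>N. ennreal ((Y N \<omega>)\<^sup>2)) \<noteq> \<infinity>"
      using int by (intro nn_integral_PInf_AE) auto
    then show ?thesis
    proof eventually_elim
      case (elim \<omega>)
      then have "summable (\<lambda>N. (Y N \<omega>)\<^sup>2)"
        by (intro summable_suminf_not_top) auto
      then have "(\<lambda>N. sqrt ((Y N \<omega>)\<^sup>2)) \<longlonglongrightarrow> sqrt 0"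
        by (intro tendsto_real_sqrt summable_LIMSEQ_zero)
      then have "(\<lambda>N. Y N \<omega>) \<longlonglongrightarrow> 0"
        by (simp add: tendsto_rabs_zero_iff)
      moreover have "Y N \<omega> = (\<Sum>r<2 ^ N. (X (N + m) (j * 2 ^ N + r) \<omega>)\<^sup>2) - v / 2 ^ m" for N
        by (simp add: Y_def sum_subtractf power_add)
      ultimately show ?case
        by (simp add: LIM_zero_iff)
    qed
  qed
  then show ?thesis
    unfolding AE_all_countable by (auto simp: AE_impI intro!: AE_impI)
qed

end

section \<open>The Gaussian space of a Brownian sheet\<close>

context prob_space
begin

lemma integrable_gaussian_rv:
  assumes "gaussian_rv M X"
  shows "integrable M X"
proof -
  from assms obtain \<mu> where X [measurable]: "X \<in> borel_measurable M"
    and "(AE \<omega> in M. X \<omega> = \<mu>) \<or> (\<exists>\<sigma>>0. distributed M lborel X (\<lambda>x. ennreal (normal_density \<mu> \<sigma> x)))"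
    unfolding gaussian_rv_def by blast
  then consider "AE \<omega> in M. X \<omega> = \<mu>" | \<sigma> where "0 < \<sigma>" "distributed M lborel X (\<lambda>x. ennreal (normal_density \<mu> \<sigma> x))"
    by blast
  then show ?thesis
  proof cases
    case 1
    then have "integrable M X \<longleftrightarrow> integrable M (\<lambda>_. \<mu>)"
      by (intro integrable_cong_AE) auto
    then show ?thesis by simp
  next
    case 2
    have "integrable lborel (\<lambda>x. normal_density \<mu> \<sigma> x * x) \<longleftrightarrow> integrable M (\<lambda>\<omega>. X \<omega>)"
      by (rule distributed_integrable[OF 2(2)]) auto
    then show ?thesis using integrable_normal_moment_nz_1[OF 2(1)] by simp
  qed
qed

lemma char_centered_gaussian_rv:
  assumes "gaussian_rv M X" "expectation X = 0"
  obtains u where "0 \<le> u" "\<And>t. char (distr M borel X) t = complex_of_real (exp (- (t\<^sup>2 * u) / 2))"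
proof -
  from assms obtain \<mu> where X [measurable]: "X \<in> borel_measurable M"
    and "(AE \<omega> in M. X \<omega> = \<mu>) \<or> (\<exists>\<sigma>>0. distributed M lborel X (\<lambda>x. ennreal (normal_density \<mu> \<sigma> x)))"
    unfolding gaussian_rv_def by blast
  then consider "AE \<omega> in M. X \<omega> = \<mu>" | \<sigma> where "0 < \<sigma>" "distributed M lborel X (\<lambda>x. ennreal (normal_density \<mu> \<sigma> x))"
    by blast
  then show ?thesis
  proof cases
    case 1
    then have "expectation X = expectation (\<lambda>_. \<mu>)"
      by (intro integral_cong_AE) auto
    then have "\<mu> = 0" using assms(2) by (simp add: prob_space)
    have "char (distr M borel X) t = 1" for t
    proof -
      have "char (distr M borel X) t = (CLINT \<omega>|M. iexp (t * X \<omega>))"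
        unfolding char_def by (subst integral_distr) auto
      also have "\<dots> = (CLINT \<omega>|M. 1)"
        using 1 \<open>\<mu> = 0\<close> by (intro integral_cong_AE) auto
      finally show ?thesis by (simp add: prob_space)
    qed
    then show ?thesis by (intro that[of 0]) auto
  next
    case 2
    have "expectation X = \<mu>" by (rule normal_distributed_expectation[OF 2])
    then have "\<mu> = 0" using assms(2) by simp
    have "distributed M lborel (\<lambda>\<omega>. (X \<omega> - \<mu>) / \<sigma>) (\<lambda>x. ennreal (std_normal_density x))"
      using 2 normal_standard_normal_convert[OF 2(1), of X \<mu>] by simp
    then have std: "distr M lborel (\<lambda>\<omega>. X \<omega> / \<sigma>) = std_normal_distribution"
      by (simp add: distributed_distr_eq_density \<open>\<mu> = 0\<close>)
    have "char (distr M borel X) t = complex_of_real (exp (- (t\<^sup>2 * \<sigma>\<^sup>2) / 2))" for t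
    proof -
      have "char (distr M borel X) t = (CLINT \<omega>|M. iexp ((t * \<sigma>) * (X \<omega> / \<sigma>)))"
        unfolding char_def using 2(1) by (subst integral_distr) auto
      also have "\<dots> = char (distr M lborel (\<lambda>\<omega>. X \<omega> / \<sigma>)) (t * \<sigma>)"
        unfolding char_def by (subst integral_distr) auto
      also have "\<dots> = complex_of_real (exp (- (t\<^sup>2 * \<sigma>\<^sup>2) / 2))"
        unfolding std by (simp add: char_std_normal_distribution power_mult_distrib)
      finally show ?thesis .
    qed
    then show ?thesis by (intro that[of "\<sigma>\<^sup>2"]) auto
  qed
qed

lemma distr_eq_centered_normal:
  assumes [measurable]: "X \<in> borel_measurable M" and "0 \<le> u"
    and char: "\<And>t. char (distr M borel X) t = complex_of_real (exp (- (t\<^sup>2 * u) / 2))"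
  shows "distr M borel X = centered_normal (expectation (\<lambda>\<omega>. (X \<omega>)\<^sup>2))"
proof -
  have eq: "distr M borel X = centered_normal u"
  proof (rule Levy_uniqueness)
    show "real_distribution (distr M borel X)" by (rule real_distribution_distr) simp
    show "char (distr M borel X) = char (centered_normal u)"
      using char char_centered_normal[OF \<open>0 \<le> u\<close>] by auto
  qed (rule real_distribution_centered_normal)
  have "expectation (\<lambda>\<omega>. (X \<omega>)\<^sup>2) = (\<integral>x. x\<^sup>2 \<partial>distr M borel X)"
    by (subst integral_distr) auto
  also have "\<dots> = (\<integral>x. u * x ^ (2 * 1) \<partial>std_normal_distribution)"
    unfolding eq using \<open>0 \<le> u\<close> by (subst integral_distr) (auto simp: power_mult_distrib)
  also have "\<dots> = u"
    by (subst integral_mult_right_zero) (subst std_normal_distribution_even_moments(1), simp)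
  finally show ?thesis using eq by simp
qed

end

text \<open>The linear span of the values of all components of a sheet.\<close>

definition sheet_space :: "(real \<times> real \<Rightarrow> 'w \<Rightarrow> real ^ 'd) \<Rightarrow> ('w \<Rightarrow> real) set" where
  "sheet_space W = {X. \<exists>F c. finite F \<and> F \<subseteq> unit_square \<and> X = (\<lambda>\<omega>. \<Sum>j\<in>UNIV. \<Sum>p\<in>F. c j p * W p \<omega> $ j)}"

lemma sheet_space_add:
  fixes W :: "real \<times> real \<Rightarrow> 'w \<Rightarrow> real ^ 'd::finite"
  assumes "X \<in> sheet_space W" "Y \<in> sheet_space W"
  shows "(\<lambda>\<omega>. X \<omega> + Y \<omega>) \<in> sheet_space W"
proof -
  from assms obtain F c F' c' where *: "finite F" "F \<subseteq> unit_square" "finite F'" "F' \<subseteq> unit_square"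
    and X: "X = (\<lambda>\<omega>. \<Sum>j\<in>UNIV. \<Sum>p\<in>F. c j p * W p \<omega> $ j)"
    and Y: "Y = (\<lambda>\<omega>. \<Sum>j\<in>UNIV. \<Sum>p\<in>F'. c' j p * W p \<omega> $ j)"
    unfolding sheet_space_def by blast
  define b where "b j p = (if p \<in> F then c j p else 0) + (if p \<in> F' then c' j p else 0)" for j p
  have "(\<Sum>p\<in>F \<union> F'. b j p * W p \<omega> $ j) = (\<Sum>p\<in>F. c j p * W p \<omega> $ j) + (\<Sum>p\<in>F'. c' j p * W p \<omega> $ j)" for j \<omega>
  proof -
    have "(\<Sum>p\<in>F \<union> F'. b j p * W p \<omega> $ j) = (\<Sum>p\<in>F \<union> F'. (if p \<in> F then c j p else 0) * W p \<omega> $ j)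
        + (\<Sum>p\<in>F \<union> F'. (if p \<in> F' then c' j p else 0) * W p \<omega> $ j)"
      by (simp add: b_def distrib_right sum.distrib)
    also have "(\<Sum>p\<in>F \<union> F'. (if p \<in> F then c j p else 0) * W p \<omega> $ j) = (\<Sum>p\<in>F. c j p * W p \<omega> $ j)"
      using * by (intro sum.mono_neutral_cong_right) auto
    also have "(\<Sum>p\<in>F \<union> F'. (if p \<in> F' then c' j p else 0) * W p \<omega> $ j) = (\<Sum>p\<in>F'. c' j p * W p \<omega> $ j)"
      using * by (intro sum.mono_neutral_cong_right) auto
    finally show ?thesis .
  qed
  then have "(\<lambda>\<omega>. X \<omega> + Y \<omega>) = (\<lambda>\<omega>. \<Sum>j\<in>UNIV. \<Sum>p\<in>F \<union> F'. b j p * W p \<omega> $ j)"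
    by (simp add: X Y sum.distrib)
  then show ?thesis
    unfolding sheet_space_def using * by (intro CollectI exI[of _ "F \<union> F'"] exI[of _ b]) simp
qed

lemma sheet_space_scale:
  assumes "X \<in> sheet_space W"
  shows "(\<lambda>\<omega>. a * X \<omega>) \<in> sheet_space W"
proof -
  from assms obtain F c where *: "finite F" "F \<subseteq> unit_square"
    and X: "X = (\<lambda>\<omega>. \<Sum>j\<in>UNIV. \<Sum>p\<in>F. c j p * W p \<omega> $ j)"
    unfolding sheet_space_def by blast
  have "(\<lambda>\<omega>. a * X \<omega>) = (\<lambda>\<omega>. \<Sum>j\<in>UNIV. \<Sum>p\<in>F. (a * c j p) * W p \<omega> $ j)"
    by (simp add: X sum_distrib_left mult.assoc)
  then show ?thesis
    unfolding sheet_space_def using * by (intro CollectI exI[of _ F] exI[of _ "\<lambda>j p. a * c j p"]) simp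
qed

lemma sheet_space_component:
  fixes W :: "real \<times> real \<Rightarrow> 'w \<Rightarrow> real ^ 'd::finite"
  assumes "p \<in> unit_square"
  shows "(\<lambda>\<omega>. W p \<omega> $ j) \<in> sheet_space W"
proof -
  have "(\<lambda>\<omega>. W p \<omega> $ j) = (\<lambda>\<omega>. \<Sum>l\<in>UNIV. \<Sum>q\<in>{p}. (if l = j then 1 else 0) * W q \<omega> $ l)"
    by (auto simp: if_distrib[of "\<lambda>x. x * _"] sum.delta cong: if_cong)
  then show ?thesis
    unfolding sheet_space_def using assms
    by (intro CollectI exI[of _ "{p}"] exI[of _ "\<lambda>l q. if l = j then 1 else 0"]) simp
qed

lemma indep_vars_sheet:
  fixes W :: "real \<times> real \<Rightarrow> 'w \<Rightarrow> real ^ 'd::finite"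
  assumes "prob_space M" and W: "brownian_sheet M W"
    and f: "\<And>j. f j \<in> borel_measurable (\<Pi>\<^sub>M p\<in>unit_square. (borel :: real measure))"
  shows "prob_space.indep_vars M (\<lambda>_. borel) (\<lambda>j \<omega>. f j (\<lambda>p\<in>unit_square. W p \<omega> $ j)) UNIV"
proof -
  interpret prob_space M by fact
  have "indep_vars (\<lambda>_. \<Pi>\<^sub>M p\<in>unit_square. (borel :: real measure)) (\<lambda>j \<omega>. \<lambda>p\<in>unit_square. W p \<omega> $ j) UNIV"
    using W unfolding brownian_sheet_def by blast
  from indep_vars_compose2[OF this, of f "\<lambda>_. borel"] f show ?thesis by simp
qed

lemma gaussian_space_sheet:
  fixes W :: "real \<times> real \<Rightarrow> 'w \<Rightarrow> real ^ 'd::finite"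
  assumes "prob_space M" and W: "brownian_sheet M W"
  shows "gaussian_space M (sheet_space W)"
proof -
  interpret prob_space M by fact
  have sheet: "brownian_sheet_real M (\<lambda>p \<omega>. W p \<omega> $ j)" for j
    using W unfolding brownian_sheet_def by blast
  have gauss: "gaussian_rv M (\<lambda>\<omega>. \<Sum>p\<in>F. c p * W p \<omega> $ j)" if "finite F" "F \<subseteq> unit_square" for F c j
    using sheet[of j] that unfolding brownian_sheet_real_def gaussian_process_def by blast
  have int: "integrable M (\<lambda>\<omega>. W p \<omega> $ j)" if "p \<in> unit_square" for p j
    using integrable_gaussian_rv[OF gauss[of "{p}" "\<lambda>_. 1" j]] that by simp
  have mean: "expectation (\<lambda>\<omega>. W p \<omega> $ j) = 0" if "p \<in> unit_square" for p j
    using sheet[of j] that unfolding brownian_sheet_real_def by blast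
  have main: "X \<in> borel_measurable M \<and> distr M borel X = centered_normal (expectation (\<lambda>\<omega>. (X \<omega>)\<^sup>2))"
    if "X \<in> sheet_space W" for X
  proof -
    from that obtain F c where F: "finite F" "F \<subseteq> unit_square"
      and X: "X = (\<lambda>\<omega>. \<Sum>j\<in>UNIV. \<Sum>p\<in>F. c j p * W p \<omega> $ j)"
      unfolding sheet_space_def by blast
    define Y where "Y j \<omega> = (\<Sum>p\<in>F. c j p * W p \<omega> $ j)" for j \<omega>
    have Y: "gaussian_rv M (Y j)" for j unfolding Y_def by (rule gauss[OF F])
    have Y_meas [measurable]: "Y j \<in> borel_measurable M" for j
      using Y[of j] by (simp add: gaussian_rv_def)
    have mem_F: "p \<in> unit_square" if "p \<in> F" for p using F that by blast
    have "expectation (Y j) = 0" for j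
      unfolding Y_def using int mean mem_F by (simp add: Bochner_Integration.integral_sum)
    then have "\<exists>u\<ge>0. \<forall>t. char (distr M borel (Y j)) t = complex_of_real (exp (- (t\<^sup>2 * u) / 2))" for j
      using char_centered_gaussian_rv[OF Y[of j]] by metis
    then obtain u where u: "\<And>j. 0 \<le> u j"
        "\<And>j t. char (distr M borel (Y j)) t = complex_of_real (exp (- (t\<^sup>2 * u j) / 2))"
      by metis
    have "indep_vars (\<lambda>_. borel) (\<lambda>j \<omega>. (\<lambda>f. \<Sum>p\<in>F. c j p * f p) (\<lambda>p\<in>unit_square. W p \<omega> $ j)) UNIV"
      using mem_F
      by (intro indep_vars_sheet[OF assms] borel_measurable_sum borel_measurable_times
            measurable_component_singleton) auto
    moreover have "(\<lambda>f. \<Sum>p\<in>F. c j p * f p) (\<lambda>p\<in>unit_square. W p \<omega> $ j) = Y j \<omega>" for j \<omega>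
      unfolding Y_def using mem_F by (auto intro!: sum.cong)
    ultimately have indep: "indep_vars (\<lambda>_. borel) Y UNIV" by simp
    have XY: "X = (\<lambda>\<omega>. \<Sum>j\<in>UNIV. Y j \<omega>)" unfolding X Y_def ..
    have meas [measurable]: "X \<in> borel_measurable M" unfolding XY by measurable
    have "char (distr M borel X) t = complex_of_real (exp (- (t\<^sup>2 * (\<Sum>j\<in>UNIV. u j)) / 2))" for t
    proof -
      have "char (distr M borel X) t = (\<Prod>j\<in>UNIV. char (distr M borel (Y j)) t)"
        unfolding XY by (rule char_distr_sum[OF indep])
      also have "\<dots> = complex_of_real (\<Prod>j\<in>UNIV. exp (- (t\<^sup>2 * u j) / 2))"
        unfolding u(2) by simp
      also have "(\<Prod>j\<in>UNIV. exp (- (t\<^sup>2 * u j) / 2)) = exp (\<Sum>j\<in>UNIV. - (t\<^sup>2 * u j) / 2)"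
        by (simp add: exp_sum)
      also have "(\<Sum>j\<in>UNIV. - (t\<^sup>2 * u j) / 2) = - (t\<^sup>2 * (\<Sum>j\<in>UNIV. u j)) / 2"
        by (simp add: sum_distrib_left sum_divide_distrib sum_negf)
      finally show ?thesis .
    qed
    from distr_eq_centered_normal[OF meas _ this] meas u(1) show ?thesis
      by (simp only: sum_nonneg)
  qed
  show ?thesis
  proof
    show "(\<lambda>\<omega>. 0) \<in> sheet_space W"
      unfolding sheet_space_def by (intro CollectI exI[of _ "{}"]) simp
  qed (use main sheet_space_add sheet_space_scale in blast)+
qed

text \<open>The covariance function of a one-dimensional Brownian sheet.\<close>

definition sheet_cov :: "real \<times> real \<Rightarrow> real \<times> real \<Rightarrow> real" where
  "sheet_cov p q = min (fst p) (fst q) * min (snd p) (snd q)"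

lemma cov_sheet:
  fixes W :: "real \<times> real \<Rightarrow> 'w \<Rightarrow> real ^ 'd::finite"
  assumes "prob_space M" and W: "brownian_sheet M W" and p: "p \<in> unit_square" and q: "q \<in> unit_square"
  shows "gaussian_space.cov M (\<lambda>\<omega>. W p \<omega> $ j) (\<lambda>\<omega>. W q \<omega> $ l) = (if j = l then sheet_cov p q else 0)"
proof -
  interpret gaussian_space M "sheet_space W" by (rule gaussian_space_sheet[OF assms(1,2)])
  have sheet: "brownian_sheet_real M (\<lambda>p \<omega>. W p \<omega> $ j)" for j
    using W unfolding brownian_sheet_def by blast
  show ?thesis
  proof (cases "j = l")
    case True
    then show ?thesis
      using sheet[of j] p q unfolding brownian_sheet_real_def cov_def sheet_cov_def
      by (cases p; cases q) auto
  next
    case False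
    have meas: "(\<lambda>f. f r) \<in> borel_measurable (\<Pi>\<^sub>M p\<in>unit_square. borel)" if "r \<in> unit_square" for r :: "real \<times> real"
      by (rule measurable_component_singleton[OF that])
    have *: "indep_vars (\<lambda>_. borel) (\<lambda>k \<omega>. (\<lambda>f. f (if k = j then p else q)) (\<lambda>p\<in>unit_square. W p \<omega> $ k)) UNIV"
      using p q by (intro indep_vars_sheet[OF assms(1,2)] meas) auto
    have "indep_vars (\<lambda>_. borel) (\<lambda>k \<omega>. W (if k = j then p else q) \<omega> $ k) UNIV"
    proof -
      have "(if k = j then p else q) \<in> unit_square" for k using p q by simp
      then show ?thesis using * by (simp only: restrict_apply if_True)
    qed
    then have "indep_vars (\<lambda>_. borel) (\<lambda>k \<omega>. W (if k = j then p else q) \<omega> $ k) (insert j {l})"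
      by (rule indep_vars_subset) simp
    from indep_vars_sum[OF _ _ this]
    have indep: "indep_var borel (\<lambda>\<omega>. W p \<omega> $ j) borel (\<lambda>\<omega>. W q \<omega> $ l)"
      using False by auto
    have int: "integrable M (\<lambda>\<omega>. W r \<omega> $ k)" if "r \<in> unit_square" for r k
      using integrable_power[OF sheet_space_component[OF that], where n=1] by simp
    have "expectation (\<lambda>\<omega>. W p \<omega> $ j) = 0"
      using sheet[of j] p unfolding brownian_sheet_real_def by blast
    then show ?thesis
      unfolding cov_def using indep_var_lebesgue_integral[OF indep int[OF p] int[OF q]] False by simp
  qed
qed

lemma cov_sheet_increments:
  fixes W :: "real \<times> real \<Rightarrow> 'w \<Rightarrow> real ^ 'd::finite"
  assumes "prob_space M" and W: "brownian_sheet M W"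
    and p: "p \<in> unit_square" "p' \<in> unit_square" and q: "q \<in> unit_square" "q' \<in> unit_square"
  shows "gaussian_space.cov M (\<lambda>\<omega>. W p \<omega> $ j - W p' \<omega> $ j) (\<lambda>\<omega>. W q \<omega> $ l - W q' \<omega> $ l)
    = (if j = l then sheet_cov p q - sheet_cov p q' - sheet_cov p' q + sheet_cov p' q' else 0)"
proof -
  interpret gaussian_space M "sheet_space W" by (rule gaussian_space_sheet[OF assms(1,2)])
  note mem = sheet_space_component[of _ W]
  show ?thesis
    unfolding cov_diff_left[OF mem[OF p(1)] mem[OF p(2)] diff_mem[OF mem[OF q(1)] mem[OF q(2)]]]
      cov_diff_right[OF mem[OF q(1)] mem[OF q(2)] mem[OF p(1)]]
      cov_diff_right[OF mem[OF q(1)] mem[OF q(2)] mem[OF p(2)]]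
    by (simp add: cov_sheet[OF assms(1,2)] p q)
qed

section \<open>Quadratic covariation along a path\<close>

lemma uniformly_continuous_on_obtains:
  assumes "uniformly_continuous_on S f" "0 < e"
  obtains d where "0 < d" "\<And>p p'. p \<in> S \<Longrightarrow> p' \<in> S \<Longrightarrow> dist p' p < d \<Longrightarrow> dist (f p') (f p) < e"
  using assms unfolding uniformly_continuous_on_def by blast

text \<open>The partial derivative in direction \<^term>\<open>i\<close> of the first vector variable, read off the total
  derivative.\<close>

definition grad_x :: "'d \<Rightarrow> (((real ^ 'd) \<times> (real ^ 'd)) \<Rightarrow>\<^sub>L real) \<Rightarrow> real" where
  "grad_x i A = blinfun_apply A (axis i 1, 0)"

text \<open>Locally uniform continuity in the parameter makes the derivative jointly continuous.\<close>

lemma continuous_into_C1_derivative: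
  fixes g :: "real \<times> real \<Rightarrow> (real ^ 'd) \<times> (real ^ 'd) \<Rightarrow> real"
  assumes "continuous_into_C1 T g"
  obtains Dg where
    "\<And>p z. p \<in> T \<Longrightarrow> (g p has_derivative blinfun_apply (Dg p z)) (at z)"
    "continuous_on (T \<times> UNIV) (\<lambda>(p, z). Dg p z)"
proof -
  from assms obtain Dg where D: "\<And>p z. p \<in> T \<Longrightarrow> (g p has_derivative blinfun_apply (Dg p z)) (at z)"
    and cont: "\<And>p. p \<in> T \<Longrightarrow> continuous_on UNIV (Dg p)"
    and unif: "\<And>p K. p \<in> T \<Longrightarrow> compact K \<Longrightarrow> uniform_limit K Dg (Dg p) (at p within T)"
    unfolding continuous_into_C1_def by metis
  have "continuous_on (T \<times> UNIV) (\<lambda>(p, z). Dg p z)"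
    unfolding continuous_on_iff
  proof (intro ballI allI impI)
    fix x :: "(real \<times> real) \<times> (real ^ 'd) \<times> (real ^ 'd)" and e :: real
    assume x: "x \<in> T \<times> UNIV" and e: "0 < e"
    obtain p z where xpz: "x = (p, z)" by (cases x)
    have p: "p \<in> T" using x xpz by simp
    have "\<exists>d>0. \<forall>z'. dist z' z < d \<longrightarrow> dist (Dg p z') (Dg p z) < e / 2"
      using cont[OF p] e unfolding continuous_on_iff by (meson UNIV_I half_gt_zero)
    then obtain d1 where d1: "0 < d1" "\<And>z'. dist z' z < d1 \<Longrightarrow> dist (Dg p z') (Dg p z) < e / 2" by blast
    have "\<forall>\<^sub>F q in at p within T. \<forall>z'\<in>cball z 1. dist (Dg q z') (Dg p z') < e / 2"
      using unif[OF p compact_cball] e unfolding uniform_limit_iff by (meson half_gt_zero)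
    then obtain d2 where d2: "0 < d2" "\<And>q z'. q \<in> T \<Longrightarrow> q \<noteq> p \<Longrightarrow> dist q p < d2 \<Longrightarrow> z' \<in> cball z 1 \<Longrightarrow>
        dist (Dg q z') (Dg p z') < e / 2"
      unfolding eventually_at by blast
    show "\<exists>d>0. \<forall>x'\<in>T \<times> UNIV. dist x' x < d \<longrightarrow>
        dist (case x' of (p, z) \<Rightarrow> Dg p z) (case x of (p, z) \<Rightarrow> Dg p z) < e"
    proof (intro exI[of _ "min 1 (min d1 d2)"] conjI ballI impI)
      fix x' :: "(real \<times> real) \<times> (real ^ 'd) \<times> (real ^ 'd)"
      assume x': "x' \<in> T \<times> UNIV" and dist: "dist x' x < min 1 (min d1 d2)"
      obtain q z' where x'qz: "x' = (q, z')" by (cases x')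
      have q: "q \<in> T" using x' x'qz by simp
      have dq: "dist q p < d2" using dist dist_fst_le[of x' x] xpz x'qz by simp
      have dz: "dist z' z < d1" "dist z' z < 1" using dist dist_snd_le[of x' x] xpz x'qz by simp_all
      have "dist (Dg q z') (Dg p z') < e / 2"
        using d2(2)[OF q _ dq, of z'] dz(2) e by (cases "q = p") (auto simp: dist_commute)
      then have "dist (Dg q z') (Dg p z) < e"
        using d1(2)[OF dz(1)] dist_triangle[of "Dg q z'" "Dg p z" "Dg p z'"] by linarith
      then show "dist (case x' of (p, z) \<Rightarrow> Dg p z) (case x of (p, z) \<Rightarrow> Dg p z) < e"
        by (simp add: xpz x'qz)
    qed (use d1(1) d2(1) in auto)
  qed
  with D show ?thesis by (rule that)
qed

lemma has_derivative_along_axis: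
  fixes G :: "(real ^ 'd) \<times> (real ^ 'd) \<Rightarrow> real"
  assumes "\<And>p. (G has_derivative blinfun_apply (A p)) (at p)"
  shows "((\<lambda>u. G (x + u *\<^sub>R axis i 1, z)) has_real_derivative grad_x i (A (x + u *\<^sub>R axis i 1, z))) (at u)"
proof -
  have "((\<lambda>u. (x + u *\<^sub>R axis i 1, z)) has_derivative (\<lambda>h. (h *\<^sub>R axis i 1, 0))) (at u)"
    by (auto intro!: derivative_eq_intros)
  from has_derivative_compose[OF this assms]
  have "((\<lambda>u. G (x + u *\<^sub>R axis i 1, z)) has_derivative
      (\<lambda>h. blinfun_apply (A (x + u *\<^sub>R axis i 1, z)) (h *\<^sub>R axis i 1, 0))) (at u)" .
  moreover have "blinfun_apply B (h *\<^sub>R axis i 1, 0) = grad_x i B * h" for B :: "((real ^ 'd) \<times> (real ^ 'd)) \<Rightarrow>\<^sub>L real" and h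
  proof -
    have "(h *\<^sub>R axis i 1, 0) = h *\<^sub>R (axis i (1 :: real) :: real ^ 'd, 0 :: real ^ 'd)" by simp
    then show ?thesis unfolding grad_x_def by (simp only: blinfun.scaleR_right real_scaleR_def mult.commute)
  qed
  ultimately show ?thesis unfolding has_field_derivative_def by simp
qed

lemma partial_x_eq_grad_x:
  assumes "\<And>z. (g p has_derivative blinfun_apply (A z)) (at z)"
  shows "partial_x i g p z = grad_x i (A z)"
  using DERIV_imp_deriv[OF has_derivative_along_axis[OF assms, of "fst z" i "snd z" 0]]
  by (simp add: partial_x_def)

text \<open>The discrete quadratic covariation of \<^term>\<open>G\<close> along a path with the \<^term>\<open>i\<close>-th coordinate of the path
  converges, whenever that coordinate has quadratic variation \<^term>\<open>v\<close> times time. The statement concerns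
  a single path. Only one coordinate moves in each difference, so the mean value theorem produces the
  square of its increment and no mixed terms.\<close>

lemma path_covariation_tendsto:
  fixes G :: "real \<Rightarrow> (real ^ 'd) \<times> (real ^ 'd) \<Rightarrow> real"
    and A :: "real \<Rightarrow> (real ^ 'd) \<times> (real ^ 'd) \<Rightarrow> ((real ^ 'd) \<times> (real ^ 'd)) \<Rightarrow>\<^sub>L real"
    and x z :: "real \<Rightarrow> real ^ 'd" and i :: 'd and v :: real
  defines "\<tau> \<equiv> \<lambda>N k. real k / 2 ^ N"
  defines "\<delta> \<equiv> \<lambda>N k. x (\<tau> N (Suc k)) $ i - x (\<tau> N k) $ i"
  assumes G: "\<And>t p. t \<in> {0..1} \<Longrightarrow> (G t has_derivative blinfun_apply (A t p)) (at p)"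
    and A: "continuous_on ({0..1} \<times> UNIV) (\<lambda>(t, p). A t p)"
    and x: "continuous_on {0..1} x" and z: "continuous_on {0..1} z"
    and qv: "\<And>m j. j < 2 ^ m \<Longrightarrow> (\<lambda>N. \<Sum>r<2 ^ N. (\<delta> (N + m) (j * 2 ^ N + r))\<^sup>2) \<longlonglongrightarrow> v / 2 ^ m"
  shows "(\<lambda>N. \<Sum>k<2 ^ N. (G (\<tau> N (Suc k)) (x (\<tau> N (Suc k)), z (\<tau> N (Suc k)))
        - G (\<tau> N (Suc k)) (x (\<tau> N (Suc k)) - \<delta> N k *\<^sub>R axis i 1, z (\<tau> N (Suc k)))) * \<delta> N k)
      \<longlonglongrightarrow> v * integral {0..1} (\<lambda>t. grad_x i (A t (x t, z t)))"
proof -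
  define P where "P = (\<lambda>(t, p). grad_x i (A t p))"
  have P: "continuous_on ({0..1} \<times> UNIV) P"
    unfolding P_def grad_x_def case_prod_beta
    using A by (intro continuous_intros) (simp add: case_prod_beta)
  have f: "continuous_on {0..1} (\<lambda>t. P (t, x t, z t))"
    by (rule continuous_on_compose2[OF P]) (auto intro!: continuous_intros x z)
  have \<tau>: "\<tau> N k \<in> {0..1}" if "k \<le> 2 ^ N" for N k
  proof -
    have "real k \<le> real (2 ^ N)" using that by (rule of_nat_mono)
    then show ?thesis by (simp add: \<tau>_def field_simps)
  qed
  have \<tau>_diff: "\<tau> N (Suc k) - \<tau> N k = 1 / 2 ^ N" for N k
    by (simp add: \<tau>_def field_simps)
  define U where "U N k u \<longleftrightarrow> 0 < u \<and> u < 1 \<and>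
      G (\<tau> N (Suc k)) (x (\<tau> N (Suc k)), z (\<tau> N (Suc k)))
        - G (\<tau> N (Suc k)) (x (\<tau> N (Suc k)) - \<delta> N k *\<^sub>R axis i 1, z (\<tau> N (Suc k)))
      = P (\<tau> N (Suc k), x (\<tau> N (Suc k)) - (u * \<delta> N k) *\<^sub>R axis i 1, z (\<tau> N (Suc k))) * \<delta> N k" for N k u
  have ex: "\<exists>u. U N k u"
    if k: "k < 2 ^ N" for N k
  proof -
    let ?t = "\<tau> N (Suc k)" and ?d = "\<delta> N k"
    have t: "?t \<in> {0..1}" using k by (intro \<tau>) simp
    let ?q = "\<lambda>u. G ?t (x ?t - (u * ?d) *\<^sub>R axis i 1, z ?t)"
    let ?p = "\<lambda>u. P (?t, x ?t - (u * ?d) *\<^sub>R axis i 1, z ?t) * (- ?d)"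
    have der: "(?q has_real_derivative ?p u) (at u)" for u
    proof -
      have "((\<lambda>w. G ?t (x ?t + w *\<^sub>R axis i 1, z ?t)) has_real_derivative
          P (?t, x ?t + w *\<^sub>R axis i 1, z ?t)) (at w)" for w
        unfolding P_def prod.case by (rule has_derivative_along_axis[OF G[OF t]])
      moreover have "((\<lambda>u. - (u * ?d)) has_real_derivative - ?d) (at u)"
        by (auto intro!: derivative_eq_intros)
      ultimately have "((\<lambda>u. G ?t (x ?t + (- (u * ?d)) *\<^sub>R axis i 1, z ?t)) has_real_derivative
          P (?t, x ?t + (- (u * ?d)) *\<^sub>R axis i 1, z ?t) * (- ?d)) (at u)"
        by (rule DERIV_chain2[where f="\<lambda>w. G ?t (x ?t + w *\<^sub>R axis i 1, z ?t)" and g="\<lambda>u. - (u * ?d)"])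
      then show ?thesis by (simp only: scaleR_minus_left add_uminus_conv_diff)
    qed
    have "\<exists>u>0. u < 1 \<and> ?q 1 - ?q 0 = (1 - 0) * ?p u"
      by (rule MVT2[where f="?q" and f'="?p"]) (simp, rule der)
    then obtain u where u: "0 < u" "u < 1" "?q 1 - ?q 0 = (1 - 0) * ?p u"
      by blast
    then show ?thesis
      unfolding U_def by (intro exI[of _ u]) auto
  qed
  define u where "u N k = (SOME u. U N k u)" for N k
  have u: "U N k (u N k)" if "k < 2 ^ N" for N k
    unfolding u_def by (rule someI_ex[OF ex[OF that]])
  define \<phi> where "\<phi> N k = P (\<tau> N (Suc k), x (\<tau> N (Suc k)) - (u N k * \<delta> N k) *\<^sub>R axis i 1, z (\<tau> N (Suc k)))" for N k
  have "(\<lambda>N. \<Sum>k<2 ^ N. (\<delta> N k)\<^sup>2 * \<phi> N k) \<longlonglongrightarrow> v * integral {0..1} (\<lambda>t. P (t, x t, z t))"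
  proof (rule dyadic_weighted_sums_tendsto[OF f])
    show "(\<lambda>N. \<Sum>r<2 ^ N. (\<delta> (N + m) (j * 2 ^ N + r))\<^sup>2) \<longlonglongrightarrow> v / 2 ^ m" if "j < 2 ^ m" for m j
      by (rule qv[OF that])
    fix e :: real assume e: "0 < e"
    have "bounded (x ` {0..1})"
      by (intro compact_imp_bounded compact_continuous_image x) simp
    then obtain R where R: "\<And>t. t \<in> {0..1} \<Longrightarrow> norm (x t) \<le> R"
      unfolding bounded_iff by (meson imageI)
    define K :: "(real \<times> (real ^ 'd) \<times> (real ^ 'd)) set"
      where "K = {0..1} \<times> cball 0 (R + 1) \<times> z ` {0..1}"
    have "compact K"
      unfolding K_def by (intro compact_Times compact_continuous_image z) auto
    moreover have "continuous_on K P" unfolding K_def by (rule continuous_on_subset[OF P]) auto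
    ultimately have unif_P: "uniformly_continuous_on K P" by (intro compact_uniformly_continuous)
    obtain d where d: "0 < d" "\<And>p p'. p \<in> K \<Longrightarrow> p' \<in> K \<Longrightarrow> dist p' p < d \<Longrightarrow> dist (P p') (P p) < e"
      using uniformly_continuous_on_obtains[OF unif_P e] by blast
    define d' where "d' = min 1 d"
    have d': "0 < d'" using d(1) by (simp add: d'_def)
    have unif_x: "uniformly_continuous_on {0..1} x"
      by (intro compact_uniformly_continuous x) simp
    obtain h where h: "0 < h" "\<And>t t'. t \<in> {0..1} \<Longrightarrow> t' \<in> {0..1} \<Longrightarrow> dist t' t < h \<Longrightarrow> dist (x t') (x t) < d'"
      using uniformly_continuous_on_obtains[OF unif_x d'] by blast
    obtain N0 :: nat where N0: "(1 / 2) ^ N0 < h"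
      using real_arch_pow_inv[OF h(1), of "1/2"] by auto
    have "\<bar>\<phi> N k - P (\<tau> N (Suc k), x (\<tau> N (Suc k)), z (\<tau> N (Suc k)))\<bar> \<le> e"
      if N: "N0 \<le> N" and k: "k < 2 ^ N" for N k
    proof -
      let ?t = "\<tau> N (Suc k)" and ?d = "\<delta> N k"
      have t: "?t \<in> {0..1}" "\<tau> N k \<in> {0..1}" using k by (auto intro!: \<tau> simp del: atLeastAtMost_iff)
      have "(1 / 2 :: real) ^ N \<le> (1 / 2) ^ N0" using N by (intro power_decreasing) auto
      then have "dist ?t (\<tau> N k) < h"
        using N0 by (simp add: dist_real_def \<tau>_diff power_one_over)
      then have "dist (x ?t) (x (\<tau> N k)) < d'" by (intro h(2) t)
      then have "\<bar>?d\<bar> < d'"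
        using component_le_norm_cart[of "x ?t - x (\<tau> N k)" i] by (simp add: \<delta>_def dist_norm)
      moreover have "\<bar>u N k * ?d\<bar> \<le> 1 * \<bar>?d\<bar>"
        unfolding abs_mult using u[OF k] by (intro mult_right_mono) (auto simp: U_def)
      ultimately have small: "\<bar>u N k * ?d\<bar> < d'" by simp
      let ?y = "x ?t - (u N k * ?d) *\<^sub>R axis i 1"
      have dist_y: "dist ?y (x ?t) < d'" using small by (simp add: dist_norm)
      have "norm ?y \<le> norm (x ?t) + norm ((u N k * ?d) *\<^sub>R (axis i 1 :: real ^ 'd))"
        by (rule norm_triangle_ineq4)
      also have "\<dots> \<le> R + 1" using R[OF t(1)] small by (simp add: d'_def)
      finally have y: "?y \<in> cball 0 (R + 1)" by simp
      have "dist (P (?t, ?y, z ?t)) (P (?t, x ?t, z ?t)) < e"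
      proof (rule d(2))
        show "(?t, x ?t, z ?t) \<in> K" unfolding K_def using t(1) R[OF t(1)] by auto
        show "(?t, ?y, z ?t) \<in> K" unfolding K_def using t(1) y by auto
        show "dist (?t, ?y, z ?t) (?t, x ?t, z ?t) < d"
          using dist_y by (simp add: dist_Pair_Pair d'_def)
      qed
      then show ?thesis by (simp add: \<phi>_def dist_real_def)
    qed
    then show "\<forall>\<^sub>F N in sequentially. \<forall>k<2 ^ N. \<bar>\<phi> N k - P (real (Suc k) / 2 ^ N, x (real (Suc k) / 2 ^ N), z (real (Suc k) / 2 ^ N))\<bar> \<le> e"
      unfolding eventually_sequentially \<tau>_def by blast
  qed simp
  moreover have "(\<Sum>k<2 ^ N. (G (\<tau> N (Suc k)) (x (\<tau> N (Suc k)), z (\<tau> N (Suc k)))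
        - G (\<tau> N (Suc k)) (x (\<tau> N (Suc k)) - \<delta> N k *\<^sub>R axis i 1, z (\<tau> N (Suc k)))) * \<delta> N k)
      = (\<Sum>k<2 ^ N. (\<delta> N k)\<^sup>2 * \<phi> N k)" for N
    using u by (intro sum.cong refl) (simp add: U_def \<phi>_def power2_eq_square)
  ultimately show ?thesis by (simp add: P_def)
qed

section \<open>The exponential moment bound\<close>

lemma borel_measurable_sheet:
  fixes W :: "real \<times> real \<Rightarrow> 'w \<Rightarrow> real ^ 'd"
  assumes "prob_space M" "brownian_sheet M W" "p \<in> unit_square"
  shows "W p \<in> borel_measurable M"
proof -
  interpret gaussian_space M "sheet_space W" by (rule gaussian_space_sheet[OF assms(1,2)])
  show ?thesis
    unfolding borel_measurable_euclidean_space[where f="W p"]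
    using measurable_mem[OF sheet_space_component[OF assms(3)]]
    by (auto simp: Basis_vec_def inner_axis)
qed

lemma sheet_path_continuous:
  fixes W :: "real \<times> real \<Rightarrow> 'w \<Rightarrow> real ^ 'd"
  assumes "brownian_sheet M W" "\<omega> \<in> space M"
  shows "continuous_on unit_square (\<lambda>p. W p \<omega>)"
proof -
  have "continuous_on unit_square (\<lambda>p. W p \<omega> $ j)" for j
    using assms unfolding brownian_sheet_def brownian_sheet_real_def by blast
  then have "continuous_on unit_square (\<lambda>p. \<chi> j. W p \<omega> $ j)"
    by (rule continuous_on_vec_lambda)
  then show ?thesis by simp
qed

text \<open>The estimate with its explicit constants. The discrete covariations \<open>S N\<close> tend almost surely to \<open>\<epsilon> * s\<close>
  times the integral, and their exponential moments are bounded uniformly in \<open>N\<close>; Fatou's lemma passes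
  the bound to the limit.\<close>

lemma sheet_nn_integral_exp_le:
  fixes M :: "'w measure"
    and W :: "real \<times> real \<Rightarrow> 'w \<Rightarrow> real ^ 'd"
    and g :: "real \<times> real \<Rightarrow> (real ^ 'd) \<times> (real ^ 'd) \<Rightarrow> real"
    and a \<epsilon> s s' \<kappa> \<alpha> :: real and y :: "real ^ 'd" and i :: 'd
  assumes M: "prob_space M" and W: "brownian_sheet M W" and g: "continuous_into_C1 unit_square g"
    and \<kappa>: "0 < \<kappa>" "\<And>s t x y. s \<in> {0..1} \<Longrightarrow> t \<in> {0..1} \<Longrightarrow> \<bar>g (s, t) (x, y)\<bar> \<le> \<kappa> * infnorm y"
    and a\<epsilon>: "0 \<le> a" "0 < \<epsilon>" "a + \<epsilon> \<le> 1"
    and s: "s \<in> {0<..1}" "s' \<in> {0<..1}" "s \<le> s'"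
    and D_pos: "0 < infnorm y + sqrt (s' - s)"
    and \<alpha>: "0 < \<alpha>" "48 * real CARD('d) * (\<alpha> * \<kappa>) \<le> 1"
  defines "F \<equiv> (\<lambda>\<omega>. exp (\<alpha> * sqrt (\<epsilon> * s) / (infnorm y + sqrt (s' - s)) *
       \<bar>LINT t:{0..1}|lborel. partial_x i g (s, t)
           (W_tilde W a \<epsilon> (s, t) \<omega>, y + W_eps W a \<epsilon> (s', t) \<omega> - W_eps W a \<epsilon> (s, t) \<omega>)\<bar>))"
  shows "F \<in> borel_measurable M" and "(\<integral>\<^sup>+\<omega>. ennreal (F \<omega>) \<partial>M) \<le> 44"
proof -
  interpret gaussian_space M "sheet_space W" by (rule gaussian_space_sheet[OF M W])
  obtain Dg where Dg: "\<And>p z. p \<in> unit_square \<Longrightarrow> (g p has_derivative blinfun_apply (Dg p z)) (at z)"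
    and Dg_cont: "continuous_on (unit_square \<times> UNIV) (\<lambda>(p, z). Dg p z)"
    using continuous_into_C1_derivative[OF g] by blast
  define D where "D = infnorm y + sqrt (s' - s)"
  define v where "v = \<epsilon> * s"
  have v: "0 < v" using a\<epsilon> s by (simp add: v_def)
  have D: "0 < D" using D_pos by (simp add: D_def)
  define X where "X \<omega> t = W_tilde W a \<epsilon> (s, t) \<omega>" for \<omega> t
  define Y where "Y \<omega> t = y + W_eps W a \<epsilon> (s', t) \<omega> - W_eps W a \<epsilon> (s, t) \<omega>" for \<omega> t
  define f where "f \<omega> t = grad_x i (Dg (s, t) (X \<omega> t, Y \<omega> t))" for \<omega> t
  define J where "J \<omega> = (LINT t:{0..1}|lborel. partial_x i g (s, t) (X \<omega> t, Y \<omega> t))" for \<omega>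
  have F: "F \<omega> = exp (\<alpha> * sqrt v / D * \<bar>J \<omega>\<bar>)" for \<omega>
    by (simp add: F_def J_def X_def Y_def v_def D_def)
  have time: "a + \<epsilon> * t \<in> {0..1}" if "t \<in> {0..1}" for t
  proof -
    have "\<epsilon> * t \<le> \<epsilon> * 1" using that a\<epsilon> by (intro mult_left_mono) auto
    then have "a + \<epsilon> * t \<le> 1" using a\<epsilon> by linarith
    then show ?thesis using that a\<epsilon> by simp
  qed
  have a01: "a \<in> {0..1}" using a\<epsilon> by auto
  have s01: "s \<in> {0..1}" "s' \<in> {0..1}" using s by auto
  have X_cont: "continuous_on {0..1} (X \<omega>)" and Y_cont: "continuous_on {0..1} (Y \<omega>)"
    if "\<omega> \<in> space M" for \<omega>
  proof -
    have "continuous_on {0..1} (\<lambda>t. W (r, a + \<epsilon> * t) \<omega>)" if "r \<in> {0..1}" for r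
    proof (rule continuous_on_compose2[OF sheet_path_continuous[OF W \<open>\<omega> \<in> space M\<close>]])
      show "continuous_on {0..1} (\<lambda>t. (r, a + \<epsilon> * t))" by (intro continuous_intros)
      show "(\<lambda>t. (r, a + \<epsilon> * t)) ` {0..1} \<subseteq> unit_square"
        by (intro image_subsetI SigmaI that time)
    qed
    then show "continuous_on {0..1} (X \<omega>)" "continuous_on {0..1} (Y \<omega>)"
      unfolding X_def Y_def W_tilde_def W_eps_def using s01 by (auto intro!: continuous_intros)
  qed
  have A_cont: "continuous_on ({0..1} \<times> UNIV) (\<lambda>(t, p). Dg (s, t) p)"
  proof -
    have "continuous_on ({0..1} \<times> UNIV) (\<lambda>x. case ((s, fst x), snd x) of (p, z) \<Rightarrow> Dg p z)"
    proof (rule continuous_on_compose2[OF Dg_cont])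
      show "(\<lambda>x. ((s, fst x), snd x)) ` ({0..1} \<times> UNIV) \<subseteq> unit_square \<times> UNIV"
        using s01 by auto
    qed (intro continuous_intros)
    then show ?thesis by (simp add: case_prod_beta)
  qed
  have f_cont: "continuous_on {0..1} (f \<omega>)" if "\<omega> \<in> space M" for \<omega>
  proof -
    have "continuous_on {0..1} (\<lambda>t. Dg (s, t) (X \<omega> t, Y \<omega> t))"
    proof -
      have "continuous_on {0..1} (\<lambda>t. case (t, X \<omega> t, Y \<omega> t) of (t, p) \<Rightarrow> Dg (s, t) p)"
      proof (rule continuous_on_compose2[OF A_cont])
        show "continuous_on {0..1} (\<lambda>t. (t, X \<omega> t, Y \<omega> t))"
          by (intro continuous_intros X_cont[OF that] Y_cont[OF that])
      qed auto
      then show ?thesis by simp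
    qed
    then show ?thesis
      unfolding f_def grad_x_def by (intro continuous_intros)
  qed
  have J: "J \<omega> = integral {0..1} (f \<omega>)" if "\<omega> \<in> space M" for \<omega>
  proof -
    have "J \<omega> = (LINT t:{0..1}|lborel. f \<omega> t)"
      unfolding J_def f_def
    proof (rule set_lebesgue_integral_cong)
      show "\<forall>t. t \<in> {0..1} \<longrightarrow> partial_x i g (s, t) (X \<omega> t, Y \<omega> t) = grad_x i (Dg (s, t) (X \<omega> t, Y \<omega> t))"
        using s01 by (auto intro!: partial_x_eq_grad_x Dg)
    qed simp
    also have "\<dots> = integral {0..1} (f \<omega>)"
      by (intro set_borel_integral_eq_integral(2) borel_integrable_atLeastAtMost' f_cont[OF that])
    finally show ?thesis .
  qed

  \<comment> \<open>the integral is a limit of Riemann sums, each of which is a function of finitely many values of the sheet\<close>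
  have J_meas [measurable]: "J \<in> borel_measurable M"
  proof (rule borel_measurable_LIMSEQ_real)
    show "(\<lambda>\<omega>. \<Sum>k<2 ^ N. 1 / 2 ^ N * f \<omega> (real (Suc k) / 2 ^ N)) \<in> borel_measurable M" for N
    proof (intro borel_measurable_sum borel_measurable_times borel_measurable_const)
      fix k :: nat assume "k \<in> {..<2 ^ N}"
      then have "real (Suc k) \<le> real (2 ^ N)" by (intro of_nat_mono) simp
      then have t: "real (Suc k) / 2 ^ N \<in> {0..1}" by (simp add: field_simps)
      let ?t = "real (Suc k) / 2 ^ N"
      have W_meas: "W (r, a + \<epsilon> * ?t) \<in> borel_measurable M" "W (r, a) \<in> borel_measurable M" if "r \<in> {0..1}" for r
        using that time[OF t] a01 by (auto intro!: borel_measurable_sheet[OF M W])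
      note [measurable] = W_meas[OF s01(1)] W_meas[OF s01(2)]
      have "(\<lambda>\<omega>. (X \<omega> ?t, Y \<omega> ?t)) \<in> borel_measurable M"
        unfolding X_def Y_def W_tilde_def W_eps_def fst_conv snd_conv by measurable
      moreover have "(\<lambda>p. grad_x i (Dg (s, ?t) p)) \<in> borel_measurable borel"
      proof (rule borel_measurable_continuous_onI)
        have "continuous_on UNIV (\<lambda>p. Dg (s, ?t) p)"
        proof -
          have "continuous_on UNIV (\<lambda>p. case (?t, p) of (t, p) \<Rightarrow> Dg (s, t) p)"
          proof (rule continuous_on_compose2[OF A_cont])
            show "range (Pair ?t) \<subseteq> {0..1} \<times> UNIV" using t by blast
          qed (intro continuous_intros)
          then show ?thesis by simp
        qed
        then show "continuous_on UNIV (\<lambda>p. grad_x i (Dg (s, ?t) p))"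
          unfolding grad_x_def by (intro continuous_intros)
      qed
      ultimately show "(\<lambda>\<omega>. f \<omega> ?t) \<in> borel_measurable M"
        unfolding f_def by (rule measurable_compose)
    qed
    show "(\<lambda>N. \<Sum>k<2 ^ N. 1 / 2 ^ N * f \<omega> (real (Suc k) / 2 ^ N)) \<longlonglongrightarrow> J \<omega>" if "\<omega> \<in> space M" for \<omega>
    proof -
      have "(\<lambda>N. \<Sum>k<2 ^ N. 1 / 2 ^ N * f \<omega> (real (Suc k) / 2 ^ N)) \<longlonglongrightarrow> 1 * integral {0..1} (f \<omega>)"
        by (rule dyadic_weighted_sums_tendsto[OF f_cont[OF that]]) (auto simp: power_add)
      then show ?thesis by (simp add: J[OF that])
    qed
  qed
  show F_meas: "F \<in> borel_measurable M"
    unfolding F by measurable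

  define T where "T N k = a + \<epsilon> * (real k / 2 ^ N)" for N k :: nat
  define B where "B N j k \<omega> = W (s, T N k) \<omega> $ j - W (s, a) \<omega> $ j" for N j k \<omega>
  define Z where "Z N j k \<omega> = W (s', T N k) \<omega> $ j - W (s, T N k) \<omega> $ j" for N j k \<omega>
  define h where "h N k = g (s, real k / 2 ^ N)" for N k :: nat
  have t01: "real k / 2 ^ N \<in> {0..1}" if "k \<le> 2 ^ N" for N k
  proof -
    have "real k \<le> real (2 ^ N)" using that by (rule of_nat_mono)
    then show ?thesis by (simp add: field_simps)
  qed
  have T01: "T N k \<in> {0..1}" if "k \<le> 2 ^ N" for N k
    unfolding T_def by (intro time t01 that)
  have T_mono: "T N k \<le> T N l" if "k \<le> l" for N k l
    unfolding T_def using a\<epsilon> that by (intro add_left_mono mult_left_mono divide_right_mono) auto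
  have T_min: "min (T N k) (T N l) = T N (min k l)" for N k l
    using T_mono[of k l N] T_mono[of l k N] by (auto simp: min_def)
  have T_a: "min (T N k) a = a" "min a (T N k) = a" for N k
  proof -
    have "a \<le> T N k" using a\<epsilon> by (simp add: T_def)
    then show "min (T N k) a = a" "min a (T N k) = a" by (simp_all add: min_absorb1 min_absorb2)
  qed
  have s_min: "min s s' = s" "min s' s = s" using s(3) by auto
  have sq: "(s, T N k) \<in> unit_square" "(s', T N k) \<in> unit_square" "(s, a) \<in> unit_square" if "k \<le> 2 ^ N" for N k
    using T01[OF that] a01 s01 by auto
  note inc = cov_sheet_increments[OF M W]
  have walk: "gaussian_walk M (sheet_space W) (B N) (Z N) (2 ^ N) v D y i (h N) \<kappa> \<alpha>" for N
  proof
    show "0 < v" "0 < D" "0 < \<kappa>" "0 < \<alpha>" "48 * real CARD('d) * (\<alpha> * \<kappa>) \<le> 1"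
      by (fact v D \<kappa>(1) \<alpha>)+
    show "(0::nat) < 2 ^ N" by simp
    show "infnorm y \<le> D" unfolding D_def using s by simp
    show "B N j k \<in> sheet_space W" "Z N j k \<in> sheet_space W" if "k \<le> 2 ^ N" for j k
      unfolding B_def Z_def using sq[OF that] by (auto intro!: diff_mem sheet_space_component)
    show "cov (B N i k) (B N i l) = v * real (min k l) / real (2 ^ N)" if "k \<le> 2 ^ N" "l \<le> 2 ^ N" for k l
    proof -
      have "cov (B N i k) (B N i l) = s * T N (min k l) - s * a"
        unfolding B_def inc[OF sq(1)[OF that(1)] sq(3)[OF that(1)] sq(1)[OF that(2)] sq(3)[OF that(2)]]
        by (simp add: sheet_cov_def T_min T_a)
      then show ?thesis by (simp add: T_def v_def distrib_left)
    qed
    show "cov (B N i k) (B N j l) = 0" if "k \<le> 2 ^ N" "l \<le> 2 ^ N" "j \<noteq> i" for k l j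
      unfolding B_def inc[OF sq(1)[OF that(1)] sq(3)[OF that(1)] sq(1)[OF that(2)] sq(3)[OF that(2)]]
      using that by simp
    show "cov (B N i k) (Z N j l) = 0" if "k \<le> 2 ^ N" "l \<le> 2 ^ N" for k l j
      unfolding B_def Z_def inc[OF sq(1)[OF that(1)] sq(3)[OF that(1)] sq(2)[OF that(2)] sq(1)[OF that(2)]]
      by (simp add: sheet_cov_def s_min)
    show "cov (Z N j k) (Z N j k) \<le> D\<^sup>2" if "k \<le> 2 ^ N" for j k
    proof -
      have "cov (Z N j k) (Z N j k) = (s' - s) * T N k"
        unfolding Z_def inc[OF sq(2)[OF that] sq(1)[OF that] sq(2)[OF that] sq(1)[OF that]]
        by (simp add: sheet_cov_def s_min left_diff_distrib)
      also have "\<dots> \<le> (s' - s) * 1" using T01[OF that] s by (intro mult_left_mono) auto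
      also have "\<dots> = (sqrt (s' - s))\<^sup>2" using s by simp
      also have "\<dots> \<le> D\<^sup>2" unfolding D_def using s by (intro power_mono) (auto simp: infnorm_pos_le)
      finally show ?thesis .
    qed
    show "h N k \<in> borel_measurable borel" if "k \<le> 2 ^ N" for k
    proof (rule borel_measurable_continuous_onI)
      have "(s, real k / 2 ^ N) \<in> unit_square" using t01[OF that] s01 by auto
      from Dg[OF this] show "continuous_on UNIV (h N k)"
        unfolding h_def by (intro continuous_at_imp_continuous_on ballI has_derivative_continuous)
    qed
    show "\<bar>h N k (x, z)\<bar> \<le> \<kappa> * infnorm z" if "k \<le> 2 ^ N" for k x z
      unfolding h_def by (intro \<kappa>(2) s01 t01 that)
  qed
  \<comment> \<open>one walk for every dyadic level \<open>N\<close>, with \<open>2 ^ N\<close> steps\<close>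
  interpret walk: gaussian_walk M "sheet_space W" "B N" "Z N" "2 ^ N" v D y i "h N" \<kappa> \<alpha> for N
    by (rule walk)
  define S where "S N \<omega> = (\<Sum>k<2 ^ N. (walk.bwd N k \<omega> - walk.fwd N k \<omega>) * walk.\<Delta> N k \<omega>)" for N \<omega>
  have S_meas [measurable]: "S N \<in> borel_measurable M" for N
    unfolding S_def
    by (intro borel_measurable_sum borel_measurable_times borel_measurable_diff walk.measurable_walk) auto
  have \<Delta>: "walk.\<Delta> N k \<omega> = X \<omega> (real (Suc k) / 2 ^ N) $ i - X \<omega> (real k / 2 ^ N) $ i" for N k \<omega>
    unfolding walk.\<Delta>_def B_def X_def W_tilde_def T_def by simp
  have Bvec: "walk.Bvec N k \<omega> = X \<omega> (real k / 2 ^ N)" for N k \<omega>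
    unfolding walk.Bvec_def B_def X_def W_tilde_def T_def by (simp add: vec_eq_iff)
  have Bmix: "walk.Bmix N k \<omega> = X \<omega> (real (Suc k) / 2 ^ N) - walk.\<Delta> N k \<omega> *\<^sub>R axis i 1" for N k \<omega>
    unfolding walk.Bmix_def \<Delta> vec_eq_iff
    by (auto simp: B_def X_def W_tilde_def T_def axis_def)
  have Zvec: "y + walk.Zvec N k \<omega> = Y \<omega> (real k / 2 ^ N)" for N k \<omega>
    unfolding walk.Zvec_def Z_def Y_def W_eps_def T_def by (simp add: vec_eq_iff)
  have "AE \<omega> in M. \<forall>m j. j < 2 ^ m \<longrightarrow>
      (\<lambda>N. \<Sum>r<2 ^ N. (walk.\<Delta> (N + m) (j * 2 ^ N + r) \<omega>)\<^sup>2) \<longlonglongrightarrow> v / 2 ^ m"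
  proof (rule AE_dyadic_quadratic_variation)
    show "walk.\<Delta> N k \<in> sheet_space W" if "k < 2 ^ N" for N k by (rule walk.\<Delta>_mem[OF that])
    show "cov (walk.\<Delta> N k) (walk.\<Delta> N l) = 0" if "k < 2 ^ N" "l < 2 ^ N" "k \<noteq> l" for N k l
      using walk.cov_\<Delta>_\<Delta>[of k l N] walk.cov_\<Delta>_\<Delta>[of l k N] cov_commute[of "walk.\<Delta> N k" "walk.\<Delta> N l"] that
      by (cases "k < l") auto
    show "cov (walk.\<Delta> N k) (walk.\<Delta> N k) = v / 2 ^ N" if "k < 2 ^ N" for N k
      using walk.cov_\<Delta>_self[OF that] by simp
  qed
  moreover have "AE \<omega> in M. \<omega> \<in> space M" by (rule AE_space)
  ultimately have lim: "AE \<omega> in M. (\<lambda>N. S N \<omega>) \<longlonglongrightarrow> v * J \<omega>"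
  proof eventually_elim
    case (elim \<omega>)
    have "(\<lambda>N. S N \<omega>) \<longlonglongrightarrow> v * integral {0..1} (\<lambda>t. grad_x i (Dg (s, t) (X \<omega> t, Y \<omega> t)))"
      unfolding S_def walk.bwd_def walk.fwd_def Bmix Bvec Zvec h_def \<Delta>
    proof (rule path_covariation_tendsto[where G="\<lambda>t. g (s, t)"])
      show "(g (s, t) has_derivative blinfun_apply (Dg (s, t) p)) (at p)" if "t \<in> {0..1}" for t p
        using that s01 by (intro Dg) auto
    qed (use A_cont X_cont Y_cont elim in \<open>auto simp: \<Delta>\<close>)
    then show ?case by (simp add: J[OF elim(2)] f_def[abs_def])
  qed
  let ?E = "\<lambda>N \<omega>. ennreal (exp (\<alpha> / (sqrt v * D) * \<bar>S N \<omega>\<bar>))"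
  have "(\<integral>\<^sup>+\<omega>. ennreal (F \<omega>) \<partial>M) = (\<integral>\<^sup>+\<omega>. liminf (\<lambda>N. ?E N \<omega>) \<partial>M)"
  proof (rule nn_integral_cong_AE)
    show "AE \<omega> in M. ennreal (F \<omega>) = liminf (\<lambda>N. ?E N \<omega>)"
      using lim
    proof eventually_elim
      case (elim \<omega>)
      have "\<alpha> / (sqrt v * D) * \<bar>v * J \<omega>\<bar> = \<alpha> * sqrt v / D * \<bar>J \<omega>\<bar>"
      proof -
        have "\<alpha> / (sqrt v * D) * \<bar>v * J \<omega>\<bar> = \<alpha> / (sqrt v * D) * ((sqrt v * sqrt v) * \<bar>J \<omega>\<bar>)"
          using v by (simp add: abs_mult)
        also have "\<dots> = \<alpha> * sqrt v / D * \<bar>J \<omega>\<bar>"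
          using v by (simp add: field_simps del: real_sqrt_mult_self)
        finally show ?thesis .
      qed
      moreover have "(\<lambda>N. ?E N \<omega>) \<longlonglongrightarrow> ennreal (exp (\<alpha> / (sqrt v * D) * \<bar>v * J \<omega>\<bar>))"
        by (intro tendsto_ennrealI tendsto_exp tendsto_mult tendsto_const tendsto_rabs elim)
      ultimately have "(\<lambda>N. ?E N \<omega>) \<longlonglongrightarrow> ennreal (F \<omega>)"
        by (simp only: F)
      then show ?case by (rule lim_imp_Liminf[OF sequentially_bot, symmetric])
    qed
  qed
  also have "\<dots> \<le> liminf (\<lambda>N. \<integral>\<^sup>+\<omega>. ?E N \<omega> \<partial>M)"
    by (rule nn_integral_liminf) measurable
  also have "\<dots> \<le> liminf (\<lambda>N. 44)"
    using walk.nn_integral_exp_walk unfolding S_def by (intro Liminf_mono always_eventually allI)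
  also have "\<dots> = 44" by (rule Liminf_const[OF sequentially_bot])
  finally show "(\<integral>\<^sup>+\<omega>. ennreal (F \<omega>) \<partial>M) \<le> 44" .
qed

theorem proposition3p1:
  fixes M :: "'w measure"
    and W :: "real \<times> real \<Rightarrow> 'w \<Rightarrow> real ^ 'd"
    and g :: "real \<times> real \<Rightarrow> (real ^ 'd) \<times> (real ^ 'd) \<Rightarrow> real"
    and a \<epsilon> :: real
  assumes "prob_space M"
    and "brownian_sheet M W"
    and "continuous_into_C1 unit_square g"
    and "\<exists>\<kappa>>0. \<forall>s\<in>{0..1}. \<forall>t\<in>{0..1}. \<forall>x y. \<bar>g (s, t) (x, y)\<bar> \<le> \<kappa> * infnorm y"
    and "0 \<le> a" "a < 1" "0 < \<epsilon>" "\<epsilon> < 1" "a + \<epsilon> \<le> 1"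
  shows "\<exists>\<alpha>>0. \<exists>C>0. \<forall>s\<in>{0<..1}. \<forall>s'\<in>{0<..1}. \<forall>y :: real ^ 'd. \<forall>i.
           s \<le> s' \<and> (s' - s, y) \<noteq> (0, 0) \<longrightarrow>
           (let F = (\<lambda>\<omega>. exp (\<alpha> * sqrt (\<epsilon> * s) / (infnorm y + sqrt (s' - s)) *
                  \<bar>LINT t:{0..1}|lborel.
                     partial_x i g (s, t)
                       (W_tilde W a \<epsilon> (s, t) \<omega>,
                        y + W_eps W a \<epsilon> (s', t) \<omega> - W_eps W a \<epsilon> (s, t) \<omega>)\<bar>))
            in integrable M F \<and> integral\<^sup>L M F \<le> C)"
proof -
  obtain \<kappa> where \<kappa>: "0 < \<kappa>" "\<And>s t x y. s \<in> {0..1} \<Longrightarrow> t \<in> {0..1} \<Longrightarrow> \<bar>g (s, t) (x, y)\<bar> \<le> \<kappa> * infnorm y"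
    using assms(4) by metis
  \<comment> \<open>the largest exponent that the walk estimate allows\<close>
  define \<alpha> where "\<alpha> = 1 / (48 * real CARD('d) * \<kappa>)"
  have \<alpha>: "0 < \<alpha>" "48 * real CARD('d) * (\<alpha> * \<kappa>) \<le> 1"
    using \<kappa>(1) by (auto simp: \<alpha>_def)
  show ?thesis
  proof (rule exI[of _ \<alpha>], rule conjI[OF \<alpha>(1)], rule exI[of _ 44], intro conjI ballI allI impI)
    fix s s' :: real and y :: "real ^ 'd" and i :: 'd
    assume s: "s \<in> {0<..1}" "s' \<in> {0<..1}" and le: "s \<le> s' \<and> (s' - s, y) \<noteq> (0, 0)"
    have D_pos: "0 < infnorm y + sqrt (s' - s)"
    proof (cases "y = 0")
      case True
      with le have "s < s'" by auto
      then show ?thesis using infnorm_pos_le[of y] by (intro add_nonneg_pos) auto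
    next
      case False
      then show ?thesis using le by (intro add_pos_nonneg) (auto simp: infnorm_pos_lt)
    qed
    let ?F = "\<lambda>\<omega>. exp (\<alpha> * sqrt (\<epsilon> * s) / (infnorm y + sqrt (s' - s)) *
       \<bar>LINT t:{0..1}|lborel. partial_x i g (s, t)
           (W_tilde W a \<epsilon> (s, t) \<omega>, y + W_eps W a \<epsilon> (s', t) \<omega> - W_eps W a \<epsilon> (s, t) \<omega>)\<bar>)"
    note bound = sheet_nn_integral_exp_le[OF assms(1-3) \<kappa> assms(5,7,9) s conjunct1[OF le] D_pos \<alpha>, of i]
    have int: "integrable M ?F"
    proof (rule integrableI_bounded[OF bound(1)])
      show "(\<integral>\<^sup>+\<omega>. ennreal (norm (?F \<omega>)) \<partial>M) < \<infinity>"
        using le_less_trans[OF bound(2), of \<infinity>] by simp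
    qed
    have "ennreal (integral\<^sup>L M ?F) = (\<integral>\<^sup>+\<omega>. ennreal (?F \<omega>) \<partial>M)"
      by (rule nn_integral_eq_integral[OF int, symmetric]) simp
    also have "\<dots> \<le> ennreal 44" using bound(2) by simp
    finally have "integral\<^sup>L M ?F \<le> 44" by (subst (asm) ennreal_le_iff) auto
    with int show "let F = ?F in integrable M F \<and> integral\<^sup>L M F \<le> 44"
      unfolding Let_def by (rule conjI)
  qed simp
qed

end
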